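(* Let $\gamma\in\sum_{i\in\mathbb S_0}\mathbb Z_{\ge0}\alpha_i^\vee$. Then $$z_\gamma=\max\{x\in W_0\mid \mathrm{wt}(x,1)\le\gamma\},$$ i.e. the set $\{x\in W_0\mid\mathrm{wt}(x,1)\le\gamma\}$ has a unique maximal element in the Bruhat order, and it is $z_\gamma$.
   Context: $\Sigma$ is a reduced root system with positive roots $\Sigma^+$, simple roots $\alpha_i$ ($i\in\mathbb S_0$), coroots $\alpha^\vee$, Weyl group $W_0$ with simple reflections $s_i$, length function $\ell$ and Bruhat order $\le$. For $\alpha\in\Sigma^+$, $s_\alpha\in W_0$ is the corresponding reflection; $2\rho$ is the sum of the positive roots. For elements $\gamma,\gamma'$ of the coroot lattice, $\gamma'\le\gamma$ means $\gamma-\gamma'\in\sum_{i\in\mathbb S_0}\mathbb Z_{\ge0}\alpha_i^\vee$. Roots are partially ordered by: $\beta'\le\beta$ iff $\beta-\beta'\in\sum_i\mathbb Z_{\ge0}\alpha_i$. Quantum Bruhat graph $\mathrm{QBG}(\Sigma)$: the directed graph with vertex set $W_0$ and edges $x\to xs_\alpha$ ($x\in W_0$, $\alpha\in\Sigma^+$) whenever (1) $\ell(xs_\alpha)=\ell(x)+1$ (a Bruhat edge, of weight $0$), or (2) $\ell(xs_\alpha)=\ell(x)+1-\langle\alpha^\vee,2\rho\rangle$ (a quantum edge, of weight $\alpha^\vee$). The weight of a path is the sum of the weights of its edges. Any two vertices are joined by a path, all shortest paths from $x$ to $x'$ have the same weight, and this common weight is denoted $\mathrm{wt}(x,x')$.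 Demazure product: for $u,v\in W_0$, $u*v$ is the unique maximal element (in Bruhat order) of $\{u'v'\mid u'\le u,\ v'\le v\}$; $*$ is associative. Definition of $z_\gamma\in W_0$ for $\gamma\in\sum_i\mathbb Z_{\ge0}\alpha_i^\vee$, inductively: $z_0=1$; if $\gamma$ is a simple coroot $\alpha_i^\vee$, $z_\gamma=s_i$; otherwise (for $\gamma\ne0$), choose $\beta$ maximal (in the partial order on roots) among the $\beta\in\Sigma^+$ with $\beta^\vee\le\gamma$, and set $z_\gamma=z_{\gamma-\beta^\vee}*s_\beta$. The element $z_\gamma$ does not depend on the choices of $\beta$. *)

theory Defs
  imports "HOL-Analysis.Analysis"
begin

definition coroot :: "'a::euclidean_space \<Rightarrow> 'a" where
  "coroot \<alpha> = (2 / (\<alpha> \<bullet> \<alpha>)) *\<^sub>R \<alpha>"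

definition reflection :: "'a::euclidean_space \<Rightarrow> 'a \<Rightarrow> 'a" where
  "reflection \<alpha> v = v - (coroot \<alpha> \<bullet> v) *\<^sub>R \<alpha>"

definition nat_cone :: "'a::euclidean_space set \<Rightarrow> 'a set" where
  "nat_cone S = {\<Sum>v\<in>S. real (c v) *\<^sub>R v | c :: 'a \<Rightarrow> nat. True}"

(* The ambient space carries a Weyl-invariant inner product, by which it is identified
   with its dual: coroots live in the same space, and the pairing of a coroot with a vector
   is the inner product. The roots are not required to span the ambient space, so that a
   root system in the subspace "span Phi" (in particular the empty one) is covered; the
   Weyl group fixes the orthogonal complement pointwise. *)
locale reduced_root_system =
  fixes \<Phi> :: "'a::euclidean_space set"
  assumes finite_roots: "finite \<Phi>"
    and zero_not_root: "0 \<notin> \<Phi>"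
    and reflection_closed: "\<lbrakk>\<alpha> \<in> \<Phi>; \<beta> \<in> \<Phi>\<rbrakk> \<Longrightarrow> reflection \<alpha> \<beta> \<in> \<Phi>"
    and integral: "\<lbrakk>\<alpha> \<in> \<Phi>; \<beta> \<in> \<Phi>\<rbrakk> \<Longrightarrow> coroot \<alpha> \<bullet> \<beta> \<in> \<int>"
    and reduced: "\<lbrakk>\<alpha> \<in> \<Phi>; c *\<^sub>R \<alpha> \<in> \<Phi>\<rbrakk> \<Longrightarrow> c = 1 \<or> c = - 1"

locale based_root_system = reduced_root_system \<Phi>
  for \<Phi> :: "'a::euclidean_space set" +
  fixes \<Delta> :: "'a set"
  assumes simple_roots: "\<Delta> \<subseteq> \<Phi>"
    and independent_simple: "independent \<Delta>"
    and pos_or_neg: "\<alpha> \<in> \<Phi> \<Longrightarrow> \<alpha> \<in> nat_cone \<Delta> \<or> - \<alpha> \<in> nat_cone \<Delta>"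

definition pos_roots :: "'a::euclidean_space set \<Rightarrow> 'a set \<Rightarrow> 'a set" where
  "pos_roots \<Phi> \<Delta> = \<Phi> \<inter> nat_cone \<Delta>"

definition two_rho :: "'a::euclidean_space set \<Rightarrow> 'a set \<Rightarrow> 'a" where
  "two_rho \<Phi> \<Delta> = (\<Sum>\<alpha>\<in>pos_roots \<Phi> \<Delta>. \<alpha>)"

definition root_le :: "'a::euclidean_space set \<Rightarrow> 'a \<Rightarrow> 'a \<Rightarrow> bool" where
  "root_le \<Delta> \<beta>' \<beta> \<longleftrightarrow> \<beta> - \<beta>' \<in> nat_cone \<Delta>"

definition coroot_le :: "'a::euclidean_space set \<Rightarrow> 'a \<Rightarrow> 'a \<Rightarrow> bool" where
  "coroot_le \<Delta> \<gamma>' \<gamma> \<longleftrightarrow> \<gamma> - \<gamma>' \<in> nat_cone (coroot ` \<Delta>)"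

(* The group generated by the reflections; these are involutions, so inverses need not be
   added. The product of the group is composition. *)
inductive_set weyl_group :: "'a::euclidean_space set \<Rightarrow> ('a \<Rightarrow> 'a) set"
  for \<Phi> :: "'a set" where
  "id \<in> weyl_group \<Phi>"
| "\<lbrakk>w \<in> weyl_group \<Phi>; \<alpha> \<in> \<Phi>\<rbrakk> \<Longrightarrow> w \<circ> reflection \<alpha> \<in> weyl_group \<Phi>"

definition weyl_length :: "'a::euclidean_space set \<Rightarrow> ('a \<Rightarrow> 'a) \<Rightarrow> nat" where
  "weyl_length \<Delta> w =
     (LEAST n. \<exists>as. set as \<subseteq> \<Delta> \<and> length as = n \<and> w = foldr (\<lambda>\<alpha> f. reflection \<alpha> \<circ> f) as id)"

definition bruhat_le ::
  "'a::euclidean_space set \<Rightarrow> 'a set \<Rightarrow> ('a \<Rightarrow> 'a) \<Rightarrow> ('a \<Rightarrow> 'a) \<Rightarrow> bool" where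
  "bruhat_le \<Phi> \<Delta> =
     (\<lambda>x y. x \<in> weyl_group \<Phi> \<and> weyl_length \<Delta> x < weyl_length \<Delta> y \<and>
            (\<exists>\<alpha>\<in>pos_roots \<Phi> \<Delta>. y = x \<circ> reflection \<alpha>))\<^sup>*\<^sup>*"

definition unique_maximal :: "('b \<Rightarrow> 'b \<Rightarrow> bool) \<Rightarrow> 'b set \<Rightarrow> 'b \<Rightarrow> bool" where
  "unique_maximal le S m \<longleftrightarrow>
     (\<forall>x. (x \<in> S \<and> (\<forall>y\<in>S. le x y \<longrightarrow> y = x)) \<longleftrightarrow> x = m)"

definition demazure ::
  "'a::euclidean_space set \<Rightarrow> 'a set \<Rightarrow> ('a \<Rightarrow> 'a) \<Rightarrow> ('a \<Rightarrow> 'a) \<Rightarrow> ('a \<Rightarrow> 'a)" where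
  "demazure \<Phi> \<Delta> u v =
     (THE w. unique_maximal (bruhat_le \<Phi> \<Delta>)
        {u' \<circ> v' | u' v'. u' \<in> weyl_group \<Phi> \<and> v' \<in> weyl_group \<Phi> \<and>
                           bruhat_le \<Phi> \<Delta> u' u \<and> bruhat_le \<Phi> \<Delta> v' v} w)"

(* qbg_edge Phi Delta x w y: there is an edge from x to y of weight w *)
inductive qbg_edge ::
  "'a::euclidean_space set \<Rightarrow> 'a set \<Rightarrow> ('a \<Rightarrow> 'a) \<Rightarrow> 'a \<Rightarrow> ('a \<Rightarrow> 'a) \<Rightarrow> bool"
  for \<Phi> \<Delta> :: "'a set" where
  bruhat_edge:
  "\<lbrakk>x \<in> weyl_group \<Phi>; \<alpha> \<in> pos_roots \<Phi> \<Delta>;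
    weyl_length \<Delta> (x \<circ> reflection \<alpha>) = weyl_length \<Delta> x + 1\<rbrakk>
   \<Longrightarrow> qbg_edge \<Phi> \<Delta> x 0 (x \<circ> reflection \<alpha>)"
| quantum_edge:
  "\<lbrakk>x \<in> weyl_group \<Phi>; \<alpha> \<in> pos_roots \<Phi> \<Delta>;
    real (weyl_length \<Delta> (x \<circ> reflection \<alpha>)) =
      real (weyl_length \<Delta> x) + 1 - coroot \<alpha> \<bullet> two_rho \<Phi> \<Delta>\<rbrakk>
   \<Longrightarrow> qbg_edge \<Phi> \<Delta> x (coroot \<alpha>) (x \<circ> reflection \<alpha>)"

(* qbg_path Phi Delta x n w y: there is a path from x to y with n edges and weight w *)
inductive qbg_path ::
  "'a::euclidean_space set \<Rightarrow> 'a set \<Rightarrow> ('a \<Rightarrow> 'a) \<Rightarrow> nat \<Rightarrow> 'a \<Rightarrow> ('a \<Rightarrow> 'a) \<Rightarrow> bool"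
  for \<Phi> \<Delta> :: "'a set" where
  "x \<in> weyl_group \<Phi> \<Longrightarrow> qbg_path \<Phi> \<Delta> x 0 0 x"
| "\<lbrakk>qbg_edge \<Phi> \<Delta> x \<omega> y; qbg_path \<Phi> \<Delta> y n \<omega>' z\<rbrakk>
   \<Longrightarrow> qbg_path \<Phi> \<Delta> x (Suc n) (\<omega> + \<omega>') z"

definition wt ::
  "'a::euclidean_space set \<Rightarrow> 'a set \<Rightarrow> ('a \<Rightarrow> 'a) \<Rightarrow> ('a \<Rightarrow> 'a) \<Rightarrow> 'a" where
  "wt \<Phi> \<Delta> x y =
     (THE \<omega>. \<exists>n. qbg_path \<Phi> \<Delta> x n \<omega> y \<and> (\<forall>m \<omega>'. qbg_path \<Phi> \<Delta> x m \<omega>' y \<longrightarrow> n \<le> m))"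

definition maximal_root_below ::
  "'a::euclidean_space set \<Rightarrow> 'a set \<Rightarrow> 'a \<Rightarrow> 'a \<Rightarrow> bool" where
  "maximal_root_below \<Phi> \<Delta> \<gamma> \<beta> \<longleftrightarrow>
     \<beta> \<in> pos_roots \<Phi> \<Delta> \<and> coroot_le \<Delta> (coroot \<beta>) \<gamma> \<and>
     (\<forall>\<beta>'\<in>pos_roots \<Phi> \<Delta>. coroot_le \<Delta> (coroot \<beta>') \<gamma> \<and> root_le \<Delta> \<beta> \<beta>' \<longrightarrow> \<beta>' = \<beta>)"

(* z_value Phi Delta g w: some sequence of choices of maximal roots in the recursion
   computing z at g yields w. The value does not depend on the choices, which justifies
   the definite description in z_elt. *)
inductive z_value ::
  "'a::euclidean_space set \<Rightarrow> 'a set \<Rightarrow> 'a \<Rightarrow> ('a \<Rightarrow> 'a) \<Rightarrow> bool"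
  for \<Phi> \<Delta> :: "'a set" where
  "z_value \<Phi> \<Delta> 0 id"
| "\<alpha> \<in> \<Delta> \<Longrightarrow> z_value \<Phi> \<Delta> (coroot \<alpha>) (reflection \<alpha>)"
| "\<lbrakk>\<gamma> \<in> nat_cone (coroot ` \<Delta>); \<gamma> \<noteq> 0; \<gamma> \<notin> coroot ` \<Delta>;
    maximal_root_below \<Phi> \<Delta> \<gamma> \<beta>; z_value \<Phi> \<Delta> (\<gamma> - coroot \<beta>) w\<rbrakk>
   \<Longrightarrow> z_value \<Phi> \<Delta> \<gamma> (demazure \<Phi> \<Delta> w (reflection \<beta>))"

definition z_elt :: "'a::euclidean_space set \<Rightarrow> 'a set \<Rightarrow> 'a \<Rightarrow> ('a \<Rightarrow> 'a)" where
  "z_elt \<Phi> \<Delta> \<gamma> = (THE w. z_value \<Phi> \<Delta> \<gamma> w)"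

end

theory Submission
  imports Defs
begin

text \<open>Write s \<beta> for the reflection in a root, \<star> for the Demazure product,
  and call an element bounded by \<gamma> if it lies below a Demazure product of reflections in
  positive roots whose coroots add up to at most \<gamma>. The proof shows that, for an element \<open>x\<close>,
  having weight at most \<gamma>, being the source of a path to the identity of weight at most \<gamma>, and
  being bounded by \<gamma> are the same thing, and that the elements bounded by \<gamma> form a lower
  interval of the Bruhat order whose top is \<open>z_elt \<Phi> \<Delta> \<gamma>\<close>.

  Among the weights of all paths between two vertices there is a smallest one (\<open>path_has_min\<close>);
  it is the weight of every shortest path, since the length of a path is determined by its weight and
  its endpoints. This minimum exists for the following reason. Left multiplication
  by a simple reflection, or by the reflection in a maximal root (the linear part of an additional
  simple reflection of the affine Weyl group), maps edges to edges, except for those edges that are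
  themselves such a left multiplication (\<open>edge_crossing\<close>, \<open>edge_parallel\<close>). So a pair of vertices can
  be moved around without changing its set of weights by more than a translation, and the distance
  drops as soon as the root is positive at the first vertex and negative at the second one. By an averaging argument
  (\<open>raise_closed_id\<close>) the first vertex can be moved to the identity, where the distance does drop.

  Paths and bounded elements are related as follows. Along a path, a Bruhat edge goes up, and a
  quantum edge costs one reflection with the right coroot, so the source of a path to the identity is
  bounded by its weight (\<open>path_bounded\<close>). Conversely a path from \<open>v\<close> to the identity can be
  translated to a path from u \<star> v to \<open>u\<close> of the same weight (\<open>dem_path\<close>).

  The heart of the matter is that there is a largest element bounded by \<gamma>. Instead of maximal
  roots, the existence proof uses simple ones. If \<gamma> is not zero, some simple root \<open>a\<close> has positive
  pairing with \<gamma>, as \<gamma> \<bullet> \<gamma> > 0. If \<open>y\<close> is the largest element bounded by \<gamma> - coroot a, then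
  s a \<star> y \<star> s a is bounded by \<gamma> (\<open>top_member\<close>) and above every element that is bounded by \<gamma>
  (\<open>top_upper\<close>). This recursion along simple roots is then compared with the recursion along a maximal
  root \<beta> that defines \<open>z_elt\<close>: if \<gamma> - coroot \<beta> is not zero, it pairs positively with some simple
  root \<open>a\<close>; maximality makes \<open>s a\<close> and s \<beta> commute, and both recursions can be interchanged
  (\<open>step_maximal\<close>). If \<gamma> = coroot \<beta>, then \<beta> is the label of a quantum edge, and the
  recursion along simple roots unwinds the reflection in \<beta> (\<open>step_quantum_root\<close>).\<close>

section \<open>Reflections\<close>

lemma linear_reflection: "linear (reflection \<alpha>)"
  by (rule linearI) (auto simp: reflection_def inner_add_right algebra_simps)

lemma reflection_uminus_root [simp]: "reflection (- \<alpha>) = reflection \<alpha>"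
  by (rule ext) (simp add: reflection_def coroot_def)

lemma coroot_uminus [simp]: "coroot (- \<alpha>) = - coroot \<alpha>"
  by (simp add: coroot_def)

lemma coroot_self [simp]: "\<alpha> \<noteq> 0 \<Longrightarrow> coroot \<alpha> \<bullet> \<alpha> = 2"
  by (simp add: coroot_def)

lemma reflection_self: "\<alpha> \<noteq> 0 \<Longrightarrow> reflection \<alpha> \<alpha> = - \<alpha>"
  by (simp add: reflection_def scaleR_2)

lemma reflection_invol [simp]: "reflection \<alpha> (reflection \<alpha> v) = v"
proof (cases "\<alpha> = 0")
  case False
  then show ?thesis
    by (simp add: reflection_def inner_diff_right algebra_simps scaleR_2)
qed (simp add: reflection_def)

lemma reflection_comp_self [simp]: "reflection \<alpha> \<circ> reflection \<alpha> = id"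
  by (rule ext) simp

lemma reflection_comp_comp_self [simp]:
  "reflection \<alpha> \<circ> (reflection \<alpha> \<circ> w) = w" "(w \<circ> reflection \<alpha>) \<circ> reflection \<alpha> = w"
  by (simp_all add: fun_eq_iff)

lemma inner_coroot_sym: "coroot \<alpha> \<bullet> v = 2 * (\<alpha> \<bullet> v) / (\<alpha> \<bullet> \<alpha>)"
  by (simp add: coroot_def)

lemma reflection_isometry: "reflection \<alpha> u \<bullet> reflection \<alpha> v = u \<bullet> v"
proof (cases "\<alpha> = 0")
  case False
  then have "\<alpha> \<bullet> \<alpha> \<noteq> 0" by simp
  then show ?thesis
    by (simp add: reflection_def coroot_def inner_diff_left inner_diff_right inner_commute[of v \<alpha>]
      inner_commute[of u \<alpha>] field_simps)
qed (simp add: reflection_def)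

lemma bij_reflection: "bij (reflection \<alpha>)"
  by (metis reflection_comp_self o_bij)

lemma inv_reflection [simp]: "inv (reflection \<alpha>) = reflection \<alpha>"
  by (simp add: inv_equality)

lemma coroot_isometry:
  assumes "linear w" "\<And>u v. w u \<bullet> w v = u \<bullet> v"
  shows "coroot (w \<alpha>) = w (coroot \<alpha>)"
  using assms by (simp add: coroot_def linear_scale)

text \<open>Isometries conjugate reflections to reflections; this is the source of all commutation rules in
  the Weyl group.\<close>

lemma reflection_conj:
  assumes "linear w" "\<And>u v. w u \<bullet> w v = u \<bullet> v"
  shows "w (reflection \<alpha> v) = reflection (w \<alpha>) (w v)"
  using assms coroot_isometry[OF assms]
  by (simp add: reflection_def linear_diff linear_scale)

lemma coroot_reflection: "coroot (reflection \<alpha> \<beta>) = coroot \<beta> - (coroot \<beta> \<bullet> \<alpha>) *\<^sub>R coroot \<alpha>"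
proof -
  have "coroot (reflection \<alpha> \<beta>) = reflection \<alpha> (coroot \<beta>)"
    by (rule coroot_isometry[OF linear_reflection reflection_isometry])
  also have "\<dots> = coroot \<beta> - (coroot \<beta> \<bullet> \<alpha>) *\<^sub>R coroot \<alpha>"
    by (simp add: reflection_def coroot_def[of \<alpha>] inner_commute[of "coroot \<beta>" \<alpha>])
  finally show ?thesis .
qed

lemma coroot_pairing_sign:
  assumes "\<alpha> \<noteq> 0"
  shows "coroot \<alpha> \<bullet> v > 0 \<longleftrightarrow> \<alpha> \<bullet> v > 0" "coroot \<alpha> \<bullet> v < 0 \<longleftrightarrow> \<alpha> \<bullet> v < 0"
    "coroot \<alpha> \<bullet> v = 0 \<longleftrightarrow> \<alpha> \<bullet> v = 0"
proof -
  have "\<alpha> \<bullet> \<alpha> > 0" using assms by simp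
  moreover have "\<not> \<alpha> \<bullet> \<alpha> < 0" using inner_ge_zero[of \<alpha>] by linarith
  ultimately show "coroot \<alpha> \<bullet> v > 0 \<longleftrightarrow> \<alpha> \<bullet> v > 0" "coroot \<alpha> \<bullet> v < 0 \<longleftrightarrow> \<alpha> \<bullet> v < 0"
    "coroot \<alpha> \<bullet> v = 0 \<longleftrightarrow> \<alpha> \<bullet> v = 0"
    by (simp_all add: inner_coroot_sym zero_less_divide_iff divide_less_0_iff)
qed

lemma coroot_eq_iff:
  assumes "\<alpha> \<noteq> 0" "\<beta> \<noteq> 0" shows "coroot \<alpha> = coroot \<beta> \<longleftrightarrow> \<alpha> = \<beta>"
proof
  have twice: "(2 / (coroot \<gamma> \<bullet> coroot \<gamma>)) *\<^sub>R coroot \<gamma> = \<gamma>" if "\<gamma> \<noteq> 0" for \<gamma> :: 'a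
    using that by (simp add: coroot_def)
  show "coroot \<alpha> = coroot \<beta> \<Longrightarrow> \<alpha> = \<beta>"
    by (metis assms twice)
qed simp

lemma unique_maximal_unique: "unique_maximal ord S m \<Longrightarrow> unique_maximal ord S w \<Longrightarrow> w = m"
  unfolding unique_maximal_def by metis

section \<open>Nonnegative integral combinations\<close>

lemma nat_coneI: "v = (\<Sum>a\<in>S. real (c a) *\<^sub>R a) \<Longrightarrow> v \<in> nat_cone S"
  unfolding nat_cone_def by auto

lemma nat_coneE:
  assumes "v \<in> nat_cone S" obtains c where "v = (\<Sum>a\<in>S. real (c a) *\<^sub>R a)"
  using assms unfolding nat_cone_def by auto

lemma nat_cone_zero [simp, intro]: "0 \<in> nat_cone S"
  by (rule nat_coneI[of _ "\<lambda>_. 0"]) simp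

lemma nat_cone_add: "u \<in> nat_cone S \<Longrightarrow> v \<in> nat_cone S \<Longrightarrow> u + v \<in> nat_cone S"
proof (elim nat_coneE)
  fix c d
  assume "u = (\<Sum>a\<in>S. real (c a) *\<^sub>R a)" "v = (\<Sum>a\<in>S. real (d a) *\<^sub>R a)"
  then show "u + v \<in> nat_cone S"
    by (intro nat_coneI[of _ "\<lambda>a. c a + d a"]) (simp add: scaleR_add_left sum.distrib)
qed

lemma nat_cone_scale: "v \<in> nat_cone S \<Longrightarrow> real n *\<^sub>R v \<in> nat_cone S"
proof (elim nat_coneE)
  fix c assume "v = (\<Sum>a\<in>S. real (c a) *\<^sub>R a)"
  then show ?thesis
    by (intro nat_coneI[of _ "\<lambda>a. n * c a"]) (simp add: scaleR_sum_right)
qed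

lemma nat_cone_base:
  assumes "finite S" "a \<in> S" shows "a \<in> nat_cone S"
proof (rule nat_coneI)
  have "(\<Sum>b\<in>S. real (of_bool (b = a)) *\<^sub>R b) = (\<Sum>b\<in>S. if b = a then a else 0)"
    by (rule sum.cong) auto
  then show "a = (\<Sum>b\<in>S. real (of_bool (b = a)) *\<^sub>R b)" using assms by simp
qed

lemma nat_cone_sum_list: "(\<And>v. v \<in> set vs \<Longrightarrow> v \<in> nat_cone S) \<Longrightarrow> sum_list vs \<in> nat_cone S"
  by (induction vs) (auto intro: nat_cone_add)

lemma Ints_nonneg_scale_nat_cone:
  assumes "k \<in> \<int>" "0 \<le> k" "v \<in> nat_cone S" shows "k *\<^sub>R v \<in> nat_cone S"
proof -
  obtain n :: nat where "k = real n"
    using assms(1,2) by (auto simp: Ints_def) (metis nonneg_int_cases of_int_of_nat_eq)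
  then show ?thesis using assms(3) nat_cone_scale by auto
qed

section \<open>Positive roots and simple reflections\<close>

context based_root_system
begin

abbreviation s :: "'a \<Rightarrow> 'a \<Rightarrow> 'a" where "s \<equiv> reflection"
abbreviation P :: "'a set" where "P \<equiv> pos_roots \<Phi> \<Delta>"
abbreviation rho2 :: 'a where "rho2 \<equiv> two_rho \<Phi> \<Delta>"
abbreviation max_below :: "'a \<Rightarrow> 'a \<Rightarrow> bool" where "max_below \<equiv> maximal_root_below \<Phi> \<Delta>"
abbreviation W :: "('a \<Rightarrow> 'a) set" where "W \<equiv> weyl_group \<Phi>"
abbreviation len :: "('a \<Rightarrow> 'a) \<Rightarrow> nat" where "len \<equiv> weyl_length \<Delta>"
abbreviation le :: "('a \<Rightarrow> 'a) \<Rightarrow> ('a \<Rightarrow> 'a) \<Rightarrow> bool" (infix "\<preceq>" 50) where "le \<equiv> bruhat_le \<Phi> \<Delta>"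
abbreviation RC :: "'a set" where "RC \<equiv> nat_cone \<Delta>"
abbreviation QC :: "'a set" where "QC \<equiv> nat_cone (coroot ` \<Delta>)"

lemma finite_simple: "finite \<Delta>"
  using finite_roots simple_roots finite_subset by blast

lemma finite_pos: "finite P"
  using finite_roots by (auto simp: pos_roots_def)

lemma root_nonzero: "\<alpha> \<in> \<Phi> \<Longrightarrow> \<alpha> \<noteq> 0"
  using zero_not_root by auto

lemma root_uminus: "\<alpha> \<in> \<Phi> \<Longrightarrow> - \<alpha> \<in> \<Phi>"
  using reflection_closed[of \<alpha> \<alpha>] reflection_self[of \<alpha>] root_nonzero by auto

lemma pos_root: "\<beta> \<in> P \<Longrightarrow> \<beta> \<in> \<Phi>"
  by (simp add: pos_roots_def)

lemma simple_pos: "a \<in> \<Delta> \<Longrightarrow> a \<in> P"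
  using simple_roots nat_cone_base[OF finite_simple] by (auto simp: pos_roots_def)

lemma simple_root: "a \<in> \<Delta> \<Longrightarrow> a \<in> \<Phi>"
  using simple_roots by auto

lemma pos_nonzero: "\<beta> \<in> P \<Longrightarrow> \<beta> \<noteq> 0"
  using pos_root root_nonzero by blast

text \<open>The dual basis of the simple roots. The simple roots need not span the ambient space, so the
  coordinates are extended to all of it by some linear map; only their values on the span matter.\<close>

definition coord :: "'a \<Rightarrow> 'a \<Rightarrow> real" where
  "coord a = (SOME f. linear f \<and> (\<forall>b\<in>\<Delta>. f b = of_bool (b = a)))"

lemma coord_spec: "linear (coord a) \<and> (\<forall>b\<in>\<Delta>. coord a b = of_bool (b = a))"
proof -
  obtain g where "linear g" "\<And>b. b \<in> \<Delta> \<Longrightarrow> g b = (of_bool (b = a) :: real)"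
    using linear_independent_extend[OF independent_simple, of "\<lambda>b. of_bool (b = a) :: real"] by blast
  then have "linear g \<and> (\<forall>b\<in>\<Delta>. g b = of_bool (b = a))" by blast
  then show ?thesis unfolding coord_def
    by (rule someI[where P = "\<lambda>f. linear f \<and> (\<forall>b\<in>\<Delta>. f b = of_bool (b = a))"])
qed

lemma linear_coord: "linear (coord a)" using coord_spec by blast

lemma coord_simple: "b \<in> \<Delta> \<Longrightarrow> coord a b = of_bool (b = a)" using coord_spec by blast

lemmas coord_linear = linear_add[OF linear_coord] linear_diff[OF linear_coord] linear_scale[OF linear_coord]
  linear_neg[OF linear_coord] linear_0[OF linear_coord] linear_sum[OF linear_coord]

lemma coord_combination:
  assumes "a \<in> \<Delta>" shows "coord a (\<Sum>b\<in>\<Delta>. g b *\<^sub>R b) = g a"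
proof -
  have "coord a (\<Sum>b\<in>\<Delta>. g b *\<^sub>R b) = (\<Sum>b\<in>\<Delta>. if b = a then g a else 0)"
    by (auto simp: coord_linear coord_simple intro!: sum.cong)
  then show ?thesis using assms finite_simple by simp
qed

lemma coord_cone_nonneg: "v \<in> RC \<Longrightarrow> a \<in> \<Delta> \<Longrightarrow> coord a v \<ge> 0"
  by (erule nat_coneE) (simp add: coord_combination)

lemma cone_expand:
  assumes "v \<in> RC" shows "v = (\<Sum>b\<in>\<Delta>. coord b v *\<^sub>R b)"
proof -
  obtain c where c: "v = (\<Sum>a\<in>\<Delta>. real (c a) *\<^sub>R a)" using assms by (rule nat_coneE)
  then have "coord b v = real (c b)" if "b \<in> \<Delta>" for b using that by (simp add: coord_combination)
  then have "(\<Sum>b\<in>\<Delta>. coord b v *\<^sub>R b) = (\<Sum>a\<in>\<Delta>. real (c a) *\<^sub>R a)" by (intro sum.cong) auto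
  then show ?thesis using c by metis
qed

lemma cone_pointed:
  assumes "v \<in> RC" "- v \<in> RC" shows "v = 0"
proof -
  have "coord b v = 0" if "b \<in> \<Delta>" for b
    using coord_cone_nonneg[OF assms(1) that] coord_cone_nonneg[OF assms(2) that] by (simp add: coord_linear)
  then show ?thesis using cone_expand[OF assms(1)] by simp
qed

lemma pos_uminus: "\<alpha> \<in> \<Phi> \<Longrightarrow> - \<alpha> \<in> P \<longleftrightarrow> \<alpha> \<notin> P"
  using pos_or_neg[of \<alpha>] cone_pointed[of \<alpha>] root_nonzero[of \<alpha>] root_uminus[of \<alpha>]
  by (auto simp: pos_roots_def)

lemma pos_not_neg: "\<beta> \<in> P \<Longrightarrow> - \<beta> \<notin> P"
  using pos_uminus pos_root by blast

lemma coord_pos: "\<beta> \<in> P \<Longrightarrow> a \<in> \<Delta> \<Longrightarrow> coord a \<beta> \<ge> 0"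
  by (auto simp: pos_roots_def intro: coord_cone_nonneg)

lemma pos_if_coord_pos:
  assumes "\<alpha> \<in> \<Phi>" "a \<in> \<Delta>" "coord a \<alpha> > 0" shows "\<alpha> \<in> P"
  using coord_pos[of "- \<alpha>" a] pos_uminus[of \<alpha>] assms by (auto simp: coord_linear)

lemma pos_if_sum:
  assumes "\<alpha> \<in> \<Phi>" "\<beta> \<in> P" "\<alpha> - \<beta> \<in> RC" shows "\<alpha> \<in> P"
  using nat_cone_add[of \<beta> \<Delta> "\<alpha> - \<beta>"] assms by (auto simp: pos_roots_def)

text \<open>Since the root system is reduced, a positive root other than \<open>a\<close> is not a multiple of \<open>a\<close>.
  The second coordinate found here certifies the sign of the root after the coefficient of \<open>a\<close> has
  been changed.\<close>

lemma pos_other_simple: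
  assumes "\<beta> \<in> P" "a \<in> \<Delta>" "\<beta> \<noteq> a" shows "\<exists>b\<in>\<Delta>. b \<noteq> a \<and> coord b \<beta> > 0"
proof (rule ccontr)
  assume "\<not> ?thesis"
  then have z: "coord b \<beta> = 0" if "b \<in> \<Delta>" "b \<noteq> a" for b
    using that coord_pos[OF assms(1), of b] by force
  have "\<beta> = (\<Sum>b\<in>\<Delta>. coord b \<beta> *\<^sub>R b)" using assms(1) by (intro cone_expand) (simp add: pos_roots_def)
  also have "\<dots> = (\<Sum>b\<in>\<Delta>. if b = a then coord a \<beta> *\<^sub>R a else 0)"
    using z by (intro sum.cong) auto
  also have "\<dots> = coord a \<beta> *\<^sub>R a" using assms(2) finite_simple by simp
  finally have eq: "\<beta> = coord a \<beta> *\<^sub>R a" .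
  then have "coord a \<beta> = 1 \<or> coord a \<beta> = - 1"
    using reduced[of a "coord a \<beta>"] pos_root[OF assms(1)] simple_root[OF assms(2)] by auto
  then show False
    using eq coord_pos[OF assms(1,2)] assms(3) by (metis not_one_le_zero neg_0_le_iff_le scaleR_one)
qed

lemma reflection_root: "\<alpha> \<in> \<Phi> \<Longrightarrow> \<beta> \<in> \<Phi> \<Longrightarrow> s \<alpha> \<beta> \<in> \<Phi>"
  by (rule reflection_closed)

text \<open>A simple reflection changes only the coordinate at its own root, so a positive root other than
  this one keeps a positive coordinate.\<close>

lemma simple_reflection_pos:
  assumes "\<beta> \<in> P" "a \<in> \<Delta>" "\<beta> \<noteq> a" shows "s a \<beta> \<in> P"
proof -
  obtain b where b: "b \<in> \<Delta>" "b \<noteq> a" "coord b \<beta> > 0" using pos_other_simple[OF assms] by blast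
  have "coord b (s a \<beta>) = coord b \<beta>"
    using assms(2) b(1,2) by (simp add: reflection_def coord_linear coord_simple)
  then show ?thesis
    using b assms reflection_root simple_root pos_root pos_if_coord_pos by metis
qed

lemma simple_reflection_not_simple:
  assumes "\<beta> \<in> P" "a \<in> \<Delta>" "\<beta> \<noteq> a" shows "s a \<beta> \<noteq> a"
proof
  assume "s a \<beta> = a"
  then have "\<beta> = - a" using assms(2) root_nonzero simple_root reflection_self by (metis reflection_invol)
  then show False using assms(1,2) pos_not_neg simple_pos by (metis)
qed

lemma pairing_nonpos_simple:
  assumes "a \<in> \<Delta>" "b \<in> \<Delta>" "a \<noteq> b" shows "a \<bullet> b \<le> 0"
proof -
  have "s b a \<in> P" using assms simple_pos simple_reflection_pos by blast
  then have "coord b (s b a) \<ge> 0" using assms coord_pos by blast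
  then have "coroot b \<bullet> a \<le> 0"
    using assms by (simp add: reflection_def coord_linear coord_simple)
  then show ?thesis
    using coroot_pairing_sign(1)[of b a] assms root_nonzero simple_root
    by (metis inner_commute linorder_not_le)
qed

definition height :: "'a \<Rightarrow> real" where "height v = (\<Sum>a\<in>\<Delta>. coord a v)"

lemma linear_height: "linear height"
  unfolding height_def by (intro linear_compose_sum ballI linear_coord)

lemmas height_linear = linear_add[OF linear_height] linear_diff[OF linear_height]
  linear_scale[OF linear_height] linear_neg[OF linear_height] linear_0[OF linear_height]
  linear_sum[OF linear_height]

lemma height_simple: "a \<in> \<Delta> \<Longrightarrow> height a = 1"
  using finite_simple by (simp add: height_def coord_simple of_bool_def)

lemma height_cone: "v \<in> RC \<Longrightarrow> height v \<in> \<nat>"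
proof (erule nat_coneE)
  fix c assume "v = (\<Sum>a\<in>\<Delta>. real (c a) *\<^sub>R a)"
  then have "height v = (\<Sum>a\<in>\<Delta>. real (c a))" unfolding height_def by (simp add: coord_combination)
  then have "height v = real (\<Sum>a\<in>\<Delta>. c a)" by simp
  then show ?thesis by (metis of_nat_in_Nats)
qed

lemma height_cone_pos:
  assumes "v \<in> RC" "v \<noteq> 0" shows "height v > 0"
proof -
  obtain a where "a \<in> \<Delta>" "coord a v \<noteq> 0" using cone_expand[OF assms(1)] assms(2)
    by (metis (no_types, lifting) scale_eq_0_iff sum.neutral)
  then show ?thesis unfolding height_def
    using coord_cone_nonneg[OF assms(1)] finite_simple
    by (intro sum_pos2[of _ a]) (auto simp: order_less_le)
qed

lemma height_pos: "\<beta> \<in> P \<Longrightarrow> height \<beta> > 0"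
  using height_cone_pos pos_nonzero by (auto simp: pos_roots_def)

lemma pos_pairing_simple_exists:
  assumes "\<beta> \<in> P" shows "\<exists>a\<in>\<Delta>. coroot \<beta> \<bullet> a > 0"
proof (rule ccontr)
  assume "\<not> ?thesis"
  then have n: "coroot \<beta> \<bullet> a \<le> 0" if "a \<in> \<Delta>" for a using that by force
  have "coroot \<beta> \<bullet> \<beta> = (\<Sum>a\<in>\<Delta>. coord a \<beta> * (coroot \<beta> \<bullet> a))"
    using cone_expand[of \<beta>] assms
    by (metis (no_types, lifting) IntD2 inner_scaleR_right inner_sum_right pos_roots_def sum.cong)
  also have "\<dots> \<le> 0" using n coord_pos[OF assms] by (intro sum_nonpos) (simp add: mult_nonneg_nonpos)
  finally show False using pos_nonzero[OF assms] by simp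
qed

text \<open>A positive root pairs positively with some simple root because it pairs positively with itself;
  reflecting in this simple root lowers the height, unless both roots agree.\<close>

lemma pos_root_induct [consumes 1, case_names simple reflect]:
  assumes "\<beta> \<in> P"
    and simple: "\<And>a. a \<in> \<Delta> \<Longrightarrow> Q a"
    and reflect: "\<And>\<beta> a. \<lbrakk>\<beta> \<in> P; a \<in> \<Delta>; \<beta> \<noteq> a; coroot \<beta> \<bullet> a > 0; s a \<beta> \<in> P;
                   Q (s a \<beta>)\<rbrakk> \<Longrightarrow> Q \<beta>"
  shows "Q \<beta>"
  using assms(1)
proof (induction "nat \<lfloor>height \<beta>\<rfloor>" arbitrary: \<beta> rule: less_induct)
  case (less \<beta>)
  obtain a where a: "a \<in> \<Delta>" "coroot \<beta> \<bullet> a > 0" using pos_pairing_simple_exists less.prems by blast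
  show ?case
  proof (cases "\<beta> = a")
    case False
    have p: "s a \<beta> \<in> P" using less.prems a False simple_reflection_pos by blast
    have "a \<bullet> \<beta> > 0" using a coroot_pairing_sign(1)[of \<beta> a] pos_nonzero[OF less.prems]
      by (simp add: inner_commute)
    then have "coroot a \<bullet> \<beta> > 0"
      using coroot_pairing_sign(1)[of a \<beta>] a simple_root root_nonzero by blast
    then have "height (s a \<beta>) < height \<beta>"
      using a by (simp add: reflection_def height_linear height_simple)
    moreover have "height (s a \<beta>) \<in> \<nat>" "height \<beta> \<in> \<nat>"
      using p less.prems height_cone by (auto simp: pos_roots_def)
    ultimately have "nat \<lfloor>height (s a \<beta>)\<rfloor> < nat \<lfloor>height \<beta>\<rfloor>"
      by (auto simp: Nats_def)
    then show ?thesis using less.hyps[OF _ p] reflect[OF less.prems a(1) False a(2) p] by blast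
  qed (use a simple in blast)
qed

lemma finite_simple_coroots: "finite (coroot ` \<Delta>)"
  using finite_simple by simp

lemma simple_coroot_QC: "a \<in> \<Delta> \<Longrightarrow> coroot a \<in> QC"
  by (intro nat_cone_base finite_simple_coroots) simp

lemma coroot_pos_QC: "\<beta> \<in> P \<Longrightarrow> coroot \<beta> \<in> QC"
proof (induction rule: pos_root_induct)
  case (reflect \<beta> a)
  have "coroot \<beta> = coroot (s a \<beta>) + (coroot \<beta> \<bullet> a) *\<^sub>R coroot a"
    by (simp add: coroot_reflection)
  moreover have "(coroot \<beta> \<bullet> a) *\<^sub>R coroot a \<in> QC"
    using reflect integral[of \<beta> a] pos_root simple_root simple_coroot_QC
    by (intro Ints_nonneg_scale_nat_cone) auto
  ultimately show ?case using reflect.IH nat_cone_add by metis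
qed (rule simple_coroot_QC)

section \<open>The Weyl group and its length function\<close>

lemma weyl_id: "id \<in> W" by (rule weyl_group.intros)

lemma weyl_step: "w \<in> W \<Longrightarrow> \<alpha> \<in> \<Phi> \<Longrightarrow> w \<circ> s \<alpha> \<in> W"
  by (rule weyl_group.intros)

lemma weyl_induct [consumes 1, case_names id step]:
  assumes "w \<in> W" "Q id"
    "\<And>w \<alpha>. w \<in> W \<Longrightarrow> \<alpha> \<in> \<Phi> \<Longrightarrow> Q w \<Longrightarrow> Q (w \<circ> s \<alpha>)"
  shows "Q w"
  using assms(1) by (rule weyl_group.induct) (use assms(2,3) in \<open>blast+\<close>)

lemma weyl_isometry: "w \<in> W \<Longrightarrow> linear w \<and> bij w \<and> (\<forall>u v. w u \<bullet> w v = u \<bullet> v)"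
proof (induction rule: weyl_induct)
  case id
  have "linear (id :: 'a \<Rightarrow> 'a) \<and> bij (id :: 'a \<Rightarrow> 'a) \<and> (\<forall>u v :: 'a. id u \<bullet> id v = u \<bullet> v)"
    by (simp add: linear_id)
  then show ?case .
next
  case (step w \<alpha>)
  then have "linear (w \<circ> s \<alpha>) \<and> bij (w \<circ> s \<alpha>) \<and>
      (\<forall>u v. (w \<circ> s \<alpha>) u \<bullet> (w \<circ> s \<alpha>) v = u \<bullet> v)"
    using linear_compose[OF linear_reflection, of w \<alpha>] bij_comp[OF bij_reflection, of w \<alpha>]
    by (simp add: reflection_isometry)
  then show ?case .
qed

lemma weyl_linear: "w \<in> W \<Longrightarrow> linear w" using weyl_isometry by blast
lemma weyl_bij: "w \<in> W \<Longrightarrow> bij w" using weyl_isometry by blast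
lemma weyl_inner: "w \<in> W \<Longrightarrow> w u \<bullet> w v = u \<bullet> v" using weyl_isometry by blast

lemmas weyl_lin = linear_add[OF weyl_linear] linear_diff[OF weyl_linear]
  linear_scale[OF weyl_linear] linear_neg[OF weyl_linear] linear_0[OF weyl_linear]

lemma weyl_coroot: "w \<in> W \<Longrightarrow> coroot (w \<alpha>) = w (coroot \<alpha>)"
  using coroot_isometry weyl_linear weyl_inner by blast

lemma weyl_pairing: "w \<in> W \<Longrightarrow> coroot (w \<alpha>) \<bullet> w v = coroot \<alpha> \<bullet> v"
  by (simp add: weyl_coroot weyl_inner)

lemma weyl_root: "w \<in> W \<Longrightarrow> \<alpha> \<in> \<Phi> \<Longrightarrow> w \<alpha> \<in> \<Phi>"
  by (induction arbitrary: \<alpha> rule: weyl_induct) (auto intro: reflection_root)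

lemma weyl_reflection: "\<alpha> \<in> \<Phi> \<Longrightarrow> s \<alpha> \<in> W"
  using weyl_step[OF weyl_id] by simp

lemma weyl_comp: "v \<in> W \<Longrightarrow> u \<in> W \<Longrightarrow> u \<circ> v \<in> W"
  by (induction rule: weyl_induct) (auto simp: comp_assoc[symmetric] intro: weyl_id weyl_step)

lemma weyl_inv: "w \<in> W \<Longrightarrow> inv w \<in> W"
proof (induction rule: weyl_induct)
  case (step w \<alpha>)
  have "inv (w \<circ> s \<alpha>) = s \<alpha> \<circ> inv w"
    using o_inv_distrib[OF weyl_bij[OF step(1)] bij_reflection[of \<alpha>]] by simp
  then show ?case using step weyl_comp weyl_reflection by metis
next
  case id
  have "inv id \<in> W" using weyl_id by simp
  then show ?case .
qed

lemma weyl_inv_inv [simp]: "w \<in> W \<Longrightarrow> inv (inv w) = w"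
  using weyl_bij inv_inv_eq by blast

lemma weyl_inv_apply [simp]: "w \<in> W \<Longrightarrow> inv w (w v) = v" "w \<in> W \<Longrightarrow> w (inv w v) = v"
  using weyl_bij by (auto simp: bij_is_inj bij_is_surj surj_f_inv_f)

lemma weyl_inv_comp [simp]: "w \<in> W \<Longrightarrow> inv w \<circ> w = id" "w \<in> W \<Longrightarrow> w \<circ> inv w = id"
  by (auto simp: fun_eq_iff)

lemma inv_comp_weyl: "u \<in> W \<Longrightarrow> v \<in> W \<Longrightarrow> inv (u \<circ> v) = inv v \<circ> inv u"
  using o_inv_distrib weyl_bij by blast

lemma weyl_comp_reflection:
  assumes "w \<in> W" shows "w \<circ> s \<alpha> = s (w \<alpha>) \<circ> w"
  using reflection_conj[OF weyl_linear[OF assms] weyl_inner[OF assms]] by (simp add: fun_eq_iff)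

lemma reflection_comp_weyl:
  assumes "w \<in> W" shows "s \<alpha> \<circ> w = w \<circ> s (inv w \<alpha>)"
  using weyl_comp_reflection[OF assms, of "inv w \<alpha>"] assms by simp

lemma weyl_right: "w \<in> W \<Longrightarrow> \<beta> \<in> P \<Longrightarrow> w \<circ> s \<beta> \<in> W"
  using weyl_step pos_root by blast

lemma weyl_left: "w \<in> W \<Longrightarrow> \<beta> \<in> P \<Longrightarrow> s \<beta> \<circ> w \<in> W"
  using weyl_comp weyl_reflection pos_root by blast

definition word :: "'a list \<Rightarrow> 'a \<Rightarrow> 'a" where
  "word as = foldr (\<lambda>\<alpha> f. s \<alpha> \<circ> f) as id"

lemma word_simps [simp]: "word [] = id" "word (a # as) = s a \<circ> word as"
  by (simp_all add: word_def)

lemma word_append: "word (as @ bs) = word as \<circ> word bs"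
  by (induction as) (auto simp: comp_assoc)

lemma word_weyl: "set as \<subseteq> \<Delta> \<Longrightarrow> word as \<in> W"
  by (induction as) (auto intro: weyl_id weyl_left simple_pos)

lemma inv_word: "set as \<subseteq> \<Delta> \<Longrightarrow> inv (word as) = word (rev as)"
proof (induction as)
  case (Cons a as)
  have "inv (s a \<circ> word as) = inv (word as) \<circ> inv (s a)"
    using Cons.prems by (intro inv_comp_weyl word_weyl weyl_reflection simple_root) auto
  then have "inv (word (a # as)) = word (rev as) \<circ> s a" using Cons by simp
  then show ?case using word_append[of "rev as" "[a]"] by (simp only: rev.simps word_simps comp_id)
qed simp

lemma reflection_word: "\<beta> \<in> P \<Longrightarrow> \<exists>as. set as \<subseteq> \<Delta> \<and> s \<beta> = word as"
proof (induction rule: pos_root_induct)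
  case (simple a)
  then show ?case by (intro exI[of _ "[a]"]) simp
next
  case (reflect \<beta> a)
  then obtain as where as: "set as \<subseteq> \<Delta>" "s (s a \<beta>) = word as" by blast
  have "s \<beta> = word ([a] @ as @ [a])"
    using reflection_conj[OF linear_reflection reflection_isometry, of a "s a \<beta>"]
    by (auto simp: word_append as(2)[symmetric] fun_eq_iff)
  then show ?case using as reflect.hyps by (intro exI[of _ "[a] @ as @ [a]"]) auto
qed

lemma weyl_word: "w \<in> W \<Longrightarrow> \<exists>as. set as \<subseteq> \<Delta> \<and> w = word as"
proof (induction rule: weyl_induct)
  case id
  then show ?case by (intro exI[of _ "[]"]) simp
next
  case (step w \<alpha>)
  then obtain as where as: "set as \<subseteq> \<Delta>" "w = word as" by blast
  have "\<exists>bs. set bs \<subseteq> \<Delta> \<and> s \<alpha> = word bs"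
    using reflection_word[of \<alpha>] reflection_word[of "- \<alpha>"] pos_uminus[OF step(2)] by auto
  then obtain bs where "set bs \<subseteq> \<Delta>" "s \<alpha> = word bs" by blast
  then show ?case using as by (intro exI[of _ "as @ bs"]) (auto simp: word_append)
qed

lemma len_word_le: "set as \<subseteq> \<Delta> \<Longrightarrow> len (word as) \<le> length as"
  unfolding weyl_length_def word_def by (rule Least_le) blast

lemma reduced_word:
  assumes "w \<in> W" obtains as where "set as \<subseteq> \<Delta>" "word as = w" "length as = len w"
proof -
  have "\<exists>n as. set as \<subseteq> \<Delta> \<and> length as = n \<and> w = foldr (\<lambda>\<alpha> f. s \<alpha> \<circ> f) as id"
    using weyl_word[OF assms] by (simp add: word_def)
  then have "\<exists>as. set as \<subseteq> \<Delta> \<and> length as = len w \<and> w = foldr (\<lambda>\<alpha> f. s \<alpha> \<circ> f) as id"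
    unfolding weyl_length_def by (rule LeastI_ex)
  then show ?thesis using that by (auto simp: word_def)
qed

text \<open>The strong exchange condition. Applying the letters of the word to \<beta> from right to left, the
  root changes sign at some letter, where it is equal to the corresponding simple root; this is the
  letter that gets deleted.\<close>

lemma exchange:
  assumes "set as \<subseteq> \<Delta>" "\<beta> \<in> P" "word as \<beta> \<notin> P"
  shows "\<exists>bs. set bs \<subseteq> \<Delta> \<and> length as = Suc (length bs) \<and> word as \<circ> s \<beta> = word bs"
  using assms(1,3)
proof (induction as)
  case (Cons a as)
  show ?case
  proof (cases "word as \<beta> \<in> P")
    case True
    then have "word as \<beta> = a"
      using Cons.prems simple_reflection_pos by auto
    then have "word as \<circ> s \<beta> = s a \<circ> word as"
      using weyl_comp_reflection[OF word_weyl, of as \<beta>] Cons.prems by simp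
    then have "word (a # as) \<circ> s \<beta> = word as" by (simp add: comp_assoc)
    then show ?thesis using Cons.prems(1) by (metis insert_subset length_Cons list.simps(15))
  next
    case False
    then obtain bs where "set bs \<subseteq> \<Delta>" "length as = Suc (length bs)" "word as \<circ> s \<beta> = word bs"
      using Cons.IH Cons.prems(1) by (metis insert_subset list.simps(15))
    moreover have "word (a # as) \<circ> s \<beta> = s a \<circ> (word as \<circ> s \<beta>)"
      by (simp add: comp_assoc)
    ultimately have "word (a # as) \<circ> s \<beta> = word (a # bs)" by simp
    then show ?thesis
      using Cons.prems(1) \<open>set bs \<subseteq> \<Delta>\<close> \<open>length as = Suc (length bs)\<close>
      by (metis insert_subset length_Cons list.simps(15))
  qed
qed (use assms in simp)

lemma len_reflection_less:
  assumes "w \<in> W" "\<beta> \<in> P" "w \<beta> \<notin> P" shows "len (w \<circ> s \<beta>) < len w"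
proof -
  obtain as where as: "set as \<subseteq> \<Delta>" "word as = w" "length as = len w" using reduced_word assms by metis
  then obtain bs where "set bs \<subseteq> \<Delta>" "length as = Suc (length bs)" "w \<circ> s \<beta> = word bs"
    using exchange[OF as(1) assms(2)] assms(3) by metis
  then show ?thesis using as(3) len_word_le by (metis Suc_le_lessD Suc_le_mono)
qed

lemma len_reflection_iff:
  assumes "w \<in> W" "\<beta> \<in> P"
  shows "len w < len (w \<circ> s \<beta>) \<longleftrightarrow> w \<beta> \<in> P"
    "len (w \<circ> s \<beta>) < len w \<longleftrightarrow> w \<beta> \<notin> P"
proof -
  have "len w < len (w \<circ> s \<beta>)" if "w \<beta> \<in> P"
  proof -
    have "(w \<circ> s \<beta>) \<beta> = - w \<beta>"
      using assms by (simp add: pos_nonzero reflection_self weyl_lin)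
    then have "(w \<circ> s \<beta>) \<beta> \<notin> P" using that pos_not_neg by simp
    then show ?thesis
      using len_reflection_less[of "w \<circ> s \<beta>" \<beta>] assms weyl_right by simp
  qed
  then show "len w < len (w \<circ> s \<beta>) \<longleftrightarrow> w \<beta> \<in> P"
    "len (w \<circ> s \<beta>) < len w \<longleftrightarrow> w \<beta> \<notin> P"
    using len_reflection_less[OF assms] by force+
qed

lemma len_inv [simp]:
  assumes "w \<in> W" shows "len (inv w) = len w"
proof -
  have "len (inv u) \<le> len u" if u: "u \<in> W" for u
  proof -
    obtain as where "set as \<subseteq> \<Delta>" "word as = u" "length as = len u" using reduced_word u by metis
    then show ?thesis using len_word_le[of "rev as"] inv_word by auto
  qed
  from this[OF assms] this[OF weyl_inv[OF assms]] show ?thesis using assms by simp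
qed

lemma len_simple_right:
  assumes "w \<in> W" "a \<in> \<Delta>"
  shows "len (w \<circ> s a) = (if w a \<in> P then len w + 1 else len w - 1)"
    "w a \<notin> P \<Longrightarrow> len w > 0"
proof -
  have b: "len (u \<circ> s a) \<le> len u + 1" if u: "u \<in> W" for u
  proof -
    obtain as where "set as \<subseteq> \<Delta>" "word as = u" "length as = len u" using reduced_word u by metis
    then show ?thesis using len_word_le[of "as @ [a]"] assms(2) by (simp add: word_append)
  qed
  have "len w \<le> len (w \<circ> s a) + 1"
    using b[OF weyl_right[OF assms(1) simple_pos[OF assms(2)]]] by simp
  then show "len (w \<circ> s a) = (if w a \<in> P then len w + 1 else len w - 1)"
    "w a \<notin> P \<Longrightarrow> len w > 0"
    using b[OF assms(1)] len_reflection_iff[OF assms(1) simple_pos[OF assms(2)]] by (auto split: if_splits)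
qed

lemma len_simple_left:
  assumes "w \<in> W" "a \<in> \<Delta>"
  shows "len (s a \<circ> w) = (if inv w a \<in> P then len w + 1 else len w - 1)"
    "inv w a \<notin> P \<Longrightarrow> len w > 0"
proof -
  have "inv (s a \<circ> w) = inv w \<circ> s a"
    using assms inv_comp_weyl weyl_reflection simple_root by simp
  then have e: "len (s a \<circ> w) = len (inv w \<circ> s a)"
    using assms len_inv[of "s a \<circ> w"] weyl_left simple_pos by metis
  show "len (s a \<circ> w) = (if inv w a \<in> P then len w + 1 else len w - 1)"
    "inv w a \<notin> P \<Longrightarrow> len w > 0"
    using len_simple_right[OF weyl_inv[OF assms(1)] assms(2)] assms e by simp_all
qed

lemma len_id [simp]: "len id = 0"
  using len_word_le[of "[]"] by simp

lemma len_0: "w \<in> W \<Longrightarrow> len w = 0 \<Longrightarrow> w = id"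
  by (metis length_0_conv reduced_word word_simps(1))

text \<open>The last letter of a reduced word.\<close>

lemma right_descent:
  assumes "w \<in> W" "w \<noteq> id" shows "\<exists>a\<in>\<Delta>. w a \<notin> P"
proof -
  obtain as where as: "set as \<subseteq> \<Delta>" "word as = w" "length as = len w" using reduced_word assms by metis
  then obtain bs a where bs: "as = bs @ [a]" using assms(2) by (cases as rule: rev_cases) auto
  then have "w \<circ> s a = word bs" using as(2) by (auto simp: word_append)
  then have "len (w \<circ> s a) < len w" using len_word_le[of bs] as bs by auto
  then show ?thesis using len_reflection_iff(2) assms(1) as(1) bs simple_pos by auto
qed

lemma left_descent: "w \<in> W \<Longrightarrow> w \<noteq> id \<Longrightarrow> \<exists>a\<in>\<Delta>. inv w a \<notin> P"
  using right_descent[of "inv w"] weyl_inv by (metis inv_id weyl_inv_inv)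

lemma weyl_left_induct [consumes 1, case_names id left]:
  assumes "w \<in> W" "Q id"
    "\<And>w a. w \<in> W \<Longrightarrow> a \<in> \<Delta> \<Longrightarrow> inv w a \<in> P \<Longrightarrow> Q w \<Longrightarrow> Q (s a \<circ> w)"
  shows "Q w"
  using assms(1)
proof (induction "len w" arbitrary: w rule: less_induct)
  case less
  show ?case
  proof (cases "w = id")
    case False
    then obtain a where a: "a \<in> \<Delta>" "inv w a \<notin> P" using left_descent less.prems by blast
    let ?u = "s a \<circ> w"
    have u: "?u \<in> W" "len ?u < len w" using less.prems a weyl_left simple_pos len_simple_left by auto
    have "inv ?u = inv w \<circ> s a"
      using less.prems a inv_comp_weyl weyl_reflection simple_root by simp
    then have "inv ?u a = - inv w a"
      using a less.prems by (simp add: weyl_inv weyl_lin simple_root root_nonzero reflection_self)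
    then have "inv ?u a \<in> P"
      using a pos_uminus less.prems weyl_inv weyl_root simple_root by metis
    then have "Q (s a \<circ> ?u)" using assms(3) u a less.hyps by blast
    then show ?thesis by simp
  qed (use assms in simp)
qed

text \<open>The simple reflection at a right descent permutes the remaining inversions and removes
  exactly one.\<close>

lemma len_inversions:
  assumes "w \<in> W" shows "len w = card {\<beta>\<in>P. w \<beta> \<notin> P}"
  using assms
proof (induction "len w" arbitrary: w)
  case 0
  then have "w = id" using len_0 by simp
  then have "{\<beta>\<in>P. w \<beta> \<notin> P} = {}" by auto
  then show ?case using 0 by (metis card.empty)
next
  case (Suc n)
  have "w \<noteq> id" using Suc.hyps(2) by force
  then obtain a where a: "a \<in> \<Delta>" "w a \<notin> P" using right_descent[of w] Suc.prems by blast
  let ?u = "w \<circ> s a"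
  have u: "?u \<in> W" "len ?u = n"
    using Suc a weyl_right simple_pos len_simple_right(1)[of w a] by auto
  have "- w a \<in> P" using a Suc.prems pos_uminus weyl_root simple_root by metis
  then have ua: "?u a \<in> P"
    using a Suc.prems by (simp add: weyl_lin simple_root root_nonzero reflection_self)
  have "s a ` {\<beta>\<in>P. ?u \<beta> \<notin> P} = {\<beta>\<in>P. w \<beta> \<notin> P} - {a}"
  proof (intro equalityI subsetI)
    fix \<gamma> assume "\<gamma> \<in> s a ` {\<beta>\<in>P. ?u \<beta> \<notin> P}"
    then obtain \<beta> where \<beta>: "\<gamma> = s a \<beta>" "\<beta> \<in> P" "?u \<beta> \<notin> P" by blast
    then have "\<beta> \<noteq> a" using ua by auto
    then show "\<gamma> \<in> {\<beta>\<in>P. w \<beta> \<notin> P} - {a}"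
      using \<beta> a simple_reflection_pos simple_reflection_not_simple by auto
  next
    fix \<gamma> assume "\<gamma> \<in> {\<beta>\<in>P. w \<beta> \<notin> P} - {a}"
    then show "\<gamma> \<in> s a ` {\<beta>\<in>P. ?u \<beta> \<notin> P}"
      using a simple_reflection_pos by (intro image_eqI[of _ _ "s a \<gamma>"]) auto
  qed
  then have "card {\<beta>\<in>P. ?u \<beta> \<notin> P} = card ({\<beta>\<in>P. w \<beta> \<notin> P} - {a})"
    using card_image[OF inj_on_subset[OF bij_is_inj[OF bij_reflection[of a]] subset_UNIV],
        of "{\<beta>\<in>P. ?u \<beta> \<notin> P}"] by simp
  moreover have "card ({\<beta>\<in>P. w \<beta> \<notin> P} - {a}) = card {\<beta>\<in>P. w \<beta> \<notin> P} - 1"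
    and "card {\<beta>\<in>P. w \<beta> \<notin> P} > 0"
    using a simple_pos finite_pos by (auto simp: card_gt_0_iff)
  ultimately show ?case using Suc(1)[of ?u] u Suc(2) by linarith
qed

lemma finite_weyl: "finite W"
proof -
  have "len w \<le> card P" if "w \<in> W" for w
    unfolding len_inversions[OF that] using finite_pos by (intro card_mono) auto
  then have "W \<subseteq> word ` {as. set as \<subseteq> \<Delta> \<and> length as \<le> card P}"
    using reduced_word by (metis (mono_tags, lifting) image_eqI mem_Collect_eq subsetI)
  then show ?thesis using finite_lists_length_le[OF finite_simple] finite_surj by blast
qed

section \<open>Bruhat order\<close>

lemma bruhat_step:
  assumes "x \<in> W" "\<beta> \<in> P" "x \<beta> \<in> P" shows "x \<preceq> x \<circ> s \<beta>"
  unfolding bruhat_le_def using assms len_reflection_iff(1) by (intro r_into_rtranclp) blast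

lemma bruhat_refl [simp]: "x \<preceq> x"
  by (simp add: bruhat_le_def)

lemma bruhat_trans [trans]: "x \<preceq> y \<Longrightarrow> y \<preceq> z \<Longrightarrow> x \<preceq> z"
  unfolding bruhat_le_def by (rule rtranclp_trans)

lemma bruhat_induct [consumes 2, case_names refl step]:
  assumes "x \<preceq> y" "x \<in> W" "Q x"
    and step: "\<And>u \<beta>. u \<in> W \<Longrightarrow> \<beta> \<in> P \<Longrightarrow> u \<beta> \<in> P \<Longrightarrow> x \<preceq> u \<Longrightarrow> Q u \<Longrightarrow> Q (u \<circ> s \<beta>)"
  shows "Q y"
proof -
  let ?s = "\<lambda>x y. x \<in> W \<and> len x < len y \<and> (\<exists>\<alpha>\<in>P. y = x \<circ> s \<alpha>)"
  have "?s\<^sup>*\<^sup>* x y" using assms(1) by (simp add: bruhat_le_def)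
  then show ?thesis
  proof (induction rule: rtranclp_induct)
    case (step u y)
    then have u: "u \<in> W" "len u < len y" and "\<exists>\<alpha>\<in>P. y = u \<circ> s \<alpha>" by blast+
    then obtain \<beta> where \<beta>: "\<beta> \<in> P" "y = u \<circ> s \<beta>" by blast
    have "x \<preceq> u" using step(1) by (simp add: bruhat_le_def)
    then show ?case using assms(4)[OF u(1) \<beta>(1)] u \<beta> step.IH len_reflection_iff(1) by metis
  qed (rule assms)
qed

lemma bruhat_weyl:
  assumes "x \<preceq> y" "x \<in> W" shows "y \<in> W"
  using assms
proof (induction rule: bruhat_induct)
  case (step u \<beta>)
  then have "u \<circ> s \<beta> \<in> W" using weyl_right by blast
  then show ?case .
qed (rule assms)

lemma bruhat_len:
  assumes "x \<preceq> y" "x \<in> W" shows "x = y \<or> len x < len y"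
  using assms
proof (induction rule: bruhat_induct)
  case (step u \<beta>)
  then have "len u < len (u \<circ> s \<beta>)" using len_reflection_iff(1) by blast
  then show ?case using step.IH less_trans by blast
qed blast

lemma bruhat_antisym: "x \<preceq> y \<Longrightarrow> y \<preceq> x \<Longrightarrow> x \<in> W \<Longrightarrow> x = y"
  using bruhat_len bruhat_weyl by (metis less_asym)

lemma bruhat_weyl_lower: "x \<preceq> y \<Longrightarrow> y \<in> W \<Longrightarrow> x \<in> W"
  unfolding bruhat_le_def by (erule converse_rtranclpE) auto

lemma bruhat_inv:
  assumes "x \<preceq> y" "x \<in> W" shows "inv x \<preceq> inv y"
  using assms
proof (induction rule: bruhat_induct)
  case (step u \<beta>)
  have "inv (u \<circ> s \<beta>) = s \<beta> \<circ> inv u"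
    using step inv_comp_weyl[of u "s \<beta>"] weyl_reflection[OF pos_root] by simp
  also have "\<dots> = inv u \<circ> s (u \<beta>)"
    using reflection_comp_weyl[OF weyl_inv[OF step(1)], of \<beta>] step by simp
  finally have e: "inv (u \<circ> s \<beta>) = inv u \<circ> s (u \<beta>)" .
  have "inv u \<preceq> inv u \<circ> s (u \<beta>)"
    by (rule bruhat_step) (use step weyl_inv in simp_all)
  then have "inv x \<preceq> inv (u \<circ> s \<beta>)" unfolding e using step.IH bruhat_trans by blast
  then show ?case .
qed simp

text \<open>The larger and the smaller one of \<open>x\<close> and s a \<circ> x, for a simple root \<open>a\<close>.\<close>

definition up :: "'a \<Rightarrow> ('a \<Rightarrow> 'a) \<Rightarrow> 'a \<Rightarrow> 'a" where
  "up a x = (if inv x a \<in> P then s a \<circ> x else x)"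

definition down :: "'a \<Rightarrow> ('a \<Rightarrow> 'a) \<Rightarrow> 'a \<Rightarrow> 'a" where
  "down a x = (if inv x a \<in> P then x else s a \<circ> x)"

lemma inv_left_reflection:
  assumes "x \<in> W" "\<alpha> \<in> \<Phi>" shows "inv (s \<alpha> \<circ> x) \<alpha> = - inv x \<alpha>"
  using assms inv_comp_weyl[of "s \<alpha>" x] weyl_reflection[of \<alpha>]
  by (simp add: reflection_self root_nonzero weyl_inv weyl_lin)

lemma root_sign:
  assumes "x \<in> W" "\<alpha> \<in> \<Phi>" shows "inv (s \<alpha> \<circ> x) \<alpha> \<in> P \<longleftrightarrow> inv x \<alpha> \<notin> P"
  using inv_left_reflection[OF assms] pos_uminus weyl_root[OF weyl_inv] assms by simp

lemma left_sign:
  assumes "x \<in> W" "a \<in> \<Delta>"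
  shows "inv (s a \<circ> x) a \<in> P \<longleftrightarrow> inv x a \<notin> P"
  using root_sign assms simple_root by blast

lemma down_weyl: "x \<in> W \<Longrightarrow> a \<in> \<Delta> \<Longrightarrow> down a x \<in> W"
  by (auto simp: down_def intro: weyl_left simple_pos)

lemma left_le:
  assumes "x \<in> W" "a \<in> \<Delta>" "inv x a \<in> P" shows "x \<preceq> s a \<circ> x"
  using bruhat_step[OF assms(1,3)] assms simple_pos reflection_comp_weyl by simp

lemma left_ge:
  assumes "x \<in> W" "a \<in> \<Delta>" "inv x a \<notin> P" shows "s a \<circ> x \<preceq> x"
  using left_le[of "s a \<circ> x" a] assms left_sign weyl_left simple_pos by simp

lemma le_up: "x \<in> W \<Longrightarrow> a \<in> \<Delta> \<Longrightarrow> x \<preceq> up a x"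
  by (auto simp: up_def left_le)

lemma left_le_up: "x \<in> W \<Longrightarrow> a \<in> \<Delta> \<Longrightarrow> s a \<circ> x \<preceq> up a x"
  by (auto simp: up_def left_ge)

lemma up_idem: "x \<in> W \<Longrightarrow> a \<in> \<Delta> \<Longrightarrow> up a (up a x) = up a x"
  by (simp add: up_def left_sign)

lemma down_cases: "down a x = x \<or> s a \<circ> down a x = x"
  by (simp add: down_def)

text \<open>A step of the Bruhat order remains a step after left multiplication by \<open>s a\<close>, unless it is
  this left multiplication itself.\<close>

lemma lift_step:
  assumes "x \<in> W" "\<beta> \<in> P" "x \<beta> \<in> P" "a \<in> \<Delta>" "x \<beta> \<noteq> a"
  shows "s a \<circ> x \<preceq> s a \<circ> (x \<circ> s \<beta>)"
  using bruhat_step[of "s a \<circ> x" \<beta>] assms weyl_left simple_pos simple_reflection_pos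
  by (simp add: comp_assoc)

lemma simple_step:
  assumes "x \<in> W" "x \<beta> = a"
  shows "x \<circ> s \<beta> = s a \<circ> x" "inv x a = \<beta>"
  using assms weyl_comp_reflection[of x \<beta>] by auto

text \<open>The lifting property of the Bruhat order, in the form of two monotone operators.\<close>

lemma up_mono:
  assumes "x \<preceq> y" "x \<in> W" "a \<in> \<Delta>" shows "up a x \<preceq> up a y"
  using assms(1,2)
proof (induction rule: bruhat_induct)
  case (step u \<beta>)
  let ?v = "u \<circ> s \<beta>"
  have v: "?v \<in> W" using step weyl_right by blast
  have "up a u \<preceq> up a ?v"
  proof (cases "u \<beta> = a")
    case True
    then have "up a u = ?v" using simple_step[OF step(1) True] step(2) by (simp add: up_def)
    then show ?thesis using le_up[OF v assms(3)] by simp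
  next
    case False
    have l: "s a \<circ> u \<preceq> s a \<circ> ?v" using lift_step step assms(3) False by blast
    have "u \<preceq> ?v" using bruhat_step step by blast
    then show ?thesis
      using bruhat_trans[OF l left_le_up[OF v assms(3)]] bruhat_trans[OF _ le_up[OF v assms(3)]]
      by (simp add: up_def[of a u])
  qed
  then have "up a x \<preceq> up a ?v" using step.IH bruhat_trans by blast
  then show ?case .
qed simp

lemma down_mono:
  assumes "x \<preceq> y" "x \<in> W" "a \<in> \<Delta>" shows "down a x \<preceq> down a y"
  using assms(1,2)
proof (induction rule: bruhat_induct)
  case (step u \<beta>)
  let ?v = "u \<circ> s \<beta>"
  have v: "?v \<in> W" using step weyl_right by blast
  have "down a u \<preceq> down a ?v"
  proof (cases "u \<beta> = a")
    case True
    have v': "?v = s a \<circ> u" and i: "inv u a \<in> P" using simple_step[OF step(1) True] step(2) by auto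
    then have "inv ?v a \<notin> P" using left_sign[OF step(1) assms(3)] by metis
    then have "down a ?v = s a \<circ> (s a \<circ> u)" unfolding down_def v' by metis
    then show ?thesis using i by (simp add: down_def)
  next
    case False
    have l: "s a \<circ> u \<preceq> s a \<circ> ?v" using lift_step step assms(3) False by blast
    have "u \<preceq> ?v" using bruhat_step step by blast
    then show ?thesis
      using l bruhat_trans[OF left_le[OF step(1) assms(3)] l] bruhat_trans[OF left_ge[OF step(1) assms(3)]]
      by (simp add: down_def)
  qed
  then have "down a x \<preceq> down a ?v" using step.IH bruhat_trans by blast
  then show ?case .
qed simp

lemma id_le: "w \<in> W \<Longrightarrow> id \<preceq> w"
proof (induction rule: weyl_left_induct)
  case (left w a)
  then have "id \<preceq> s a \<circ> w" using left_le bruhat_trans by blast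
  then show ?case .
qed simp

lemma le_id: "x \<preceq> id \<Longrightarrow> x = id"
  using bruhat_antisym id_le bruhat_weyl_lower weyl_id by blast

section \<open>Demazure product\<close>

abbreviation dem :: "('a \<Rightarrow> 'a) \<Rightarrow> ('a \<Rightarrow> 'a) \<Rightarrow> 'a \<Rightarrow> 'a" (infixl "\<star>" 70)
  where "dem \<equiv> demazure \<Phi> \<Delta>"

text \<open>The maximum of all products u' \<circ> v' is attained with \<open>v' = v\<close>: rounding up along a reduced
  word of \<open>u\<close> only skips letters of \<open>u\<close>.\<close>

definition dem_max :: "('a \<Rightarrow> 'a) \<Rightarrow> ('a \<Rightarrow> 'a) \<Rightarrow> ('a \<Rightarrow> 'a) \<Rightarrow> bool" where
  "dem_max u v m \<longleftrightarrow> (\<exists>u'\<in>W. u' \<preceq> u \<and> m = u' \<circ> v) \<and>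
     (\<forall>u'\<in>W. \<forall>v'\<in>W. u' \<preceq> u \<and> v' \<preceq> v \<longrightarrow> u' \<circ> v' \<preceq> m)"

lemma unique_maximal_max:
  assumes "m \<in> S" "\<And>x. x \<in> S \<Longrightarrow> x \<preceq> m" "S \<subseteq> W"
  shows "unique_maximal (\<preceq>) S m"
  unfolding unique_maximal_def
proof (intro allI iffI)
  fix x assume "x \<in> S \<and> (\<forall>y\<in>S. x \<preceq> y \<longrightarrow> y = x)"
  then show "x = m" using assms by blast
next
  fix x assume "x = m"
  then show "x \<in> S \<and> (\<forall>y\<in>S. x \<preceq> y \<longrightarrow> y = x)" using assms bruhat_antisym by blast
qed

lemma dem_eq:
  assumes "u \<in> W" "v \<in> W" "dem_max u v m" shows "u \<star> v = m"
proof -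
  let ?S = "{u' \<circ> v' | u' v'. u' \<in> W \<and> v' \<in> W \<and> u' \<preceq> u \<and> v' \<preceq> v}"
  have sub: "?S \<subseteq> W" using weyl_comp by auto
  obtain u' where "u' \<in> W" "u' \<preceq> u" "m = u' \<circ> v" using assms(3) by (auto simp: dem_max_def)
  then have mem: "m \<in> ?S" using assms(2) bruhat_refl by blast
  have bound: "x \<preceq> m" if x: "x \<in> ?S" for x
  proof -
    obtain u' v' where "x = u' \<circ> v'" "u' \<in> W" "v' \<in> W" "u' \<preceq> u" "v' \<preceq> v" using x by blast
    then show ?thesis using assms(3) unfolding dem_max_def by blast
  qed
  have m: "unique_maximal (\<preceq>) ?S m" by (rule unique_maximal_max[OF mem bound sub])
  show ?thesis unfolding demazure_def
    by (rule the_equality[where P = "unique_maximal (\<preceq>) ?S", OF m]) (rule unique_maximal_unique[OF m])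
qed

lemma dem_max_id: "dem_max id v v"
  unfolding dem_max_def
proof (intro conjI ballI impI)
  show "\<exists>u'\<in>W. u' \<preceq> id \<and> v = u' \<circ> v" using weyl_id by (intro bexI[of _ id]) simp_all
  show "u' \<circ> v' \<preceq> v" if "u' \<preceq> id \<and> v' \<preceq> v" for u' v'
    using that le_id[of u'] by simp
qed

text \<open>The recursion behind the Demazure product: extending a reduced word of the left factor by a
  letter rounds up the product. By the lifting property, an element below s a \<circ> u is below \<open>u\<close>
  up to left multiplication by \<open>s a\<close>.\<close>

lemma dem_max_left:
  assumes "u \<in> W" "v \<in> W" "a \<in> \<Delta>" "inv u a \<in> P" "dem_max u v m"
  shows "dem_max (s a \<circ> u) v (up a m)"
proof -
  have au: "up a u = s a \<circ> u" "down a (s a \<circ> u) = u"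
    using assms left_sign[OF assms(1,3)] by (simp_all add: up_def down_def)
  obtain u' where u': "u' \<in> W" "u' \<preceq> u" "m = u' \<circ> v" using assms(5) by (auto simp: dem_max_def)
  have m: "m \<in> W" using u' assms weyl_comp by blast
  have "s a \<circ> u' \<preceq> s a \<circ> u"
    using left_le_up[OF u'(1) assms(3)] up_mono[OF u'(2,1) assms(3)] au bruhat_trans by metis
  moreover have "u' \<preceq> s a \<circ> u" using u' left_le[OF assms(1,3,4)] bruhat_trans by blast
  moreover have "up a m = (s a \<circ> u') \<circ> v \<or> up a m = u' \<circ> v"
    using u'(3) by (simp add: up_def comp_assoc)
  ultimately have "\<exists>w\<in>W. w \<preceq> s a \<circ> u \<and> up a m = w \<circ> v"
    using u'(1) weyl_left[OF u'(1) simple_pos[OF assms(3)]] by blast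
  moreover have "w \<circ> v' \<preceq> up a m" if w: "w \<in> W" "v' \<in> W" "w \<preceq> s a \<circ> u" "v' \<preceq> v" for w v'
  proof -
    have d: "down a w \<preceq> u" "down a w \<in> W"
      using down_mono[OF w(3,1) assms(3)] au down_weyl[OF w(1) assms(3)] by auto
    then have le: "down a w \<circ> v' \<preceq> m" "down a w \<circ> v' \<in> W"
      using assms(5) w weyl_comp unfolding dem_max_def by blast+
    from down_cases[of a w] show ?thesis
    proof
      assume "down a w = w"
      then show ?thesis using le le_up[OF m assms(3)] bruhat_trans by metis
    next
      assume "s a \<circ> down a w = w"
      then have "w \<circ> v' = s a \<circ> (down a w \<circ> v')" by (simp add: comp_assoc[symmetric])
      then show ?thesis
        using left_le_up[OF le(2) assms(3)] up_mono[OF le assms(3)] bruhat_trans by metis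
    qed
  qed
  ultimately show ?thesis unfolding dem_max_def by blast
qed

lemma dem_max_dem:
  assumes "u \<in> W" "v \<in> W" shows "dem_max u v (u \<star> v)"
proof -
  have "\<exists>m. dem_max u v m" using assms(1)
  proof (induction rule: weyl_left_induct)
    case id
    show ?case using dem_max_id by blast
  next
    case (left w a)
    then show ?case using dem_max_left[OF _ assms(2)] by blast
  qed
  then show ?thesis using dem_eq assms by blast
qed

lemma dem_factor:
  assumes "u \<in> W" "v \<in> W" obtains u' where "u' \<in> W" "u' \<preceq> u" "u \<star> v = u' \<circ> v"
  using dem_max_dem[OF assms] by (auto simp: dem_max_def)

lemma dem_bound: "u \<in> W \<Longrightarrow> v \<in> W \<Longrightarrow> u' \<preceq> u \<Longrightarrow> v' \<preceq> v \<Longrightarrow> u' \<circ> v' \<preceq> u \<star> v"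
  using dem_max_dem bruhat_weyl_lower unfolding dem_max_def by blast

lemma dem_weyl: "u \<in> W \<Longrightarrow> v \<in> W \<Longrightarrow> u \<star> v \<in> W"
  using dem_factor weyl_comp by metis

lemma dem_id_left [simp]: "v \<in> W \<Longrightarrow> id \<star> v = v"
  using dem_eq dem_max_id weyl_id by blast

lemma dem_left:
  assumes "u \<in> W" "v \<in> W" "a \<in> \<Delta>" "inv u a \<in> P"
  shows "(s a \<circ> u) \<star> v = up a (u \<star> v)"
  using dem_eq dem_max_left[OF assms dem_max_dem] weyl_left simple_pos assms by blast

lemma dem_up: "u \<in> W \<Longrightarrow> v \<in> W \<Longrightarrow> a \<in> \<Delta> \<Longrightarrow> up a u \<star> v = up a (u \<star> v)"
proof (cases "inv u a \<in> P")
  case False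
  assume *: "u \<in> W" "v \<in> W" "a \<in> \<Delta>"
  let ?u = "s a \<circ> u"
  have "?u \<in> W" "inv ?u a \<in> P" using * False left_sign weyl_left simple_pos by auto
  then have "u \<star> v = up a (?u \<star> v)" "?u \<star> v \<in> W"
    using dem_left[of ?u v a] dem_weyl[of ?u v] * by simp_all
  then have "u \<star> v = up a (u \<star> v)" using * up_idem by metis
  then show ?thesis using False by (simp add: up_def[of a u])
qed (simp add: up_def[of a u] dem_left)

lemma dem_simple: "v \<in> W \<Longrightarrow> a \<in> \<Delta> \<Longrightarrow> s a \<star> v = up a v"
  using dem_left[OF weyl_id, of v a] simple_pos by simp

lemma dem_assoc:
  assumes "u \<in> W" "v \<in> W" "w \<in> W" shows "(u \<star> v) \<star> w = u \<star> (v \<star> w)"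
  using assms(1)
proof (induction rule: weyl_left_induct)
  case id
  have "(id \<star> v) \<star> w = id \<star> (v \<star> w)" using assms dem_weyl by simp
  then show ?case .
next
  case (left u a)
  then have "((s a \<circ> u) \<star> v) \<star> w = (s a \<circ> u) \<star> (v \<star> w)"
    using assms by (simp add: dem_left dem_up dem_weyl)
  then show ?case .
qed

lemma dem_mono:
  assumes "u \<preceq> u2" "v \<preceq> v2" "u2 \<in> W" "v2 \<in> W" shows "u \<star> v \<preceq> u2 \<star> v2"
proof -
  have "u \<in> W" "v \<in> W" using assms bruhat_weyl_lower by blast+
  then obtain u' where "u' \<in> W" "u' \<preceq> u" "u \<star> v = u' \<circ> v" by (rule dem_factor)
  then show ?thesis using dem_bound[OF assms(3,4)] assms bruhat_trans by metis
qed

text \<open>Inversion reverses products and preserves the Bruhat order, so the rules for the left factor of a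
  Demazure product also hold for the right one.\<close>

lemma dem_inv:
  assumes "u \<in> W" "v \<in> W" shows "inv (u \<star> v) = inv v \<star> inv u"
proof -
  have half: "inv (x \<star> y) \<preceq> inv y \<star> inv x" if xy: "x \<in> W" "y \<in> W" for x y
  proof -
    obtain x' where x': "x' \<in> W" "x' \<preceq> x" "x \<star> y = x' \<circ> y" using dem_factor xy by blast
    then show ?thesis
      using dem_bound[of "inv y" "inv x" "inv y" "inv x'"] xy weyl_inv inv_comp_weyl bruhat_inv by simp
  qed
  have "inv (inv v \<star> inv u) \<preceq> u \<star> v" using half[of "inv v" "inv u"] assms weyl_inv by simp
  then have "inv v \<star> inv u \<preceq> inv (u \<star> v)"
    using bruhat_inv assms weyl_inv dem_weyl weyl_inv_inv by metis
  then show ?thesis using half[OF assms] bruhat_antisym weyl_inv dem_weyl assms by metis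
qed

lemma dem_id_right [simp]: "v \<in> W \<Longrightarrow> v \<star> id = v"
proof -
  assume v: "v \<in> W"
  have "v \<star> id \<in> W" and "inv (v \<star> id) = inv v"
    using v dem_inv[OF v weyl_id] dem_weyl weyl_id weyl_inv by simp_all
  then show ?thesis using v weyl_inv_inv by metis
qed

lemma dem_simple_right:
  assumes "v \<in> W" "a \<in> \<Delta>"
  shows "v \<star> s a = (if v a \<in> P then v \<circ> s a else v)"
proof -
  have "v \<star> s a = inv (s a \<star> inv v)"
    using dem_inv[of "s a" "inv v"] assms weyl_inv weyl_reflection simple_root by simp
  also have "\<dots> = inv (up a (inv v))" using assms dem_simple weyl_inv by simp
  also have "\<dots> = (if v a \<in> P then v \<circ> s a else v)"
    using assms inv_comp_weyl[of "s a" "inv v"] weyl_inv weyl_reflection simple_root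
    by (simp add: up_def)
  finally show ?thesis .
qed

lemma le_dem_left: "u \<in> W \<Longrightarrow> v \<in> W \<Longrightarrow> u \<preceq> u \<star> v"
  using dem_bound[of u v u id] id_le by simp

lemma le_dem_right: "u \<in> W \<Longrightarrow> v \<in> W \<Longrightarrow> v \<preceq> u \<star> v"
  using dem_bound[of u v id v] id_le by simp

lemma simple_weyl: "a \<in> \<Delta> \<Longrightarrow> s a \<in> W"
  using weyl_reflection simple_root by blast

lemma pos_weyl: "\<beta> \<in> P \<Longrightarrow> s \<beta> \<in> W"
  using weyl_reflection pos_root by blast

lemma simple_neg: "a \<in> \<Delta> \<Longrightarrow> s a a \<notin> P"
  by (simp add: reflection_self root_nonzero simple_root pos_not_neg simple_pos)

lemma dem_simple_idem: "a \<in> \<Delta> \<Longrightarrow> s a \<star> s a = s a"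
  by (simp add: dem_simple_right simple_weyl simple_neg)

lemma reflection_simple_neg:
  assumes "\<beta> \<in> P" "a \<in> \<Delta>" "coroot \<beta> \<bullet> a > 0" shows "s \<beta> a \<notin> P"
proof (cases "\<beta> = a")
  case False
  then obtain b where b: "b \<in> \<Delta>" "b \<noteq> a" "coord b \<beta> > 0" using pos_other_simple assms by blast
  then have "coord b (s \<beta> a) < 0"
    using assms by (simp add: reflection_def coord_linear coord_simple)
  then show ?thesis using coord_pos b by force
qed (use assms simple_neg in simp)

lemma dem_absorb:
  assumes "\<beta> \<in> P" "a \<in> \<Delta>" "coroot \<beta> \<bullet> a > 0"
  shows "s \<beta> \<star> s a = s \<beta>" "s a \<star> s \<beta> = s \<beta>"
  using assms reflection_simple_neg[OF assms]
  by (simp_all add: dem_simple_right dem_simple up_def pos_weyl)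

lemma reflection_fix:
  assumes "coroot \<beta> \<bullet> a = 0" shows "s \<beta> a = a"
  using assms by (simp add: reflection_def)

lemma dem_commute:
  assumes "\<beta> \<in> P" "a \<in> \<Delta>" "coroot \<beta> \<bullet> a \<ge> 0"
  shows "s \<beta> \<star> s a = s a \<star> s \<beta>"
proof (cases "coroot \<beta> \<bullet> a = 0")
  case True
  then show ?thesis
    using assms reflection_fix[OF True] simple_pos[OF assms(2)]
      weyl_comp_reflection[OF pos_weyl[OF assms(1)], of a]
    by (simp add: dem_simple_right dem_simple up_def pos_weyl)
qed (use assms dem_absorb in force)

text \<open>With a negative pairing, conjugation by \<open>s a\<close> makes the root higher and both multiplications
  increase the length.\<close>

lemma dem_conj:
  assumes "\<beta> \<in> P" "a \<in> \<Delta>" "coroot \<beta> \<bullet> a < 0"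
  shows "s (s a \<beta>) = s a \<star> s \<beta> \<star> s a"
proof -
  have ne: "\<beta> \<noteq> a" using assms by (auto simp: root_nonzero simple_root)
  have "\<beta> \<bullet> a < 0" using assms coroot_pairing_sign(2) pos_nonzero by blast
  then have c: "coroot a \<bullet> \<beta> < 0"
    using coroot_pairing_sign(2)[of a \<beta>] assms root_nonzero simple_root by (simp add: inner_commute)
  \<comment> \<open>The coordinate at \<open>b\<close> shows that the two roots governing the
    length are positive.\<close>
  obtain b where b: "b \<in> \<Delta>" "b \<noteq> a" "coord b \<beta> > 0" using pos_other_simple assms ne by blast
  have roots: "a \<in> \<Phi>" "\<beta> \<in> \<Phi>" using assms pos_root simple_root by blast+
  have "coord b (s \<beta> a) = - (coroot \<beta> \<bullet> a) * coord b \<beta>"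
    using b assms by (simp add: reflection_def coord_linear coord_simple)
  then have cb: "coord b (s \<beta> a) > 0" using b assms by (simp add: mult_neg_pos)
  then have r: "s \<beta> a \<in> P" using pos_if_coord_pos b roots reflection_root by blast
  have "coord b (s a (s \<beta> a)) = coord b (s \<beta> a)"
    using b assms by (simp add: reflection_def[of a] coord_linear coord_simple)
  then have r2: "s a (s \<beta> a) \<in> P"
    using cb pos_if_coord_pos b roots reflection_root by metis
  have "inv (s \<beta> \<circ> s a) a = s a (s \<beta> a)"
    using assms inv_comp_weyl[of "s \<beta>" "s a"] by (simp add: pos_weyl simple_weyl)
  then have "s a \<star> (s \<beta> \<star> s a) = s a \<circ> (s \<beta> \<circ> s a)"
    using assms r r2 by (simp add: dem_simple_right dem_simple up_def pos_weyl simple_weyl weyl_comp)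
  moreover have "s (s a \<beta>) = s a \<circ> (s \<beta> \<circ> s a)"
    using weyl_comp_reflection[OF simple_weyl[OF assms(2)], of \<beta>] by (simp add: fun_eq_iff)
  ultimately show ?thesis using assms by (simp add: dem_assoc pos_weyl simple_weyl)
qed

section \<open>Inversions of reflections and quantum edges\<close>

text \<open>The inversions of a reflection. They control how much the length can change under right
  multiplication by it.\<close>

definition inverted :: "'a \<Rightarrow> 'a set" where "inverted \<beta> = {\<epsilon>\<in>P. s \<beta> \<epsilon> \<notin> P}"

lemma finite_inverted: "finite (inverted \<beta>)" using finite_pos by (simp add: inverted_def)

lemma inverted_self: "\<beta> \<in> P \<Longrightarrow> \<beta> \<in> inverted \<beta>"
  by (simp add: inverted_def reflection_self pos_nonzero pos_not_neg)

lemma inverted_opposite: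
  assumes "\<beta> \<in> P" "\<epsilon> \<in> inverted \<beta>" shows "- s \<beta> \<epsilon> \<in> inverted \<beta>"
proof -
  have "\<epsilon> \<in> P" "s \<beta> \<epsilon> \<notin> P" using assms by (auto simp: inverted_def)
  moreover have "s \<beta> (- s \<beta> \<epsilon>) = - \<epsilon>" by (simp add: linear_neg[OF linear_reflection])
  ultimately show ?thesis
    using assms pos_uminus pos_not_neg reflection_root pos_root by (simp add: inverted_def)
qed

lemma pairing_int: "\<alpha> \<in> P \<Longrightarrow> \<beta> \<in> P \<Longrightarrow> coroot \<alpha> \<bullet> \<beta> \<in> \<int>"
  using integral pos_root by blast

lemma Ints_pos_ge_1: "(k::real) \<in> \<int> \<Longrightarrow> 0 < k \<Longrightarrow> 1 \<le> k"
  by (auto simp: Ints_def)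

lemma inverted_pairing:
  assumes "\<beta> \<in> P" "\<epsilon> \<in> inverted \<beta>" shows "coroot \<beta> \<bullet> \<epsilon> \<ge> 1"
proof (rule ccontr)
  assume "\<not> ?thesis"
  then have k: "coroot \<beta> \<bullet> \<epsilon> \<le> 0" "\<epsilon> \<in> P" "s \<beta> \<epsilon> \<notin> P"
    using Ints_pos_ge_1[of "coroot \<beta> \<bullet> \<epsilon>"] pairing_int[of \<beta> \<epsilon>] assms by (force simp: inverted_def)+
  have "s \<beta> \<epsilon> - \<epsilon> = (- (coroot \<beta> \<bullet> \<epsilon>)) *\<^sub>R \<beta>" by (simp add: reflection_def)
  also have "\<dots> \<in> RC"
    using k pairing_int[of \<beta> \<epsilon>] assms by (intro Ints_nonneg_scale_nat_cone) (auto simp: pos_roots_def)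
  finally have "s \<beta> \<epsilon> \<in> P" using k(2) assms pos_if_sum reflection_root pos_root by blast
  then show False using k by blast
qed

definition sgn_at :: "('a \<Rightarrow> 'a) \<Rightarrow> 'a \<Rightarrow> int" where
  "sgn_at x \<epsilon> = (if x \<epsilon> \<in> P then 1 else - 1)"

text \<open>Only the roots inverted by the reflection contribute, as the reflection permutes the other
  positive roots; on the inverted ones, \<epsilon> \<mapsto> - s \<beta> \<epsilon> is an involution.\<close>

lemma len_diff:
  assumes "x \<in> W" "\<beta> \<in> P"
  shows "int (len (x \<circ> s \<beta>)) - int (len x) = (\<Sum>\<epsilon>\<in>inverted \<beta>. sgn_at x \<epsilon>)"
proof -
  let ?n = "\<lambda>w \<epsilon>. of_bool (w \<epsilon> \<notin> P) :: int"
  have len: "int (len w) = (\<Sum>\<epsilon>\<in>P - inverted \<beta>. ?n w \<epsilon>) + (\<Sum>\<epsilon>\<in>inverted \<beta>. ?n w \<epsilon>)" if "w \<in> W" for w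
  proof -
    have "int (len w) = (\<Sum>\<epsilon>\<in>P. ?n w \<epsilon>)"
      using len_inversions[OF that] finite_pos by (simp add: of_bool_def sum.If_cases Int_def)
    also have "\<dots> = (\<Sum>\<epsilon>\<in>P - inverted \<beta>. ?n w \<epsilon>) + (\<Sum>\<epsilon>\<in>inverted \<beta>. ?n w \<epsilon>)"
      using finite_pos by (intro sum.subset_diff) (auto simp: inverted_def)
    finally show ?thesis .
  qed
  let ?y = "x \<circ> s \<beta>"
  have 1: "(\<Sum>\<epsilon>\<in>P - inverted \<beta>. ?n ?y \<epsilon>) = (\<Sum>\<epsilon>\<in>P - inverted \<beta>. ?n x \<epsilon>)"
    by (rule sum.reindex_bij_witness[of _ "s \<beta>" "s \<beta>"]) (auto simp: inverted_def)
  have 2: "(\<Sum>\<epsilon>\<in>inverted \<beta>. ?n ?y \<epsilon>) = (\<Sum>\<epsilon>\<in>inverted \<beta>. of_bool (x \<epsilon> \<in> P))"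
  proof (rule sum.reindex_bij_witness[of _ "\<lambda>\<epsilon>. - s \<beta> \<epsilon>" "\<lambda>\<epsilon>. - s \<beta> \<epsilon>"])
    fix \<epsilon> assume "\<epsilon> \<in> inverted \<beta>"
    then have "x (s \<beta> \<epsilon>) \<in> \<Phi>"
      using assms weyl_root reflection_root pos_root by (auto simp: inverted_def)
    then show "of_bool (x (- s \<beta> \<epsilon>) \<in> P) = ?n ?y \<epsilon>"
      using assms pos_uminus by (simp add: weyl_lin)
  qed (use assms inverted_opposite in \<open>auto simp: linear_neg[OF linear_reflection]\<close>)
  have "int (len ?y) - int (len x) = (\<Sum>\<epsilon>\<in>inverted \<beta>. of_bool (x \<epsilon> \<in> P) - ?n x \<epsilon>)"
    using len[OF assms(1)] len[OF weyl_right[OF assms]] 1 2 by (simp add: sum_subtractf)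
  also have "\<dots> = (\<Sum>\<epsilon>\<in>inverted \<beta>. sgn_at x \<epsilon>)" by (rule sum.cong) (auto simp: sgn_at_def)
  finally show ?thesis .
qed

text \<open>The same permutation makes the contributions of the roots that are not inverted cancel.\<close>

lemma coroot_two_rho:
  assumes "\<beta> \<in> P" shows "coroot \<beta> \<bullet> rho2 = (\<Sum>\<epsilon>\<in>inverted \<beta>. coroot \<beta> \<bullet> \<epsilon>)"
proof -
  have anti: "coroot \<beta> \<bullet> s \<beta> \<epsilon> = - (coroot \<beta> \<bullet> \<epsilon>)" for \<epsilon>
    using assms pos_nonzero by (simp add: reflection_def inner_diff_right)
  have "(\<Sum>\<epsilon>\<in>P - inverted \<beta>. coroot \<beta> \<bullet> \<epsilon>) = (\<Sum>\<epsilon>\<in>P - inverted \<beta>. - (coroot \<beta> \<bullet> \<epsilon>))"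
    by (rule sum.reindex_bij_witness[of _ "s \<beta>" "s \<beta>"]) (auto simp: inverted_def anti)
  then have z: "(\<Sum>\<epsilon>\<in>P - inverted \<beta>. coroot \<beta> \<bullet> \<epsilon>) = 0" by (simp add: sum_negf)
  have "coroot \<beta> \<bullet> rho2 = (\<Sum>\<epsilon>\<in>P. coroot \<beta> \<bullet> \<epsilon>)"
    by (simp add: two_rho_def inner_sum_right)
  also have "\<dots> = (\<Sum>\<epsilon>\<in>P - inverted \<beta>. coroot \<beta> \<bullet> \<epsilon>) + (\<Sum>\<epsilon>\<in>inverted \<beta>. coroot \<beta> \<bullet> \<epsilon>)"
    using finite_pos by (intro sum.subset_diff) (auto simp: inverted_def)
  finally show ?thesis using z by simp
qed

text \<open>Each inverted root pairs at least once with the coroot, and \<beta> itself pairs twice. So these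
  are the positive roots for which the length of the reflection attains its upper bound
  coroot \<beta> \<bullet> rho2 - 1; they are the labels of the quantum edges.\<close>

definition quantum_root :: "'a \<Rightarrow> bool" where
  "quantum_root \<beta> \<longleftrightarrow> \<beta> \<in> P \<and> (\<forall>\<epsilon>\<in>inverted \<beta>. \<epsilon> \<noteq> \<beta> \<longrightarrow> coroot \<beta> \<bullet> \<epsilon> = 1)"

text \<open>The defect of the length from the value required of a quantum edge is a sum over the inverted
  roots whose terms are nonnegative, and whose term at \<beta> is at least 1.\<close>

lemma quantum_iff:
  assumes "x \<in> W" "\<beta> \<in> P"
  shows "real (len (x \<circ> s \<beta>)) = real (len x) + 1 - coroot \<beta> \<bullet> rho2
    \<longleftrightarrow> quantum_root \<beta> \<and> (\<forall>\<epsilon>\<in>inverted \<beta>. x \<epsilon> \<notin> P)"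
proof -
  define t where "t \<epsilon> = coroot \<beta> \<bullet> \<epsilon> + real_of_int (sgn_at x \<epsilon>)" for \<epsilon>
  have t0: "t \<epsilon> \<ge> 0" if "\<epsilon> \<in> inverted \<beta>" for \<epsilon>
    using inverted_pairing[OF assms(2) that] by (simp add: t_def sgn_at_def)
  have tz: "t \<epsilon> = 0 \<longleftrightarrow> coroot \<beta> \<bullet> \<epsilon> = 1 \<and> x \<epsilon> \<notin> P" if "\<epsilon> \<in> inverted \<beta>" for \<epsilon>
    using inverted_pairing[OF assms(2) that] by (auto simp: t_def sgn_at_def)
  have tb: "t \<beta> = (if x \<beta> \<in> P then 3 else 1)"
    using assms pos_nonzero by (simp add: t_def sgn_at_def)
  have "real_of_int (int (len (x \<circ> s \<beta>)) - int (len x)) = (\<Sum>\<epsilon>\<in>inverted \<beta>. real_of_int (sgn_at x \<epsilon>))"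
    unfolding len_diff[OF assms] by simp
  then have "real (len (x \<circ> s \<beta>)) - real (len x) + coroot \<beta> \<bullet> rho2 = (\<Sum>\<epsilon>\<in>inverted \<beta>. t \<epsilon>)"
    by (simp add: coroot_two_rho[OF assms(2)] t_def sum.distrib)
  also have "\<dots> = t \<beta> + (\<Sum>\<epsilon>\<in>inverted \<beta> - {\<beta>}. t \<epsilon>)"
    using finite_inverted inverted_self[OF assms(2)] by (rule sum.remove)
  finally have sum: "real (len (x \<circ> s \<beta>)) - real (len x) + coroot \<beta> \<bullet> rho2
      = t \<beta> + (\<Sum>\<epsilon>\<in>inverted \<beta> - {\<beta>}. t \<epsilon>)" .
  have nn: "(\<Sum>\<epsilon>\<in>inverted \<beta> - {\<beta>}. t \<epsilon>) \<ge> 0" using t0 by (intro sum_nonneg) auto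
  have "real (len (x \<circ> s \<beta>)) = real (len x) + 1 - coroot \<beta> \<bullet> rho2
      \<longleftrightarrow> t \<beta> = 1 \<and> (\<Sum>\<epsilon>\<in>inverted \<beta> - {\<beta>}. t \<epsilon>) = 0"
    using sum nn tb by (auto split: if_splits)
  also have "\<dots> \<longleftrightarrow> x \<beta> \<notin> P \<and> (\<forall>\<epsilon>\<in>inverted \<beta> - {\<beta>}. t \<epsilon> = 0)"
    using sum_nonneg_eq_0_iff[of "inverted \<beta> - {\<beta>}" t] finite_inverted t0 tb by (auto split: if_splits)
  also have "\<dots> \<longleftrightarrow> quantum_root \<beta> \<and> (\<forall>\<epsilon>\<in>inverted \<beta>. x \<epsilon> \<notin> P)"
    using tz assms(2) inverted_self by (auto simp: quantum_root_def)
  finally show ?thesis .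
qed

lemma inverted_simple: "a \<in> \<Delta> \<Longrightarrow> inverted a = {a}"
  using inverted_self simple_pos simple_reflection_pos by (auto simp: inverted_def)

lemma quantum_root_simple: "a \<in> \<Delta> \<Longrightarrow> quantum_root a"
  by (auto simp: quantum_root_def inverted_simple simple_pos)

lemma two_rho_simple: "a \<in> \<Delta> \<Longrightarrow> coroot a \<bullet> rho2 = 2"
  by (simp add: coroot_two_rho simple_pos inverted_simple root_nonzero simple_root)

lemma QC_expand:
  assumes "\<gamma> \<in> QC" obtains c where "\<gamma> = (\<Sum>a\<in>\<Delta>. real (c a) *\<^sub>R coroot a)"
proof -
  obtain c where c: "\<gamma> = (\<Sum>v\<in>coroot ` \<Delta>. real (c v) *\<^sub>R v)" using assms by (rule nat_coneE)
  \<comment> \<open>Distinct simple roots have distinct coroots, so the sum can be indexed by the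
    simple roots.\<close>
  have "inj_on coroot \<Delta>"
    using coroot_eq_iff root_nonzero simple_root by (intro inj_onI) blast
  then have "\<gamma> = (\<Sum>a\<in>\<Delta>. real (c (coroot a)) *\<^sub>R coroot a)" using c by (simp add: sum.reindex)
  then show ?thesis by (rule that)
qed

lemma QC_two_rho:
  assumes "\<gamma> \<in> QC" shows "\<gamma> \<bullet> rho2 \<ge> 0" "\<gamma> \<bullet> rho2 = 0 \<Longrightarrow> \<gamma> = 0"
    "\<gamma> \<bullet> rho2 \<in> \<nat>"
proof -
  obtain c where c: "\<gamma> = (\<Sum>a\<in>\<Delta>. real (c a) *\<^sub>R coroot a)" using assms by (rule QC_expand)
  have "\<gamma> \<bullet> rho2 = (\<Sum>a\<in>\<Delta>. real (c a) * (coroot a \<bullet> rho2))"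
    unfolding c by (simp add: inner_sum_left)
  also have "\<dots> = (\<Sum>a\<in>\<Delta>. real (c a * 2))" by (intro sum.cong) (simp_all add: two_rho_simple)
  also have "\<dots> = real (\<Sum>a\<in>\<Delta>. c a * 2)" by simp
  finally have e: "\<gamma> \<bullet> rho2 = real (\<Sum>a\<in>\<Delta>. c a * 2)" .
  show "\<gamma> \<bullet> rho2 \<ge> 0" unfolding e by (rule of_nat_0_le_iff)
  show "\<gamma> \<bullet> rho2 \<in> \<nat>" unfolding e by (rule of_nat_in_Nats)
  assume "\<gamma> \<bullet> rho2 = 0"
  then have "(\<Sum>a\<in>\<Delta>. c a * 2) = 0" using e by linarith
  then have "c a = 0" if "a \<in> \<Delta>" for a using that finite_simple by simp
  then show "\<gamma> = 0" by (simp add: c)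
qed

section \<open>Maximal roots\<close>

text \<open>The strict Cauchy-Schwarz inequality, for the component of \<beta> orthogonal to \<alpha>.\<close>

lemma pairing_product:
  assumes "\<alpha> \<in> \<Phi>" "\<beta> \<in> \<Phi>" "\<beta> \<noteq> \<alpha>" "\<beta> \<noteq> - \<alpha>"
  shows "(coroot \<alpha> \<bullet> \<beta>) * (coroot \<beta> \<bullet> \<alpha>) < 4"
proof -
  define c where "c = (\<alpha> \<bullet> \<beta>) / (\<alpha> \<bullet> \<alpha>)"
  have a: "\<alpha> \<bullet> \<alpha> > 0" "\<beta> \<bullet> \<beta> > 0" using assms root_nonzero by auto
  have "\<beta> - c *\<^sub>R \<alpha> \<noteq> 0"
  proof
    assume "\<beta> - c *\<^sub>R \<alpha> = 0"
    then have e: "\<beta> = c *\<^sub>R \<alpha>" by simp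
    then have "c = 1 \<or> c = - 1" using reduced[of \<alpha> c] assms by simp
    then show False using e assms by auto
  qed
  then have "(\<beta> - c *\<^sub>R \<alpha>) \<bullet> (\<beta> - c *\<^sub>R \<alpha>) > 0" by simp
  also have "(\<beta> - c *\<^sub>R \<alpha>) \<bullet> (\<beta> - c *\<^sub>R \<alpha>) = \<beta> \<bullet> \<beta> - 2 * c * (\<alpha> \<bullet> \<beta>) + c * c * (\<alpha> \<bullet> \<alpha>)"
    by (simp add: inner_diff_left inner_diff_right inner_commute[of \<beta> \<alpha>] algebra_simps)
  also have "\<dots> = \<beta> \<bullet> \<beta> - (\<alpha> \<bullet> \<beta>)\<^sup>2 / (\<alpha> \<bullet> \<alpha>)"
    using a by (simp add: c_def power2_eq_square)
  finally have "(\<alpha> \<bullet> \<beta>)\<^sup>2 / (\<alpha> \<bullet> \<alpha>) < \<beta> \<bullet> \<beta>" by simp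
  then have "(\<alpha> \<bullet> \<beta>)\<^sup>2 < (\<beta> \<bullet> \<beta>) * (\<alpha> \<bullet> \<alpha>)" using a by (simp add: divide_less_eq)
  then have "4 * (\<alpha> \<bullet> \<beta>)\<^sup>2 / ((\<beta> \<bullet> \<beta>) * (\<alpha> \<bullet> \<alpha>)) < 4" using a by (simp add: divide_less_eq)
  moreover have "(coroot \<alpha> \<bullet> \<beta>) * (coroot \<beta> \<bullet> \<alpha>) = 4 * (\<alpha> \<bullet> \<beta>)\<^sup>2 / ((\<beta> \<bullet> \<beta>) * (\<alpha> \<bullet> \<alpha>))"
    by (simp add: inner_coroot_sym inner_commute[of \<beta> \<alpha>] power2_eq_square)
  ultimately show ?thesis by simp
qed

lemma pairing_sign_sym:
  assumes "\<alpha> \<in> \<Phi>" "\<beta> \<in> \<Phi>"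
  shows "coroot \<alpha> \<bullet> \<beta> > 0 \<longleftrightarrow> coroot \<beta> \<bullet> \<alpha> > 0" "coroot \<alpha> \<bullet> \<beta> < 0 \<longleftrightarrow> coroot \<beta> \<bullet> \<alpha> < 0"
  using coroot_pairing_sign[of \<alpha> \<beta>] coroot_pairing_sign[of \<beta> \<alpha>] assms root_nonzero
  by (simp_all add: inner_commute)

lemma pairing_large:
  assumes "\<alpha> \<in> \<Phi>" "\<beta> \<in> \<Phi>" "\<beta> \<noteq> \<alpha>" "\<beta> \<noteq> - \<alpha>" "coroot \<alpha> \<bullet> \<beta> \<ge> 2"
  shows "coroot \<beta> \<bullet> \<alpha> = 1"
proof -
  have p: "coroot \<beta> \<bullet> \<alpha> > 0" using pairing_sign_sym[OF assms(1,2)] assms(5) by simp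
  have "2 * (coroot \<beta> \<bullet> \<alpha>) \<le> (coroot \<alpha> \<bullet> \<beta>) * (coroot \<beta> \<bullet> \<alpha>)"
    using p assms(5) by (intro mult_right_mono) auto
  then have "coroot \<beta> \<bullet> \<alpha> < 2" using pairing_product[OF assms(1-4)] by linarith
  then show ?thesis using p integral[OF assms(2,1)] by (auto simp: Ints_def)
qed

text \<open>If \<epsilon> is inverted by s \<beta> and pairs with coroot \<beta> at least twice, then \<epsilon> is longer
  than \<beta>, and coroot \<beta> is the sum of the coroots of \<epsilon> and of - s \<beta> \<epsilon>. One of these two
  positive roots is bigger than \<beta> but has a smaller coroot, contrary to maximality.\<close>

lemma maximal_root_quantum:
  assumes "max_below \<gamma> \<beta>" shows "quantum_root \<beta>"
proof (rule ccontr)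
  assume n: "\<not> quantum_root \<beta>"
  have \<beta>: "\<beta> \<in> P" "\<gamma> - coroot \<beta> \<in> QC"
    and max: "\<And>\<delta>. \<delta> \<in> P \<Longrightarrow> \<gamma> - coroot \<delta> \<in> QC \<Longrightarrow> \<delta> - \<beta> \<in> RC \<Longrightarrow> \<delta> = \<beta>"
    using assms by (auto simp: maximal_root_below_def coroot_le_def root_le_def)
  obtain \<epsilon> where \<epsilon>: "\<epsilon> \<in> inverted \<beta>" "\<epsilon> \<noteq> \<beta>" "coroot \<beta> \<bullet> \<epsilon> \<noteq> 1" using n \<beta> by (auto simp: quantum_root_def)
  define k where "k = coroot \<beta> \<bullet> \<epsilon>"
  define \<delta> where "\<delta> = - s \<beta> \<epsilon>"
  have eP: "\<epsilon> \<in> P" "\<delta> \<in> P" using \<epsilon> inverted_opposite[OF \<beta>(1)] by (auto simp: inverted_def \<delta>_def)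
  have k: "k \<ge> 2" "k \<in> \<int>" using inverted_pairing[OF \<beta>(1) \<epsilon>(1)] \<epsilon>(3) pairing_int[OF \<beta>(1) eP(1)]
    by (auto simp: k_def Ints_def)
  have ne: "\<epsilon> \<noteq> - \<beta>" using eP \<beta> pos_not_neg by auto
  have m: "coroot \<epsilon> \<bullet> \<beta> = 1"
    using pairing_large[of \<beta> \<epsilon>] eP \<beta> \<epsilon>(2) ne k pos_root by (auto simp: k_def)
  have c: "coroot \<delta> = coroot \<beta> - coroot \<epsilon>" by (simp add: \<delta>_def coroot_reflection m)
  have ce: "\<gamma> - coroot \<epsilon> = (\<gamma> - coroot \<beta>) + coroot \<delta>" "\<gamma> - coroot \<delta> = (\<gamma> - coroot \<beta>) + coroot \<epsilon>"
    by (simp_all add: c)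
  have le: "\<gamma> - coroot \<epsilon> \<in> QC" "\<gamma> - coroot \<delta> \<in> QC"
    unfolding ce by (intro nat_cone_add \<beta> coroot_pos_QC eP)+
  have "s \<epsilon> \<beta> \<in> \<Phi>" using eP \<beta> reflection_root pos_root by blast
  moreover have "s \<epsilon> \<beta> = \<beta> - \<epsilon>" by (simp add: reflection_def m)
  ultimately have root: "\<beta> - \<epsilon> \<in> \<Phi>" by simp
  show False
  proof (cases "\<beta> - \<epsilon> \<in> P")
    case True
    have "\<delta> - \<beta> = (k - 2) *\<^sub>R \<beta> + (\<beta> - \<epsilon>)"
      by (simp add: \<delta>_def reflection_def k_def algebra_simps scaleR_2)
    also have "\<dots> \<in> RC"
      using True \<beta> k by (intro nat_cone_add Ints_nonneg_scale_nat_cone) (auto simp: pos_roots_def)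
    finally have "\<delta> = \<beta>" using max eP le by blast
    then have "s \<beta> \<epsilon> = - \<beta>" by (metis \<delta>_def minus_minus)
    then have "\<epsilon> = s \<beta> (- \<beta>)" by (metis reflection_invol)
    also have "\<dots> = \<beta>" using \<beta>(1) by (simp add: linear_neg[OF linear_reflection] reflection_self pos_nonzero)
    finally show False using \<epsilon> by simp
  next
    case False
    then have "\<epsilon> - \<beta> \<in> P" using pos_uminus[OF root] by simp
    then have "\<epsilon> = \<beta>" using max eP le by (auto simp: pos_roots_def)
    then show False using \<epsilon> by simp
  qed
qed

text \<open>For an irreducible root system this set consists of the highest root; in general there is one
  such root for each component.\<close>

definition max_roots :: "'a set" where
  "max_roots = {\<theta>\<in>P. \<forall>\<beta>\<in>P. \<beta> - \<theta> \<in> RC \<longrightarrow> \<beta> = \<theta>}"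

lemma max_roots_pos: "\<theta> \<in> max_roots \<Longrightarrow> \<theta> \<in> P" by (simp add: max_roots_def)

lemma max_roots_max: "\<theta> \<in> max_roots \<Longrightarrow> \<beta> \<in> P \<Longrightarrow> \<beta> - \<theta> \<in> RC \<Longrightarrow> \<beta> = \<theta>"
  by (simp add: max_roots_def)

lemma max_roots_quantum: "\<theta> \<in> max_roots \<Longrightarrow> quantum_root \<theta>"
  by (rule maximal_root_quantum[of "coroot \<theta>"])
    (auto simp: maximal_root_below_def max_roots_def coroot_le_def root_le_def)

lemma max_roots_dominant:
  assumes "\<theta> \<in> max_roots" "\<beta> \<in> P" shows "coroot \<theta> \<bullet> \<beta> \<ge> 0"
proof -
  have s: "coroot \<theta> \<bullet> a \<ge> 0" if a: "a \<in> \<Delta>" for a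
  proof (rule ccontr)
    assume "\<not> ?thesis"
    then have c: "coroot a \<bullet> \<theta> < 0" "a \<noteq> \<theta>"
      using pairing_sign_sym(2)[of a \<theta>] a simple_root max_roots_pos[OF assms(1)] pos_root pos_nonzero by auto
    have "s a \<theta> - \<theta> = (- (coroot a \<bullet> \<theta>)) *\<^sub>R a" by (simp add: reflection_def)
    also have "\<dots> \<in> RC"
      using c a integral[of a \<theta>] simple_root max_roots_pos[OF assms(1)] pos_root simple_pos
      by (intro Ints_nonneg_scale_nat_cone) (auto simp: pos_roots_def)
    finally have "s a \<theta> = \<theta>"
      using max_roots_max[OF assms(1)] simple_reflection_pos[OF max_roots_pos[OF assms(1)] a] c by blast
    then show False using c a root_nonzero simple_root by (auto simp: reflection_def)
  qed
  have "\<beta> = (\<Sum>a\<in>\<Delta>. coord a \<beta> *\<^sub>R a)" using cone_expand assms(2) by (simp add: pos_roots_def)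
  then have "coroot \<theta> \<bullet> \<beta> = (\<Sum>a\<in>\<Delta>. coord a \<beta> * (coroot \<theta> \<bullet> a))"
    by (metis (no_types, lifting) inner_scaleR_right inner_sum_right sum.cong)
  also have "\<dots> \<ge> 0" using s coord_pos[OF assms(2)] by (intro sum_nonneg) auto
  finally show ?thesis .
qed

text \<open>A root with a larger pairing would be inverted by s \<theta>, as its image could only be positive if
  the root were above \<theta>; but \<theta> is a quantum root.\<close>

lemma max_roots_pairing:
  assumes "\<theta> \<in> max_roots" "\<beta> \<in> P" "\<beta> \<noteq> \<theta>" shows "coroot \<theta> \<bullet> \<beta> = 0 \<or> coroot \<theta> \<bullet> \<beta> = 1"
proof (cases "coroot \<theta> \<bullet> \<beta> = 0")
  case False
  define k where "k = coroot \<theta> \<bullet> \<beta>"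
  have k: "k \<ge> 1" "k \<in> \<int>"
    using False max_roots_dominant[OF assms(1,2)] pairing_int[OF max_roots_pos[OF assms(1)] assms(2)] Ints_pos_ge_1
    by (auto simp: k_def)
  have "s \<theta> \<beta> \<notin> P"
  proof
    assume "s \<theta> \<beta> \<in> P"
    then have "s \<theta> \<beta> + (k - 1) *\<^sub>R \<theta> \<in> RC"
      using k max_roots_pos[OF assms(1)]
      by (intro nat_cone_add Ints_nonneg_scale_nat_cone) (auto simp: pos_roots_def)
    also have "s \<theta> \<beta> + (k - 1) *\<^sub>R \<theta> = \<beta> - \<theta>"
      by (simp add: reflection_def k_def algebra_simps)
    finally show False using max_roots_max[OF assms(1,2)] assms(3) by blast
  qed
  then show ?thesis using max_roots_quantum[OF assms(1)] assms by (auto simp: quantum_root_def inverted_def)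
qed simp

lemma highest_pos_root:
  assumes "S \<subseteq> P" "S \<noteq> {}"
  obtains \<beta> where "\<beta> \<in> S" "\<And>\<delta>. \<delta> \<in> S \<Longrightarrow> \<delta> - \<beta> \<in> RC \<Longrightarrow> \<delta> = \<beta>"
proof -
  have fin: "finite S" using assms(1) finite_pos finite_subset by blast
  then have "Max (height ` S) \<in> height ` S" using assms(2) by (intro Max_in) auto
  then obtain \<beta> where \<beta>: "\<beta> \<in> S" "height \<beta> = Max (height ` S)" by auto
  show ?thesis
  proof (rule that[OF \<beta>(1)], rule ccontr)
    fix \<delta> assume d: "\<delta> \<in> S" "\<delta> - \<beta> \<in> RC" "\<delta> \<noteq> \<beta>"
    then have "height (\<delta> - \<beta>) > 0" using height_cone_pos by simp
    moreover have "height \<delta> \<le> height \<beta>" unfolding \<beta>(2) using d fin by (intro Max_ge) auto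
    ultimately show False by (simp add: height_linear)
  qed
qed

lemma max_roots_exists:
  assumes "a \<in> \<Delta>" shows "\<exists>\<theta>\<in>max_roots. coord a \<theta> > 0"
proof -
  let ?S = "{\<beta>\<in>P. \<beta> - a \<in> RC}"
  have "a \<in> ?S" using assms simple_pos by simp
  then have "?S \<subseteq> P" "?S \<noteq> {}" by blast+
  then obtain \<theta> where \<theta>: "\<theta> \<in> ?S" "\<And>\<beta>. \<beta> \<in> ?S \<Longrightarrow> \<beta> - \<theta> \<in> RC \<Longrightarrow> \<beta> = \<theta>"
    by (rule highest_pos_root) blast
  have "\<beta> = \<theta>" if b: "\<beta> \<in> P" "\<beta> - \<theta> \<in> RC" for \<beta>
  proof -
    have "(\<beta> - \<theta>) + (\<theta> - a) \<in> RC" using b \<theta>(1) by (intro nat_cone_add) auto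
    then show ?thesis using \<theta>(2)[of \<beta>] b by simp
  qed
  then have "\<theta> \<in> max_roots" using \<theta>(1) by (simp add: max_roots_def)
  moreover have "coord a (\<theta> - a) \<ge> 0" using \<theta>(1) coord_cone_nonneg assms by blast
  then have "coord a \<theta> > 0" using assms by (simp add: coord_linear coord_simple)
  ultimately show ?thesis by blast
qed

section \<open>Paths in the quantum Bruhat graph\<close>

abbreviation edge :: "('a \<Rightarrow> 'a) \<Rightarrow> 'a \<Rightarrow> ('a \<Rightarrow> 'a) \<Rightarrow> bool" where "edge \<equiv> qbg_edge \<Phi> \<Delta>"
abbreviation qpath :: "('a \<Rightarrow> 'a) \<Rightarrow> nat \<Rightarrow> 'a \<Rightarrow> ('a \<Rightarrow> 'a) \<Rightarrow> bool" where "qpath \<equiv> qbg_path \<Phi> \<Delta>"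

text \<open>Both kinds of edges obey the same length formula in terms of their weight.\<close>

lemma edge_iff:
  "edge x \<omega> y \<longleftrightarrow> x \<in> W \<and> (\<exists>\<beta>\<in>P. y = x \<circ> s \<beta> \<and> (\<omega> = 0 \<or> \<omega> = coroot \<beta>) \<and>
     real (len y) = real (len x) + 1 - \<omega> \<bullet> rho2)"
proof
  assume "edge x \<omega> y"
  then show "x \<in> W \<and> (\<exists>\<beta>\<in>P. y = x \<circ> s \<beta> \<and> (\<omega> = 0 \<or> \<omega> = coroot \<beta>) \<and>
     real (len y) = real (len x) + 1 - \<omega> \<bullet> rho2)"
  proof cases
    case (bruhat_edge \<alpha>)
    then show ?thesis by (intro conjI bexI[of _ \<alpha>]) auto
  next
    case (quantum_edge \<alpha>)
    then show ?thesis by (intro conjI bexI[of _ \<alpha>]) auto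
  qed
next
  assume "x \<in> W \<and> (\<exists>\<beta>\<in>P. y = x \<circ> s \<beta> \<and> (\<omega> = 0 \<or> \<omega> = coroot \<beta>) \<and>
     real (len y) = real (len x) + 1 - \<omega> \<bullet> rho2)"
  then obtain \<beta> where b: "x \<in> W" "\<beta> \<in> P" "y = x \<circ> s \<beta>" "\<omega> = 0 \<or> \<omega> = coroot \<beta>"
    and l: "real (len y) = real (len x) + 1 - \<omega> \<bullet> rho2" by blast
  from b(4) show "edge x \<omega> y"
  proof
    assume z: "\<omega> = 0"
    then have "len (x \<circ> s \<beta>) = len x + 1" using l b(3) by simp
    then show ?thesis using qbg_edge.bruhat_edge[OF b(1,2)] z b(3) by simp
  next
    assume z: "\<omega> = coroot \<beta>"
    then show ?thesis using qbg_edge.quantum_edge[OF b(1,2)] l b(3) by simp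
  qed
qed

lemma edge_weyl: "edge x \<omega> y \<Longrightarrow> x \<in> W \<and> y \<in> W"
  using edge_iff[of x \<omega> y] weyl_right[of x] by blast

lemma edge_length: "edge x \<omega> y \<Longrightarrow> real (len y) = real (len x) + 1 - \<omega> \<bullet> rho2"
  using edge_iff[of x \<omega> y] by blast

lemma edge_weight: "edge x \<omega> y \<Longrightarrow> \<omega> \<in> QC"
  using edge_iff[of x \<omega> y] coroot_pos_QC nat_cone_zero by auto

lemma path_refl: "x \<in> W \<Longrightarrow> qpath x 0 0 x" by (rule qbg_path.intros)

lemma path_cons: "edge x \<omega> y \<Longrightarrow> qpath y n \<omega>' z \<Longrightarrow> qpath x (Suc n) (\<omega> + \<omega>') z"
  by (rule qbg_path.intros)

lemma path_induct [consumes 1, case_names refl cons]: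
  assumes "qpath x n \<omega> y" "\<And>x. x \<in> W \<Longrightarrow> Q x 0 0 x"
    "\<And>x \<omega> y n \<omega>' z. edge x \<omega> y \<Longrightarrow> qpath y n \<omega>' z \<Longrightarrow> Q y n \<omega>' z \<Longrightarrow> Q x (Suc n) (\<omega> + \<omega>') z"
  shows "Q x n \<omega> y"
  using assms(1) by (rule qbg_path.induct) (use assms(2,3) in \<open>blast+\<close>)

lemma path_weyl: "qpath x n \<omega> y \<Longrightarrow> x \<in> W \<and> y \<in> W"
  by (induction rule: path_induct) (use edge_weyl in blast)+

lemma path_weight: "qpath x n \<omega> y \<Longrightarrow> \<omega> \<in> QC"
  by (induction rule: path_induct) (use edge_weight nat_cone_add in blast)+

lemma path_edge: "edge x \<omega> y \<Longrightarrow> qpath x 1 \<omega> y"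
  using path_cons[OF _ path_refl, of x \<omega> y] edge_weyl by simp

lemma path_append: "qpath x n \<omega> y \<Longrightarrow> qpath y m \<omega>' z \<Longrightarrow> qpath x (n + m) (\<omega> + \<omega>') z"
proof (induction rule: path_induct)
  case (cons x \<omega>1 y1 n \<omega>2 y)
  then show ?case using path_cons by (metis add.assoc add_Suc)
qed simp

text \<open>Summing the length formula over the edges of a path.\<close>

lemma path_length: "qpath x n \<omega> y \<Longrightarrow> real n = real (len y) - real (len x) + \<omega> \<bullet> rho2"
proof (induction rule: path_induct)
  case (cons x \<omega> y n \<omega>' z)
  have "real (len y) = real (len x) + 1 - \<omega> \<bullet> rho2" using cons(1) by (rule edge_length)
  then show ?case using cons by (simp add: inner_add_left)
qed simp

text \<open>The linear parts of the simple affine roots. The affine root with linear part - \<theta> provides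
  moves of nontrivial weight in the quantum Bruhat graph.\<close>

definition Aff :: "'a set" where "Aff = \<Delta> \<union> uminus ` max_roots"

text \<open>The weight of the edge from \<open>x\<close> to s \<alpha> \<circ> x if inv x \<alpha> is positive. The same formula gives
  the negative of the weight of the reversed edge otherwise, so that no case distinction is needed
  when weights are translated.\<close>

definition raise_wt :: "'a \<Rightarrow> ('a \<Rightarrow> 'a) \<Rightarrow> 'a" where
  "raise_wt \<alpha> x = (if \<alpha> \<in> \<Delta> then 0 else coroot (inv x \<alpha>))"

lemma Aff_cases [consumes 1, case_names simple max_roots]:
  assumes "\<alpha> \<in> Aff" "\<alpha> \<in> \<Delta> \<Longrightarrow> R" "\<And>\<theta>. \<theta> \<in> max_roots \<Longrightarrow> \<alpha> = - \<theta> \<Longrightarrow> \<alpha> \<notin> \<Delta> \<Longrightarrow> R"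
  shows R
  using assms max_roots_pos simple_pos pos_not_neg by (auto simp: Aff_def)

lemma Aff_root: "\<alpha> \<in> Aff \<Longrightarrow> \<alpha> \<in> \<Phi>"
  using max_roots_pos pos_root root_uminus simple_root by (auto simp: Aff_def)

lemma raise_wt_left: "\<alpha> \<in> Aff \<Longrightarrow> x \<in> W \<Longrightarrow> raise_wt \<alpha> (s \<alpha> \<circ> x) = - raise_wt \<alpha> x"
  using inv_left_reflection Aff_root by (simp add: raise_wt_def)

lemma left_weyl: "\<alpha> \<in> Aff \<Longrightarrow> x \<in> W \<Longrightarrow> s \<alpha> \<circ> x \<in> W"
  using weyl_comp weyl_reflection Aff_root by blast

lemma Aff_sign: "\<alpha> \<in> Aff \<Longrightarrow> x \<in> W \<Longrightarrow> inv (s \<alpha> \<circ> x) \<alpha> \<in> P \<longleftrightarrow> inv x \<alpha> \<notin> P"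
  using root_sign Aff_root by blast

text \<open>For \<alpha> = - \<theta> the root \<tau> = inv x \<alpha> is mapped to - \<theta> by \<open>x\<close>. Hence the pairings of
  coroot \<tau> with inverted roots are pairings of coroot \<theta> with positive roots, which are 1 or 0.\<close>

lemma raise_edge:
  assumes "\<alpha> \<in> Aff" "x \<in> W" "inv x \<alpha> \<in> P" shows "edge x (raise_wt \<alpha> x) (s \<alpha> \<circ> x)"
  using assms(1)
proof (cases rule: Aff_cases)
  case simple
  then have "len (s \<alpha> \<circ> x) = len x + 1" using len_simple_left assms by simp
  then show ?thesis using assms simple reflection_comp_weyl[OF assms(2), of \<alpha>]
    by (auto simp: edge_iff raise_wt_def)
next
  case (max_roots \<theta>)
  define \<tau> where "\<tau> = inv x \<alpha>"
  have \<tau>: "\<tau> \<in> P" "x \<tau> = - \<theta>" using assms max_roots by (auto simp: \<tau>_def)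
  have key: "x \<epsilon> \<notin> P \<and> (\<epsilon> \<noteq> \<tau> \<longrightarrow> coroot \<tau> \<bullet> \<epsilon> = 1)" if e: "\<epsilon> \<in> inverted \<tau>" for \<epsilon>
  proof -
    have "coroot \<tau> \<bullet> \<epsilon> = coroot (x \<tau>) \<bullet> x \<epsilon>" using weyl_pairing[OF assms(2)] by simp
    then have p: "coroot \<tau> \<bullet> \<epsilon> = - (coroot \<theta> \<bullet> x \<epsilon>)" by (simp add: \<tau>)
    have ge: "coroot \<tau> \<bullet> \<epsilon> \<ge> 1" using inverted_pairing[OF \<tau>(1) e] .
    then have n: "x \<epsilon> \<notin> P" using p max_roots_dominant[OF max_roots(1), of "x \<epsilon>"] by force
    have "\<epsilon> \<in> \<Phi>" using e pos_root by (auto simp: inverted_def)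
    then have m: "- x \<epsilon> \<in> P" using n pos_uminus weyl_root assms(2) by blast
    have "coroot \<tau> \<bullet> \<epsilon> = 1" if "\<epsilon> \<noteq> \<tau>"
    proof -
      have "- x \<epsilon> \<noteq> \<theta>"
      proof
        assume "- x \<epsilon> = \<theta>"
        then have "x \<epsilon> = x \<tau>" using \<tau>(2) by (metis minus_minus)
        then show False using that assms(2) by (metis weyl_inv_apply(1))
      qed
      then show ?thesis using max_roots_pairing[OF max_roots(1) m] ge p by auto
    qed
    then show ?thesis using n by blast
  qed
  then have "quantum_root \<tau> \<and> (\<forall>\<epsilon>\<in>inverted \<tau>. x \<epsilon> \<notin> P)" using \<tau>(1) by (auto simp: quantum_root_def)
  then have "real (len (x \<circ> s \<tau>)) = real (len x) + 1 - coroot \<tau> \<bullet> rho2"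
    using quantum_iff[OF assms(2) \<tau>(1)] by blast
  moreover have "s \<alpha> \<circ> x = x \<circ> s \<tau>"
    using reflection_comp_weyl[OF assms(2)] by (simp add: \<tau>_def)
  moreover have "raise_wt \<alpha> x = coroot \<tau>" using max_roots(3) by (simp add: raise_wt_def \<tau>_def)
  ultimately show ?thesis unfolding edge_iff using assms(2) \<tau>(1) by (intro conjI bexI[of _ \<tau>]) simp_all
qed

lemma len_left:
  assumes "\<alpha> \<in> Aff" "x \<in> W"
  shows "real (len (s \<alpha> \<circ> x)) = real (len x) + (if inv x \<alpha> \<in> P then 1 else - 1) - raise_wt \<alpha> x \<bullet> rho2"
proof (cases "inv x \<alpha> \<in> P")
  case True
  then have "real (len (s \<alpha> \<circ> x)) = real (len x) + 1 - raise_wt \<alpha> x \<bullet> rho2"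
    by (intro edge_length raise_edge assms)
  then show ?thesis using True by simp
next
  case False
  let ?x = "s \<alpha> \<circ> x"
  have "?x \<in> W" "inv ?x \<alpha> \<in> P" using left_weyl[OF assms] Aff_sign[OF assms] False by auto
  then have "edge ?x (raise_wt \<alpha> ?x) (s \<alpha> \<circ> ?x)" by (rule raise_edge[OF assms(1)])
  from edge_length[OF this] have "real (len x) = real (len ?x) + 1 - raise_wt \<alpha> ?x \<bullet> rho2" by simp
  then show ?thesis using False raise_wt_left[OF assms] by simp
qed

text \<open>An edge along which the root changes from positive to negative inverts a = inv x \<alpha>. For a
  simple root and a Bruhat edge the lifting property bounds s \<alpha> \<circ> x by \<open>y\<close>, which has the same
  length. In the other cases the pairing of a with coroot \<beta>, or the signs of \<open>x a\<close> and x (\<beta> - a),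
  contradict the dominance or the maximality of \<theta> or the criterion for a quantum edge, unless
  a = \<beta>.\<close>

lemma edge_crossing:
  assumes "\<alpha> \<in> Aff" "edge x \<omega> y" "inv x \<alpha> \<in> P" "inv y \<alpha> \<notin> P"
  shows "y = s \<alpha> \<circ> x" "\<omega> = raise_wt \<alpha> x"
proof -
  obtain \<beta> where x: "x \<in> W" and \<beta>: "\<beta> \<in> P" "y = x \<circ> s \<beta>" "\<omega> = 0 \<or> \<omega> = coroot \<beta>"
    and l: "real (len y) = real (len x) + 1 - \<omega> \<bullet> rho2" using assms(2) by (auto simp: edge_iff)
  define a where "a = inv x \<alpha>"
  have y: "y \<in> W" using \<beta> x weyl_right by blast
  have "inv y \<alpha> = s \<beta> a"
    using inv_comp_weyl[OF x pos_weyl[OF \<beta>(1)]] by (simp add: \<beta>(2) a_def)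
  then have a: "a \<in> P" "s \<beta> a \<notin> P" "x a = \<alpha>" using assms(3,4) x by (auto simp: a_def)
  then have aI: "a \<in> inverted \<beta>" by (simp add: inverted_def)
  have k: "coroot \<beta> \<bullet> a \<ge> 1" using inverted_pairing[OF \<beta>(1) aI] .
  have kx: "coroot \<beta> \<bullet> a = coroot (x \<beta>) \<bullet> \<alpha>" using weyl_pairing[OF x, of \<beta> a] a by simp
  have "y = s \<alpha> \<circ> x \<and> \<omega> = raise_wt \<alpha> x"
  proof (cases "\<omega> = 0")
    case True
    then have "len y = len x + 1" using l by simp
    then have "x \<beta> \<in> P" using len_reflection_iff(1)[OF x \<beta>(1)] \<beta>(2) by simp
    from assms(1) show ?thesis
    proof (cases rule: Aff_cases)
      case simple
      have "up \<alpha> x \<preceq> up \<alpha> y"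
        using up_mono[OF _ x simple] bruhat_step[OF x \<beta>(1) \<open>x \<beta> \<in> P\<close>] \<beta>(2) by simp
      then have "s \<alpha> \<circ> x \<preceq> y" using assms(3,4) by (simp add: up_def)
      moreover have "len (s \<alpha> \<circ> x) = len y"
        using len_simple_left(1)[OF x simple] assms(3) \<open>len y = len x + 1\<close> by simp
      ultimately show ?thesis
        using bruhat_len[of "s \<alpha> \<circ> x" y] left_weyl[OF assms(1) x] True simple
        by (auto simp: raise_wt_def)
    next
      case (max_roots \<theta>)
      have "coroot (x \<beta>) \<bullet> \<theta> < 0" using k kx max_roots by simp
      then have "coroot \<theta> \<bullet> x \<beta> < 0"
        using pairing_sign_sym(2)[of "x \<beta>" \<theta>] \<open>x \<beta> \<in> P\<close> max_roots_pos[OF max_roots(1)] pos_root by blast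
      then show ?thesis using max_roots_dominant[OF max_roots(1) \<open>x \<beta> \<in> P\<close>] by simp
    qed
  next
    case False
    then have \<omega>: "\<omega> = coroot \<beta>" using \<beta>(3) by blast
    then have q: "quantum_root \<beta>" "\<And>\<epsilon>. \<epsilon> \<in> inverted \<beta> \<Longrightarrow> x \<epsilon> \<notin> P"
      using quantum_iff[OF x \<beta>(1)] l \<beta>(2) by auto
    from assms(1) show ?thesis
    proof (cases rule: Aff_cases)
      case simple
      then show ?thesis using q(2)[OF aI] a simple_pos by simp
    next
      case (max_roots \<theta>)
      have "a = \<beta>"
      proof (rule ccontr)
        assume ne: "a \<noteq> \<beta>"
        then have "coroot \<beta> \<bullet> a = 1" using q(1) aI by (simp add: quantum_root_def)
        then have opp: "- s \<beta> a = \<beta> - a" by (simp add: reflection_def)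
        have "x (\<beta> - a) \<notin> P" using q(2) inverted_opposite[OF \<beta>(1) aI] opp by simp
        moreover have "\<beta> - a \<in> \<Phi>"
          using opp reflection_root root_uminus pos_root \<beta>(1) a(1) by metis
        ultimately have "- x (\<beta> - a) \<in> P" using pos_uminus weyl_root x by blast
        then have 1: "- x \<beta> - \<theta> \<in> P" using a(3) max_roots(2) x by (simp add: weyl_lin)
        have "- x \<beta> \<in> P" using q(2)[OF inverted_self[OF \<beta>(1)]] pos_uminus weyl_root x \<beta>(1) pos_root by blast
        then have "- x \<beta> = \<theta>" using max_roots_max[OF max_roots(1)] 1 by (simp add: pos_roots_def)
        then show False using 1 pos_nonzero[of 0] by simp
      qed
      then show ?thesis
        using \<omega> max_roots(3) \<beta>(2) reflection_comp_weyl[OF x, of \<alpha>] by (simp add: raise_wt_def a_def)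
    qed
  qed
  then show "y = s \<alpha> \<circ> x" "\<omega> = raise_wt \<alpha> x" by auto
qed

text \<open>If the sign of the root does not change, then the reflection changes the lengths of both
  endpoints in the same way up to the translation of the weight. As pairings with a maximal root are 0
  or 1, the translated weight is again 0 or the coroot of the edge. A Bruhat edge may become a quantum
  edge and vice versa.\<close>

lemma edge_parallel:
  assumes "\<alpha> \<in> Aff" "edge x \<omega> y" "inv x \<alpha> \<in> P \<longleftrightarrow> inv y \<alpha> \<in> P"
  shows "edge (s \<alpha> \<circ> x) (\<omega> + raise_wt \<alpha> y - raise_wt \<alpha> x) (s \<alpha> \<circ> y)"
proof -
  obtain \<beta> where x: "x \<in> W" and \<beta>: "\<beta> \<in> P" "y = x \<circ> s \<beta>" "\<omega> = 0 \<or> \<omega> = coroot \<beta>"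
    and l: "real (len y) = real (len x) + 1 - \<omega> \<bullet> rho2" using assms(2) by (auto simp: edge_iff)
  have y: "y \<in> W" using \<beta> x weyl_right by blast
  define a where "a = inv x \<alpha>"
  have xa: "x a = \<alpha>" using x by (simp add: a_def)
  have ra: "a \<in> \<Phi>" using x weyl_inv weyl_root Aff_root assms(1) by (simp add: a_def)
  have ya: "inv y \<alpha> = s \<beta> a"
    using inv_comp_weyl[OF x pos_weyl[OF \<beta>(1)]] by (simp add: \<beta>(2) a_def)
  have len: "real (len (s \<alpha> \<circ> y)) = real (len (s \<alpha> \<circ> x)) + 1 - (\<omega> + raise_wt \<alpha> y - raise_wt \<alpha> x) \<bullet> rho2"
    using len_left[OF assms(1) x] len_left[OF assms(1) y] l assms(3)
    by (simp add: inner_add_left inner_diff_left)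
  have "\<omega> + raise_wt \<alpha> y - raise_wt \<alpha> x = 0 \<or> \<omega> + raise_wt \<alpha> y - raise_wt \<alpha> x = coroot \<beta>"
    using assms(1)
  proof (cases rule: Aff_cases)
    case simple
    then show ?thesis using \<beta> by (simp add: raise_wt_def)
  next
    case (max_roots \<theta>)
    have not: "a \<noteq> \<beta>" "a \<noteq> - \<beta>"
    proof -
      have "s \<beta> a \<noteq> - a"
        using assms(3) ya pos_uminus[OF ra] by (auto simp: a_def)
      then show "a \<noteq> \<beta>" "a \<noteq> - \<beta>"
        using \<beta>(1) by (auto simp: reflection_self pos_nonzero linear_neg[OF linear_reflection])
    qed
    have ne: "x \<beta> \<noteq> \<theta>" "- x \<beta> \<noteq> \<theta>"
    proof -
      have "x \<beta> \<noteq> x (- a)" "x \<beta> \<noteq> x a"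
        using not x by (metis minus_minus weyl_inv_apply(1))+
      then show "x \<beta> \<noteq> \<theta>" "- x \<beta> \<noteq> \<theta>" using x xa max_roots(2) by (auto simp: weyl_lin)
    qed
    have "coroot a \<bullet> \<beta> = coroot \<alpha> \<bullet> x \<beta>" using weyl_pairing[OF x, of a \<beta>] xa by simp
    then have j: "coroot a \<bullet> \<beta> = - (coroot \<theta> \<bullet> x \<beta>)" by (simp add: max_roots)
    have d: "raise_wt \<alpha> y - raise_wt \<alpha> x = (coroot \<theta> \<bullet> x \<beta>) *\<^sub>R coroot \<beta>"
      using max_roots(3) ya j by (simp add: raise_wt_def a_def[symmetric] coroot_reflection)
    show ?thesis
    proof (cases "\<omega> = 0")
      case True
      then have "x \<beta> \<in> P" using len_reflection_iff(1)[OF x \<beta>(1)] \<beta>(2) l by simp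
      then show ?thesis using max_roots_pairing[OF max_roots(1) _ ne(1)] d True by auto
    next
      case False
      then have \<omega>: "\<omega> = coroot \<beta>" using \<beta>(3) by blast
      then have "x \<beta> \<notin> P"
        using quantum_iff[OF x \<beta>(1)] l \<beta>(2) inverted_self[OF \<beta>(1)] by auto
      then have "- x \<beta> \<in> P" using pos_uminus weyl_root x \<beta>(1) pos_root by blast
      then have "coroot \<theta> \<bullet> x \<beta> = 0 \<or> coroot \<theta> \<bullet> x \<beta> = - 1"
        using max_roots_pairing[OF max_roots(1) _ ne(2)] by auto
      then show ?thesis using d \<omega> by (auto simp: algebra_simps)
    qed
  qed
  moreover have "s \<alpha> \<circ> y = (s \<alpha> \<circ> x) \<circ> s \<beta>" by (simp add: \<beta>(2) comp_assoc)
  ultimately show ?thesis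
    unfolding edge_iff using left_weyl[OF assms(1) x] \<beta>(1) len by (intro conjI bexI[of _ \<beta>]) simp_all
qed

text \<open>The first part follows the path with all its vertices reflected, up to the first edge that runs
  from the negative to the positive side; such an edge has no reflected counterpart, and is bypassed by
  crossing over in the reverse direction. The second part cuts the path at an edge from the positive to
  the negative side, which is a multiplication by the reflection, and reflects what follows.\<close>

lemma path_down:
  assumes "\<alpha> \<in> Aff" "qpath x n \<omega> y" "inv y \<alpha> \<notin> P"
  shows "(inv x \<alpha> \<notin> P \<longrightarrow> qpath (s \<alpha> \<circ> x) n (\<omega> + raise_wt \<alpha> y - raise_wt \<alpha> x) (s \<alpha> \<circ> y)) \<and>
    (inv x \<alpha> \<in> P \<longrightarrow> (\<exists>m. n = Suc m \<and> qpath x m (\<omega> + raise_wt \<alpha> y) (s \<alpha> \<circ> y)))"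
  using assms(2,3)
proof (induction rule: path_induct)
  case (refl x)
  have "qpath (s \<alpha> \<circ> x) 0 (0 + raise_wt \<alpha> x - raise_wt \<alpha> x) (s \<alpha> \<circ> x)"
    using path_refl[OF left_weyl[OF assms(1) refl(1)]] by simp
  then show ?case using refl.prems by blast
next
  case (cons x \<omega> x1 n \<omega>' y)
  have x: "x \<in> W" "x1 \<in> W" using edge_weyl cons(1) by auto
  show ?case
  proof (intro conjI impI)
    assume n: "inv x \<alpha> \<notin> P"
    show "qpath (s \<alpha> \<circ> x) (Suc n) (\<omega> + \<omega>' + raise_wt \<alpha> y - raise_wt \<alpha> x) (s \<alpha> \<circ> y)"
    proof (cases "inv x1 \<alpha> \<in> P")
      case True
      then obtain m where m: "n = Suc m" "qpath x1 m (\<omega>' + raise_wt \<alpha> y) (s \<alpha> \<circ> y)"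
        using cons.IH cons.prems by blast
      let ?x = "s \<alpha> \<circ> x"
      have "edge ?x (raise_wt \<alpha> ?x) (s \<alpha> \<circ> ?x)"
        using raise_edge[OF assms(1) left_weyl[OF assms(1) x(1)]] Aff_sign[OF assms(1) x(1)] n by blast
      then have "edge ?x (- raise_wt \<alpha> x) x" using raise_wt_left[OF assms(1) x(1)] by simp
      from path_cons[OF this path_cons[OF cons(1) m(2)]] show ?thesis
        by (simp add: m(1) algebra_simps)
    next
      case False
      then have "qpath (s \<alpha> \<circ> x1) n (\<omega>' + raise_wt \<alpha> y - raise_wt \<alpha> x1) (s \<alpha> \<circ> y)"
        using cons.IH cons.prems by blast
      from path_cons[OF edge_parallel[OF assms(1) cons(1)] this] n False show ?thesis
        by (simp add: algebra_simps)
    qed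
  next
    assume p: "inv x \<alpha> \<in> P"
    show "\<exists>m. Suc n = Suc m \<and> qpath x m (\<omega> + \<omega>' + raise_wt \<alpha> y) (s \<alpha> \<circ> y)"
    proof (cases "inv x1 \<alpha> \<in> P")
      case True
      then obtain m where m: "n = Suc m" "qpath x1 m (\<omega>' + raise_wt \<alpha> y) (s \<alpha> \<circ> y)"
        using cons.IH cons.prems by blast
      from path_cons[OF cons(1) m(2)] show ?thesis by (simp add: m(1) algebra_simps)
    next
      case False
      then have i: "qpath (s \<alpha> \<circ> x1) n (\<omega>' + raise_wt \<alpha> y - raise_wt \<alpha> x1) (s \<alpha> \<circ> y)"
        using cons.IH cons.prems by blast
      have "x1 = s \<alpha> \<circ> x" "\<omega> = raise_wt \<alpha> x" using edge_crossing[OF assms(1) cons(1) p False] by auto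
      then show ?thesis using i raise_wt_left[OF assms(1) x(1)] by (simp add: algebra_simps)
    qed
  qed
qed

text \<open>The path is reflected until it crosses over to the negative side; there the reflected path meets
  the given one.\<close>

lemma path_up:
  assumes "\<alpha> \<in> Aff" "qpath x n \<omega> y" "inv x \<alpha> \<in> P"
  shows "(inv y \<alpha> \<in> P \<longrightarrow> qpath (s \<alpha> \<circ> x) n (\<omega> + raise_wt \<alpha> y - raise_wt \<alpha> x) (s \<alpha> \<circ> y)) \<and>
    (inv y \<alpha> \<notin> P \<longrightarrow> (\<exists>m. n = Suc m \<and> qpath (s \<alpha> \<circ> x) m (\<omega> - raise_wt \<alpha> x) y))"
  using assms(2,3)
proof (induction rule: path_induct)
  case (refl x)
  have "qpath (s \<alpha> \<circ> x) 0 (0 + raise_wt \<alpha> x - raise_wt \<alpha> x) (s \<alpha> \<circ> x)"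
    using path_refl[OF left_weyl[OF assms(1) refl(1)]] by simp
  then show ?case using refl.prems by blast
next
  case (cons x \<omega> x1 n \<omega>' y)
  have y: "y \<in> W" using path_weyl cons(2) by blast
  show ?case
  proof (cases "inv x1 \<alpha> \<in> P")
    case True
    have e: "edge (s \<alpha> \<circ> x) (\<omega> + raise_wt \<alpha> x1 - raise_wt \<alpha> x) (s \<alpha> \<circ> x1)"
      using edge_parallel[OF assms(1) cons(1)] True cons.prems by blast
    show ?thesis
    proof (intro conjI impI)
      assume "inv y \<alpha> \<in> P"
      then have "qpath (s \<alpha> \<circ> x1) n (\<omega>' + raise_wt \<alpha> y - raise_wt \<alpha> x1) (s \<alpha> \<circ> y)"
        using cons.IH True by blast
      from path_cons[OF e this]
      show "qpath (s \<alpha> \<circ> x) (Suc n) (\<omega> + \<omega>' + raise_wt \<alpha> y - raise_wt \<alpha> x) (s \<alpha> \<circ> y)"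
        by (simp add: algebra_simps)
    next
      assume "inv y \<alpha> \<notin> P"
      then obtain m where m: "n = Suc m" "qpath (s \<alpha> \<circ> x1) m (\<omega>' - raise_wt \<alpha> x1) y"
        using cons.IH True by blast
      from path_cons[OF e m(2)]
      show "\<exists>m. Suc n = Suc m \<and> qpath (s \<alpha> \<circ> x) m (\<omega> + \<omega>' - raise_wt \<alpha> x) y"
        by (simp add: m(1) algebra_simps)
    qed
  next
    case False
    have c: "x1 = s \<alpha> \<circ> x" "\<omega> = raise_wt \<alpha> x" using edge_crossing[OF assms(1) cons(1,4) False] by auto
    have p: "qpath (s \<alpha> \<circ> x) n \<omega>' y" using cons(2) c(1) by simp
    show ?thesis
    proof (intro conjI impI)
      assume "inv y \<alpha> \<in> P"
      then have "qpath y 1 (raise_wt \<alpha> y) (s \<alpha> \<circ> y)" using raise_edge[OF assms(1) y] path_edge by blast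
      from path_append[OF p this]
      show "qpath (s \<alpha> \<circ> x) (Suc n) (\<omega> + \<omega>' + raise_wt \<alpha> y - raise_wt \<alpha> x) (s \<alpha> \<circ> y)"
        by (simp add: c(2))
    next
      show "\<exists>m. Suc n = Suc m \<and> qpath (s \<alpha> \<circ> x) m (\<omega> + \<omega>' - raise_wt \<alpha> x) y"
        using p by (simp add: c(2))
    qed
  qed
qed

section \<open>Minimal weights\<close>

text \<open>In the sum over \<open>R\<close> the vertices \<open>x\<close> and s \<alpha> \<circ> x cancel. What remains are the vertices on the
  negative side that are not reached from within \<open>R\<close>, each of them with a negative contribution.\<close>

lemma raise_sum:
  assumes "R \<subseteq> W" "\<alpha> \<in> Aff"
    and closed: "\<And>x. x \<in> R \<Longrightarrow> inv x \<alpha> \<in> P \<Longrightarrow> s \<alpha> \<circ> x \<in> R"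
  shows "(\<Sum>x\<in>R. height (inv x \<alpha>)) \<le> 0"
    "(\<Sum>x\<in>R. height (inv x \<alpha>)) = 0 \<Longrightarrow> x \<in> R \<Longrightarrow> s \<alpha> \<circ> x \<in> R"
proof -
  define Rpos where "Rpos = {x\<in>R. inv x \<alpha> \<in> P}"
  define Rneg where "Rneg = {x\<in>R. inv x \<alpha> \<notin> P}"
  define Rimg where "Rimg = (\<lambda>x. s \<alpha> \<circ> x) ` Rpos"
  have fin: "finite R" using assms(1) finite_weyl finite_subset by blast
  have RW: "Rpos \<subseteq> W" "Rneg \<subseteq> W" using assms(1) by (auto simp: Rpos_def Rneg_def)
  have img_neg: "Rimg \<subseteq> Rneg"
  proof
    fix y assume "y \<in> Rimg"
    then obtain x where "x \<in> Rpos" "y = s \<alpha> \<circ> x" by (auto simp: Rimg_def)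
    then show "y \<in> Rneg" using closed[of x] Aff_sign[OF assms(2), of x] RW by (auto simp: Rpos_def Rneg_def)
  qed
  have inj: "inj_on (\<lambda>x. s \<alpha> \<circ> x) Rpos"
    by (intro inj_onI) (metis reflection_comp_comp_self(1))
  have "(\<Sum>x\<in>Rimg. height (inv x \<alpha>)) = (\<Sum>x\<in>Rpos. height (inv (s \<alpha> \<circ> x) \<alpha>))"
    unfolding Rimg_def by (simp only: sum.reindex[OF inj] comp_apply o_def)
  also have "\<dots> = (\<Sum>x\<in>Rpos. - height (inv x \<alpha>))"
    using RW inv_left_reflection[OF _ Aff_root[OF assms(2)]]
    by (intro sum.cong refl) (auto simp: height_linear)
  finally have c: "(\<Sum>x\<in>Rimg. height (inv x \<alpha>)) = - (\<Sum>x\<in>Rpos. height (inv x \<alpha>))" by (simp add: sum_negf)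
  have "(\<Sum>x\<in>R. height (inv x \<alpha>)) = (\<Sum>x\<in>Rpos. height (inv x \<alpha>)) + (\<Sum>x\<in>Rneg. height (inv x \<alpha>))"
    using fin by (subst sum.union_disjoint[symmetric]) (auto simp: Rpos_def Rneg_def intro!: sum.cong)
  also have "(\<Sum>x\<in>Rneg. height (inv x \<alpha>)) = (\<Sum>x\<in>Rneg - Rimg. height (inv x \<alpha>)) + (\<Sum>x\<in>Rimg. height (inv x \<alpha>))"
    using fin img_neg by (intro sum.subset_diff) (auto simp: Rneg_def)
  finally have s: "(\<Sum>x\<in>R. height (inv x \<alpha>)) = (\<Sum>x\<in>Rneg - Rimg. height (inv x \<alpha>))" using c by simp
  have neg: "height (inv x \<alpha>) < 0" if "x \<in> Rneg" for x
  proof -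
    have "- inv x \<alpha> \<in> P"
      using that RW pos_uminus weyl_root[OF weyl_inv Aff_root[OF assms(2)]] by (auto simp: Rneg_def)
    then show ?thesis using height_pos[of "- inv x \<alpha>"] by (simp add: height_linear)
  qed
  show "(\<Sum>x\<in>R. height (inv x \<alpha>)) \<le> 0"
    unfolding s using neg by (intro sum_nonpos) force
  assume z: "(\<Sum>x\<in>R. height (inv x \<alpha>)) = 0" and x: "x \<in> R"
  have "Rneg - Rimg = {}"
  proof (rule ccontr)
    assume ne: "Rneg - Rimg \<noteq> {}"
    have "finite (Rneg - Rimg)" using fin by (simp add: Rneg_def)
    then have "(\<Sum>x\<in>Rneg - Rimg. height (inv x \<alpha>)) < (\<Sum>x\<in>Rneg - Rimg. 0)"
      using ne neg by (intro sum_strict_mono) auto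
    then show False using s z by simp
  qed
  then have "x \<in> Rpos \<or> x \<in> Rimg" using x by (auto simp: Rpos_def Rneg_def)
  then show "s \<alpha> \<circ> x \<in> R"
  proof
    assume "x \<in> Rpos"
    then show ?thesis using closed by (simp add: Rpos_def)
  next
    assume "x \<in> Rimg"
    then obtain y where "y \<in> Rpos" "x = s \<alpha> \<circ> y" by (auto simp: Rimg_def)
    then show ?thesis by (simp add: Rpos_def)
  qed
qed

text \<open>A set closed under raising is closed under left multiplication by simple reflections: the sum of
  the maximal roots is a combination of the simple roots with positive coefficients, so the nonpositive
  sums of the preceding lemma, weighted accordingly, add up to zero.\<close>

lemma raise_closed_id:
  assumes "R \<subseteq> W" "R \<noteq> {}"
    and closed: "\<And>x \<alpha>. x \<in> R \<Longrightarrow> \<alpha> \<in> Aff \<Longrightarrow> inv x \<alpha> \<in> P \<Longrightarrow> s \<alpha> \<circ> x \<in> R"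
  shows "id \<in> R"
proof -
  define S where "S \<alpha> = (\<Sum>x\<in>R. height (inv x \<alpha>))" for \<alpha>
  \<comment> \<open>The marks of the affine Dynkin diagram, if the root system is
    irreducible.\<close>
  define m where "m a = coord a (\<Sum>\<theta>\<in>max_roots. \<theta>)" for a
  have finT: "finite max_roots" using finite_pos by (simp add: max_roots_def)
  have cone: "(\<Sum>\<theta>\<in>max_roots. \<theta>) \<in> RC"
    using finT max_roots_pos by (induction rule: finite_induct[OF finT]) (auto simp: pos_roots_def intro: nat_cone_add)
  have rel: "(\<Sum>\<theta>\<in>max_roots. \<theta>) = (\<Sum>a\<in>\<Delta>. m a *\<^sub>R a)"
    unfolding m_def using cone by (rule cone_expand)
  have mpos: "m a > 0" if a: "a \<in> \<Delta>" for a
  proof -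
    obtain \<theta> where "\<theta> \<in> max_roots" "coord a \<theta> > 0" using max_roots_exists a by blast
    then show ?thesis unfolding m_def coord_linear
      using finT coord_pos[OF max_roots_pos a] by (intro sum_pos2[of _ \<theta>]) auto
  qed
  have point: "(\<Sum>a\<in>\<Delta>. m a * height (inv x a)) = - (\<Sum>\<theta>\<in>max_roots. height (inv x (- \<theta>)))" if x: "x \<in> R" for x
  proof -
    have l: "linear (\<lambda>v. height (inv x v))"
      using linear_compose[OF weyl_linear[OF weyl_inv] linear_height, of x] x assms(1) by (auto simp: o_def)
    have "(\<Sum>a\<in>\<Delta>. m a * height (inv x a)) = height (inv x (\<Sum>a\<in>\<Delta>. m a *\<^sub>R a))"
      unfolding linear_sum[OF l] using linear_scale[OF l] by simp
    also have "\<dots> = (\<Sum>\<theta>\<in>max_roots. height (inv x \<theta>))"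
      unfolding rel[symmetric] using linear_sum[OF l] by simp
    also have "\<dots> = - (\<Sum>\<theta>\<in>max_roots. height (inv x (- \<theta>)))"
      using linear_neg[OF l] by (simp add: sum_negf)
    finally show ?thesis .
  qed
  have nonpos: "S \<alpha> \<le> 0" if "\<alpha> \<in> Aff" for \<alpha>
    unfolding S_def using closed by (intro raise_sum(1)[OF assms(1) that]) (use that in blast)
  have "(\<Sum>a\<in>\<Delta>. m a * S a) = (\<Sum>x\<in>R. \<Sum>a\<in>\<Delta>. m a * height (inv x a))"
    unfolding S_def sum_distrib_left by (rule sum.swap)
  also have "\<dots> = (\<Sum>x\<in>R. - (\<Sum>\<theta>\<in>max_roots. height (inv x (- \<theta>))))"
    using point by (intro sum.cong) auto
  also have "\<dots> = - (\<Sum>x\<in>R. \<Sum>\<theta>\<in>max_roots. height (inv x (- \<theta>)))" by (rule sum_negf)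
  also have "(\<Sum>x\<in>R. \<Sum>\<theta>\<in>max_roots. height (inv x (- \<theta>))) = (\<Sum>\<theta>\<in>max_roots. S (- \<theta>))"
    unfolding S_def by (rule sum.swap)
  finally have total: "(\<Sum>a\<in>\<Delta>. m a * S a) = - (\<Sum>\<theta>\<in>max_roots. S (- \<theta>))" .
  have "(\<Sum>\<theta>\<in>max_roots. S (- \<theta>)) \<le> 0"
    using nonpos by (intro sum_nonpos) (auto simp: Aff_def)
  moreover have ms: "m a * S a \<le> 0" if "a \<in> \<Delta>" for a
    using mpos[OF that] nonpos[of a] that by (simp add: Aff_def mult_nonneg_nonpos)
  ultimately have "(\<Sum>a\<in>\<Delta>. - (m a * S a)) = 0"
    using total sum_nonpos[of \<Delta> "\<lambda>a. m a * S a"] by (simp add: sum_negf)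
  then have "\<forall>a\<in>\<Delta>. - (m a * S a) = 0"
    using ms finite_simple by (subst (asm) sum_nonneg_eq_0_iff) auto
  then have S0: "S a = 0" if "a \<in> \<Delta>" for a using that mpos by force
  have step: "s a \<circ> x \<in> R" if "a \<in> \<Delta>" "x \<in> R" for a x
  proof (rule raise_sum(2)[OF assms(1)])
    show "a \<in> Aff" using that by (simp add: Aff_def)
    then show "s a \<circ> x \<in> R" if "x \<in> R" "inv x a \<in> P" for x using closed that by blast
    show "(\<Sum>x\<in>R. height (inv x a)) = 0" using S0[OF that(1)] by (simp add: S_def)
  qed (rule that)
  have all: "w \<circ> x \<in> R" if w: "w \<in> W" and x: "x \<in> R" for w x
    using w
  proof (induction rule: weyl_left_induct)
    case id
    have "id \<circ> x \<in> R" using x by simp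
    then show ?case .
  next
    case (left w a)
    then have "(s a \<circ> w) \<circ> x \<in> R" using step[of a "w \<circ> x"] by (metis comp_assoc)
    then show ?case .
  qed
  obtain x where "x \<in> R" using assms(2) by blast
  then show ?thesis using all[of "inv x" x] assms(1) weyl_inv by auto
qed

definition has_min :: "('a \<Rightarrow> 'a) \<Rightarrow> ('a \<Rightarrow> 'a) \<Rightarrow> bool" where
  "has_min x y \<longleftrightarrow> (\<exists>n0 \<omega>0. qpath x n0 \<omega>0 y \<and> (\<forall>n \<omega>. qpath x n \<omega> y \<longrightarrow> \<omega> - \<omega>0 \<in> QC))"

lemma has_min_raise:
  assumes "\<alpha> \<in> Aff" "x \<in> W" "inv x \<alpha> \<in> P" "inv y \<alpha> \<notin> P" "has_min (s \<alpha> \<circ> x) y"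
  shows "has_min x y"
proof -
  let ?x = "s \<alpha> \<circ> x"
  obtain n0 \<omega>0 where m: "qpath ?x n0 \<omega>0 y" "\<And>n \<omega>. qpath ?x n \<omega> y \<Longrightarrow> \<omega> - \<omega>0 \<in> QC"
    using assms(5) by (auto simp: has_min_def)
  have "qpath x (Suc n0) (raise_wt \<alpha> x + \<omega>0) y" using path_cons[OF raise_edge[OF assms(1-3)] m(1)] .
  moreover have "\<omega> - (raise_wt \<alpha> x + \<omega>0) \<in> QC" if p: "qpath x n \<omega> y" for n \<omega>
  proof -
    obtain k where "qpath ?x k (\<omega> - raise_wt \<alpha> x) y" using path_up[OF assms(1) p assms(3)] assms(4) by blast
    then have "\<omega> - raise_wt \<alpha> x - \<omega>0 \<in> QC" by (rule m(2))
    then show ?thesis by (simp add: diff_diff_add)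
  qed
  ultimately show ?thesis unfolding has_min_def by blast
qed

lemma has_min_parallel:
  assumes "\<alpha> \<in> Aff" "x \<in> W" "y \<in> W" "inv x \<alpha> \<in> P" "inv y \<alpha> \<in> P"
    "has_min (s \<alpha> \<circ> x) (s \<alpha> \<circ> y)"
  shows "has_min x y"
proof -
  let ?x = "s \<alpha> \<circ> x" and ?y = "s \<alpha> \<circ> y"
  obtain n0 \<omega>0 where m: "qpath ?x n0 \<omega>0 ?y" "\<And>n \<omega>. qpath ?x n \<omega> ?y \<Longrightarrow> \<omega> - \<omega>0 \<in> QC"
    using assms(6) by (auto simp: has_min_def)
  have s: "inv ?x \<alpha> \<notin> P" "inv ?y \<alpha> \<notin> P" using Aff_sign assms by blast+
  have "qpath x n0 (\<omega>0 - raise_wt \<alpha> y + raise_wt \<alpha> x) y"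
    using path_down[OF assms(1) m(1) s(2)] s(1) raise_wt_left[OF assms(1)] assms(2,3) by simp
  moreover have "\<omega> - (\<omega>0 - raise_wt \<alpha> y + raise_wt \<alpha> x) \<in> QC" if p: "qpath x n \<omega> y" for n \<omega>
  proof -
    have "qpath ?x n (\<omega> + raise_wt \<alpha> y - raise_wt \<alpha> x) ?y" using path_up[OF assms(1) p assms(4)] assms(5) by blast
    then have "\<omega> + raise_wt \<alpha> y - raise_wt \<alpha> x - \<omega>0 \<in> QC" by (rule m(2))
    then show ?thesis by (simp add: algebra_simps)
  qed
  ultimately show ?thesis unfolding has_min_def by blast
qed

lemma shortest_path:
  assumes "qpath x n \<omega> y"
  obtains k \<omega>1 where "qpath x k \<omega>1 y" "\<And>j \<omega>. qpath x j \<omega> y \<Longrightarrow> k \<le> j"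
proof -
  define Q where "Q k \<longleftrightarrow> (\<exists>\<omega>. qpath x k \<omega> y)" for k
  have "Q n" using assms by (auto simp: Q_def)
  then have "Q (LEAST k. Q k)" by (rule LeastI)
  then obtain \<omega>1 where "qpath x (LEAST k. Q k) \<omega>1 y" by (auto simp: Q_def)
  then show ?thesis
  proof (rule that)
    fix j \<omega> assume "qpath x j \<omega> y"
    then have "Q j" by (auto simp: Q_def)
    then show "(LEAST k. Q k) \<le> j" by (rule Least_le)
  qed
qed

text \<open>Induction on the distance. Consider a counterexample of smallest distance, and all pairs
  (u, u \<circ> inv g) with the same relative position \<open>g\<close> that are counterexamples, too. Raising such a
  pair cannot bring the two vertices closer, so both are raised simultaneously and the pair remains a
  counterexample. So the pair with \<open>u = id\<close> is among them; but raising it at a descent of \<open>g\<close>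
  does bring the vertices closer.\<close>

lemma dist_has_min:
  assumes "qpath x N \<omega> y" "\<And>m \<omega>'. qpath x m \<omega>' y \<Longrightarrow> N \<le> m"
  shows "has_min x y"
  using assms
proof (induction N arbitrary: x y \<omega> rule: less_induct)
  case (less N)
  have W: "x \<in> W" "y \<in> W" using path_weyl less.prems(1) by auto
  have closer: "has_min u v" if uv: "qpath u m \<omega>' v" "m < N" for u v m \<omega>'
  proof -
    obtain k \<omega>1 where k: "qpath u k \<omega>1 v" "\<And>j \<omega>. qpath u j \<omega> v \<Longrightarrow> k \<le> j"
      using shortest_path[OF uv(1)] by metis
    have "k < N" using k(2)[OF uv(1)] uv(2) by simp
    then show ?thesis using k by (rule less.IH)
  qed
  show ?case
  proof (rule ccontr)
    assume nm: "\<not> has_min x y"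
    define g where "g = inv y \<circ> x"
    have g: "g \<in> W" using W weyl_comp weyl_inv by (simp add: g_def)
    define R where "R = {u\<in>W. \<not> has_min u (u \<circ> inv g) \<and> (\<exists>\<omega>. qpath u N \<omega> (u \<circ> inv g))}"
    have "inv g = inv x \<circ> y" using W inv_comp_weyl[of "inv y" x] weyl_inv by (simp add: g_def)
    then have "x \<circ> inv g = y" using W by (simp add: comp_assoc[symmetric])
    then have xR: "x \<in> R" using nm less.prems(1) W by (auto simp: R_def)
    \<comment> \<open>The distance drops if the root separates the two vertices.\<close>
    have cross: False if uc: "u \<in> R" "\<alpha> \<in> Aff" "inv u \<alpha> \<in> P" "inv (u \<circ> inv g) \<alpha> \<notin> P" for u \<alpha>
    proof -
      obtain \<omega>' where u: "qpath u N \<omega>' (u \<circ> inv g)" "u \<in> W" "\<not> has_min u (u \<circ> inv g)"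
        using uc(1) by (auto simp: R_def)
      obtain m where m: "N = Suc m" "qpath (s \<alpha> \<circ> u) m (\<omega>' - raise_wt \<alpha> u) (u \<circ> inv g)"
        using path_up[OF uc(2) u(1) uc(3)] uc(4) by blast
      have "has_min (s \<alpha> \<circ> u) (u \<circ> inv g)" using closer[OF m(2)] m(1) by simp
      then show False using has_min_raise[OF uc(2) u(2) uc(3,4)] u(3) by blast
    qed
    have "id \<in> R"
    proof (rule raise_closed_id)
      show "R \<subseteq> W" by (auto simp: R_def)
      show "R \<noteq> {}" using xR by blast
      fix u \<alpha> assume u: "u \<in> R" "\<alpha> \<in> Aff" "inv u \<alpha> \<in> P"
      then have p: "inv (u \<circ> inv g) \<alpha> \<in> P" using cross by blast
      obtain \<omega>' where uR: "qpath u N \<omega>' (u \<circ> inv g)" "u \<in> W" "\<not> has_min u (u \<circ> inv g)"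
        using u(1) by (auto simp: R_def)
      have v: "u \<circ> inv g \<in> W" using uR g weyl_comp weyl_inv by blast
      have e: "(s \<alpha> \<circ> u) \<circ> inv g = s \<alpha> \<circ> (u \<circ> inv g)" by (simp add: comp_assoc)
      have "\<exists>\<omega>. qpath (s \<alpha> \<circ> u) N \<omega> (s \<alpha> \<circ> (u \<circ> inv g))"
        using path_up[OF u(2) uR(1) u(3)] p by blast
      moreover have "\<not> has_min (s \<alpha> \<circ> u) (s \<alpha> \<circ> (u \<circ> inv g))"
        using has_min_parallel[OF u(2) uR(2) v u(3) p] uR(3) by blast
      ultimately show "s \<alpha> \<circ> u \<in> R"
        unfolding R_def using left_weyl[OF u(2) uR(2)] e by (intro CollectI conjI) metis+
    qed
    have "g \<noteq> id"
    proof
      assume "g = id"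
      then have "y = x" using \<open>x \<circ> inv g = y\<close> by simp
      moreover have "has_min x x" unfolding has_min_def
        using path_refl[OF W(1)] path_weight by (intro exI[of _ 0]) auto
      ultimately show False using nm by simp
    qed
    then obtain a where a: "a \<in> \<Delta>" "g a \<notin> P" using right_descent g by blast
    then show False
      using cross[OF \<open>id \<in> R\<close>, of a] simple_pos g by (simp add: Aff_def)
  qed
qed

lemma path_has_min: "qpath x n \<omega> y \<Longrightarrow> has_min x y"
  using shortest_path dist_has_min by metis

text \<open>A path with the minimal weight is shortest, since the length of a path increases with its
  weight; and every path of the same length has the same weight for the same reason.\<close>

lemma wt_minimal:
  assumes "qpath x n \<omega> y"
  shows "\<exists>m. qpath x m (wt \<Phi> \<Delta> x y) y" "\<omega> - wt \<Phi> \<Delta> x y \<in> QC"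
proof -
  obtain n0 \<omega>0 where m: "qpath x n0 \<omega>0 y" "\<And>n \<omega>. qpath x n \<omega> y \<Longrightarrow> \<omega> - \<omega>0 \<in> QC"
    using path_has_min[OF assms] by (auto simp: has_min_def)
  have len: "real k - real n0 = (\<omega>1 - \<omega>0) \<bullet> rho2" if "qpath x k \<omega>1 y" for k \<omega>1
    using path_length[OF that] path_length[OF m(1)] by (simp add: inner_diff_left)
  have short: "n0 \<le> k" if "qpath x k \<omega>1 y" for k \<omega>1
    using len[OF that] QC_two_rho(1)[OF m(2)[OF that]] by simp
  have uniq: "\<omega>1 = \<omega>0" if p: "qpath x k \<omega>1 y" "k \<le> n0" for k \<omega>1
  proof -
    have "(\<omega>1 - \<omega>0) \<bullet> rho2 = 0" using len[OF p(1)] p(2) QC_two_rho(1)[OF m(2)[OF p(1)]] by simp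
    then show ?thesis using QC_two_rho(2)[OF m(2)[OF p(1)]] by simp
  qed
  have "wt \<Phi> \<Delta> x y = \<omega>0"
    unfolding wt_def
  proof (rule the_equality)
    show "\<exists>n. qpath x n \<omega>0 y \<and> (\<forall>m \<omega>'. qpath x m \<omega>' y \<longrightarrow> n \<le> m)" using m(1) short by blast
  qed (use m(1) uniq in blast)
  then show "\<exists>m. qpath x m (wt \<Phi> \<Delta> x y) y" "\<omega> - wt \<Phi> \<Delta> x y \<in> QC" using m assms by auto
qed

section \<open>Paths from Demazure products\<close>

lemma simple_in_Aff: "a \<in> \<Delta> \<Longrightarrow> a \<in> Aff" by (simp add: Aff_def)

lemma raise_wt_simple: "a \<in> \<Delta> \<Longrightarrow> raise_wt a x = 0" by (simp add: raise_wt_def)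

text \<open>A step of the Bruhat order can be refined to a path of Bruhat edges. By induction on the length
  of \<open>y\<close>, this is known after removing a left descent \<open>a\<close> of \<open>y\<close>; the resulting path is either
  extended at both ends or reflected.\<close>

lemma bruhat_step_path:
  assumes "x \<in> W" "\<beta> \<in> P" "x \<beta> \<in> P" shows "\<exists>n. qpath x n 0 (x \<circ> s \<beta>)"
  using assms(1,3)
proof (induction "len (x \<circ> s \<beta>)" arbitrary: x rule: less_induct)
  case less
  let ?y = "x \<circ> s \<beta>"
  have y: "?y \<in> W" using less assms weyl_right by blast
  have "len x < len ?y" using less len_reflection_iff(1)[OF less.prems(1) assms(2)] by blast
  then have "?y \<noteq> id" by (metis len_id not_less_zero)
  then obtain a where a: "a \<in> \<Delta>" "inv ?y a \<notin> P" using left_descent y by blast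
  let ?x' = "s a \<circ> x" and ?y' = "s a \<circ> ?y"
  have W': "?x' \<in> W" "?y' \<in> W" using less.prems y left_weyl[OF simple_in_Aff[OF a(1)]] by auto
  have e: "?y' = ?x' \<circ> s \<beta>" by (simp add: comp_assoc)
  have pos': "inv ?y' a \<in> P" using left_sign[OF y a(1)] a(2) by blast
  have cancel: "s a \<circ> ?y' = ?y" "s a \<circ> ?x' = x" by simp_all
  have "len ?y' < len ?y" using len_simple_left[OF y a(1)] a(2) by simp
  then have IH: "\<exists>n. qpath ?x' n 0 ?y'" if "x \<beta> \<noteq> a"
    using less.hyps[OF _ W'(1)] that e simple_reflection_pos[OF less.prems(2) a(1)] by simp
  show ?case
  proof (cases "inv x a \<in> P")
    case True
    have up: "edge x 0 ?x'" using raise_edge[OF simple_in_Aff[OF a(1)] less.prems(1) True] a by (simp add: raise_wt_simple)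
    show ?thesis
    proof (cases "x \<beta> = a")
      case True
      then show ?thesis using simple_step(1)[OF less.prems(1)] path_edge[OF up] by metis
    next
      case False
      then obtain n where n: "qpath ?x' n 0 ?y'" using IH by blast
      have "edge ?y' 0 ?y"
        using raise_edge[OF simple_in_Aff[OF a(1)] W'(2) pos'] a cancel by (simp add: raise_wt_simple)
      then show ?thesis using path_append[OF path_cons[OF up n] path_edge] by auto
    qed
  next
    case False
    then have "x \<beta> \<noteq> a" using less.prems assms by auto
    then obtain n where n: "qpath ?x' n 0 ?y'" using IH by blast
    have "inv ?x' a \<in> P" using left_sign[OF less.prems(1) a(1)] False by blast
    then have "qpath x n 0 ?y"
      using path_up[OF simple_in_Aff[OF a(1)] n] pos' cancel a(1) by (simp add: raise_wt_simple)
    then show ?thesis by blast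
  qed
qed

lemma bruhat_path:
  assumes "x \<preceq> y" "x \<in> W" shows "\<exists>n. qpath x n 0 y"
  using assms
proof (induction rule: bruhat_induct)
  case refl
  show ?case using path_refl[OF assms(2)] by blast
next
  case (step u \<beta>)
  obtain n m where "qpath x n 0 u" "qpath u m 0 (u \<circ> s \<beta>)"
    using step bruhat_step_path by blast
  then have "qpath x (n + m) 0 (u \<circ> s \<beta>)" using path_append by fastforce
  then have "\<exists>n. qpath x n 0 (u \<circ> s \<beta>)" by blast
  then show ?case .
qed

text \<open>Induction on a reduced word of \<open>u\<close>: a new letter on the left either raises both endpoints, or
  it is absorbed by u \<star> v and only extends the path by a Bruhat edge at its target.\<close>

lemma dem_path:
  assumes "qpath v n \<omega> id" "u \<in> W" shows "\<exists>m. qpath (u \<star> v) m \<omega> u"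
  using assms(2)
proof (induction rule: weyl_left_induct)
  case id
  have "v \<in> W" using assms(1) path_weyl by blast
  then have "\<exists>m. qpath (id \<star> v) m \<omega> id" using assms(1) by auto
  then show ?case .
next
  case (left u a)
  have v: "v \<in> W" using assms(1) path_weyl by blast
  obtain m where m: "qpath (u \<star> v) m \<omega> u" using left by blast
  have "\<exists>m. qpath ((s a \<circ> u) \<star> v) m \<omega> (s a \<circ> u)"
  proof (cases "inv (u \<star> v) a \<in> P")
    case True
    then have "qpath (s a \<circ> (u \<star> v)) m \<omega> (s a \<circ> u)"
      using path_up[OF simple_in_Aff[OF left(2)] m True] left by (simp add: raise_wt_simple)
    then show ?thesis using dem_left[OF left(1) v left(2,3)] True by (auto simp: up_def)
  next
    case False
    have "edge u 0 (s a \<circ> u)"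
      using raise_edge[OF simple_in_Aff[OF left(2)] left(1,3)] left(2) by (simp add: raise_wt_simple)
    then have "qpath (u \<star> v) (m + 1) \<omega> (s a \<circ> u)"
      using path_append[OF m path_edge] by fastforce
    then show ?thesis using dem_left[OF left(1) v left(2,3)] False by (auto simp: up_def)
  qed
  then show ?case .
qed

lemma quantum_root_path:
  assumes "quantum_root \<beta>" shows "qpath (s \<beta>) 1 (coroot \<beta>) id"
proof -
  have \<beta>: "\<beta> \<in> P" using assms by (simp add: quantum_root_def)
  have "\<forall>\<epsilon>\<in>inverted \<beta>. s \<beta> \<epsilon> \<notin> P" by (simp add: inverted_def)
  then have "edge (s \<beta>) (coroot \<beta>) (s \<beta> \<circ> s \<beta>)"
    using qbg_edge.quantum_edge[OF pos_weyl[OF \<beta>] \<beta>] quantum_iff[OF pos_weyl[OF \<beta>] \<beta>] assms by blast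
  then show ?thesis using path_edge by simp
qed

lemma path_to_id:
  assumes "x \<in> W" shows "\<exists>n \<omega>. qpath x n \<omega> id"
  using assms
proof (induction "len x" arbitrary: x rule: less_induct)
  case less
  show ?case
  proof (cases "x = id")
    case True
    then show ?thesis using path_refl[OF weyl_id] by blast
  next
    case False
    then obtain a where a: "a \<in> \<Delta>" "x a \<notin> P" using right_descent less.prems by blast
    have "edge x (coroot a) (x \<circ> s a)"
      using qbg_edge.quantum_edge[OF less.prems simple_pos[OF a(1)]]
        quantum_iff[OF less.prems simple_pos[OF a(1)]] quantum_root_simple a inverted_simple by auto
    moreover have "len (x \<circ> s a) < len x"
      using len_simple_right[OF less.prems a(1)] a by simp
    then obtain n \<omega> where "qpath (x \<circ> s a) n \<omega> id"
      using less.hyps weyl_right[OF less.prems simple_pos[OF a(1)]] by blast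
    ultimately show ?thesis using path_cons by blast
  qed
qed

section \<open>The cone of coroots\<close>

lemma QC_sum: "(\<And>i. i \<in> I \<Longrightarrow> f i \<in> QC) \<Longrightarrow> sum f I \<in> QC"
  by (induction I rule: infinite_finite_induct) (auto intro: nat_cone_add)

lemma QC_combination: "(\<Sum>a\<in>\<Delta>. real (c a) *\<^sub>R coroot a) \<in> QC"
  by (intro QC_sum nat_cone_scale simple_coroot_QC)

lemma QC_pairing_int:
  assumes "\<gamma> \<in> QC" "a \<in> \<Delta>" shows "\<gamma> \<bullet> a \<in> \<int>"
proof -
  obtain c where c: "\<gamma> = (\<Sum>b\<in>\<Delta>. real (c b) *\<^sub>R coroot b)" using assms(1) by (rule QC_expand)
  have "\<gamma> \<bullet> a = (\<Sum>b\<in>\<Delta>. real (c b) * (coroot b \<bullet> a))" unfolding c by (simp add: inner_sum_left)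
  also have "\<dots> \<in> \<int>"
    using assms(2) integral simple_root by (intro Ints_sum Ints_mult Ints_of_nat) blast+
  finally show ?thesis .
qed

lemma coroot_simple_nonpos:
  assumes "a \<in> \<Delta>" "b \<in> \<Delta>" "a \<noteq> b" shows "coroot a \<bullet> b \<le> 0"
  using coroot_pairing_sign(1)[of a b] pairing_nonpos_simple[OF assms] assms root_nonzero simple_root
  by force

text \<open>Simple roots pair nonpositively with the other simple coroots, so a positive pairing requires a
  positive coefficient.\<close>

lemma QC_subtract:
  assumes "\<gamma> \<in> QC" "a \<in> \<Delta>" "\<gamma> \<bullet> a > 0" shows "\<gamma> - coroot a \<in> QC"
proof -
  obtain c where c: "\<gamma> = (\<Sum>b\<in>\<Delta>. real (c b) *\<^sub>R coroot b)" using assms(1) by (rule QC_expand)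
  have "c a \<noteq> 0"
  proof
    assume z: "c a = 0"
    have "\<gamma> \<bullet> a = (\<Sum>b\<in>\<Delta>. real (c b) * (coroot b \<bullet> a))" unfolding c by (simp add: inner_sum_left)
    also have "\<dots> \<le> 0"
    proof (rule sum_nonpos)
      fix b assume "b \<in> \<Delta>"
      then show "real (c b) * (coroot b \<bullet> a) \<le> 0"
        using z coroot_simple_nonpos[of b a] assms(2) by (cases "b = a") (simp_all add: mult_nonneg_nonpos)
    qed
    finally show False using assms(3) by simp
  qed
  then have "real (c b - of_bool (b = a)) = real (c b) - of_bool (b = a)" for b by auto
  then have "(\<Sum>b\<in>\<Delta>. real (c b - of_bool (b = a)) *\<^sub>R coroot b)
      = \<gamma> - (\<Sum>b\<in>\<Delta>. of_bool (b = a) *\<^sub>R coroot b)"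
    unfolding c by (simp add: scaleR_diff_left sum_subtractf)
  also have "(\<Sum>b\<in>\<Delta>. of_bool (b = a) *\<^sub>R coroot b) = (\<Sum>b\<in>\<Delta>. if b = a then coroot a else 0)"
    by (intro sum.cong) auto
  also have "\<dots> = coroot a" using assms(2) finite_simple by simp
  finally show ?thesis using QC_combination[of "\<lambda>b. c b - of_bool (b = a)"] by simp
qed

text \<open>Otherwise \<gamma> \<bullet> \<gamma> would not be positive.\<close>

lemma QC_positive_pairing:
  assumes "\<gamma> \<in> QC" "\<gamma> \<noteq> 0" shows "\<exists>a\<in>\<Delta>. \<gamma> \<bullet> a > 0"
proof (rule ccontr)
  assume "\<not> ?thesis"
  then have n: "a \<bullet> \<gamma> \<le> 0" if "a \<in> \<Delta>" for a using that by (force simp: inner_commute)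
  obtain c where c: "\<gamma> = (\<Sum>b\<in>\<Delta>. real (c b) *\<^sub>R coroot b)" using assms(1) by (rule QC_expand)
  have "\<gamma> \<bullet> \<gamma> = (\<Sum>b\<in>\<Delta>. real (c b) *\<^sub>R coroot b) \<bullet> \<gamma>" using c by metis
  also have "\<dots> = (\<Sum>b\<in>\<Delta>. real (c b) * (coroot b \<bullet> \<gamma>))" by (simp add: inner_sum_left)
  also have "\<dots> \<le> 0"
    using n coroot_pairing_sign(1)[of _ \<gamma>] root_nonzero simple_root
    by (intro sum_nonpos mult_nonneg_nonpos) (auto simp: not_less[symmetric])
  finally show False using assms(2) inner_gt_zero_iff[of \<gamma>] by linarith
qed

lemma coroot_nonzero: "\<beta> \<in> P \<Longrightarrow> coroot \<beta> \<noteq> 0"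
  using pos_nonzero[of \<beta>] by (simp add: coroot_def)

lemma Ints_pos_cases:
  assumes "(k::real) \<in> \<int>" "k > 0" shows "k = 1 \<or> k \<ge> 2"
proof -
  obtain z where z: "k = of_int z" using assms(1) by (auto simp: Ints_def)
  then have "z = 1 \<or> z \<ge> 2" using assms(2) by (simp, arith)
  then show ?thesis unfolding z by (metis of_int_1 of_int_le_iff of_int_numeral)
qed

lemma Ints_neg_cases: "(k::real) \<in> \<int> \<Longrightarrow> k < 0 \<Longrightarrow> k = - 1 \<or> k \<le> - 2"
  using Ints_pos_cases[of "- k"] by auto

text \<open>Twice the height with respect to the simple coroots; the measure for the inductions below.\<close>

definition coroot_height :: "'a \<Rightarrow> nat" where "coroot_height \<gamma> = nat \<lfloor>\<gamma> \<bullet> rho2\<rfloor>"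

lemma coroot_height_less:
  assumes "\<gamma> - coroot \<beta> \<in> QC" "\<beta> \<in> P" shows "coroot_height (\<gamma> - coroot \<beta>) < coroot_height \<gamma>"
proof -
  have b: "coroot \<beta> \<in> QC" using coroot_pos_QC assms(2) .
  have pos: "coroot \<beta> \<bullet> rho2 > 0" using QC_two_rho[OF b] coroot_nonzero[OF assms(2)] by force
  obtain n m where nm: "(\<gamma> - coroot \<beta>) \<bullet> rho2 = real n" "coroot \<beta> \<bullet> rho2 = real m"
    using QC_two_rho(3)[OF assms(1)] QC_two_rho(3)[OF b] by (auto simp: Nats_def)
  then have "\<gamma> \<bullet> rho2 = real (n + m)" by (simp add: inner_diff_left)
  then show ?thesis using nm pos by (simp add: coroot_height_def)
qed

lemma maximal_root_exists:
  assumes "\<gamma> \<in> QC" "\<gamma> \<noteq> 0" shows "\<exists>\<beta>. max_below \<gamma> \<beta>"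
proof -
  let ?S = "{\<beta>\<in>P. \<gamma> - coroot \<beta> \<in> QC}"
  obtain a where "a \<in> \<Delta>" "\<gamma> \<bullet> a > 0" using QC_positive_pairing assms by blast
  then have "a \<in> ?S" using QC_subtract assms simple_pos by blast
  then have "?S \<subseteq> P" "?S \<noteq> {}" by blast+
  then obtain \<beta> where "\<beta> \<in> ?S" "\<And>\<delta>. \<delta> \<in> ?S \<Longrightarrow> \<delta> - \<beta> \<in> RC \<Longrightarrow> \<delta> = \<beta>"
    by (rule highest_pos_root) blast
  then show ?thesis
    by (intro exI[of _ \<beta>]) (auto simp: maximal_root_below_def coroot_le_def root_le_def)
qed

text \<open>If the pairing were negative, then one of s a \<beta> and s \<beta> a would be a bigger root whose
  coroot is coroot \<beta> + coroot a, because one of the two pairings of \<beta> and \<open>a\<close> is \<open>- 1\<close>.\<close>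

lemma maximal_root_pairing:
  assumes "max_below \<gamma> \<beta>" "a \<in> \<Delta>" "\<gamma> - coroot \<beta> - coroot a \<in> QC"
  shows "coroot \<beta> \<bullet> a \<ge> 0"
proof (rule ccontr)
  assume "\<not> ?thesis"
  then have k: "coroot \<beta> \<bullet> a < 0" by simp
  have \<beta>: "\<beta> \<in> P"
    and max: "\<And>\<delta>. \<delta> \<in> P \<Longrightarrow> \<gamma> - coroot \<delta> \<in> QC \<Longrightarrow> \<delta> - \<beta> \<in> RC \<Longrightarrow> \<delta> = \<beta>"
    using assms by (auto simp: maximal_root_below_def coroot_le_def root_le_def)
  have root: "\<beta> \<in> \<Phi>" "a \<in> \<Phi>" using \<beta> assms(2) pos_root simple_root by auto
  have c: "coroot a \<bullet> \<beta> < 0" using k pairing_sign_sym(2)[OF root] by simp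
  have ints: "coroot \<beta> \<bullet> a \<in> \<int>" "coroot a \<bullet> \<beta> \<in> \<int>" using integral root by auto
  have ne: "a \<noteq> \<beta>" "a \<noteq> - \<beta>"
    using k pos_nonzero[OF \<beta>] \<beta> assms(2) simple_pos pos_not_neg[of \<beta>] by auto
  have "(coroot \<beta> \<bullet> a) * (coroot a \<bullet> \<beta>) < 4" using pairing_product[OF root ne] .
  have one: "coroot \<beta> \<bullet> a = - 1 \<or> coroot a \<bullet> \<beta> = - 1"
  proof (rule ccontr)
    assume "\<not> ?thesis"
    then have "- (coroot \<beta> \<bullet> a) \<ge> 2" "- (coroot a \<bullet> \<beta>) \<ge> 2" 
      using k c Ints_neg_cases ints by force+
    then have "2 * 2 \<le> (- (coroot \<beta> \<bullet> a)) * (- (coroot a \<bullet> \<beta>))" by (intro mult_mono) auto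
    then show False using pairing_product[OF root ne] by simp
  qed
  have step: False if d: "\<delta> \<in> \<Phi>" "coroot \<delta> = coroot \<beta> + coroot a" "\<delta> - \<beta> \<in> RC" for \<delta>
  proof -
    have "\<delta> \<in> P" using pos_if_sum[OF d(1) \<beta> d(3)] .
    moreover have "\<gamma> - coroot \<delta> \<in> QC" using assms(3) by (simp add: d(2) diff_diff_add)
    ultimately have "\<delta> = \<beta>" using max d(3) by blast
    then have "coroot a = 0" using d(2) by simp
    then show False using coroot_self[OF root_nonzero[OF root(2)]] by simp
  qed
  from one show False
  proof
    assume "coroot \<beta> \<bullet> a = - 1"
    then have sum: "coroot (s a \<beta>) = coroot \<beta> + coroot a" by (simp add: coroot_reflection)
    have "s a \<beta> - \<beta> = (- (coroot a \<bullet> \<beta>)) *\<^sub>R a" by (simp add: reflection_def)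
    also have "\<dots> \<in> RC"
      using c ints simple_pos[OF assms(2)] by (intro Ints_nonneg_scale_nat_cone) (auto simp: pos_roots_def)
    finally show False using step[OF reflection_root[OF root(2,1)] sum] by blast
  next
    assume m: "coroot a \<bullet> \<beta> = - 1"
    have "s \<beta> a - \<beta> = a + (- (coroot \<beta> \<bullet> a) - 1) *\<^sub>R \<beta>"
      by (simp add: reflection_def algebra_simps)
    also have "\<dots> \<in> RC"
      using k ints Ints_pos_ge_1[of "- (coroot \<beta> \<bullet> a)"] simple_pos[OF assms(2)] \<beta>
      by (intro nat_cone_add Ints_nonneg_scale_nat_cone) (auto simp: pos_roots_def)
    finally show False
      using step[OF reflection_root[OF root]] m by (simp add: coroot_reflection add.commute)
  qed
qed

lemma maximal_root_pairing':
  assumes "max_below \<gamma> \<beta>" "a \<in> \<Delta>" "\<gamma> \<bullet> a \<ge> 0"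
  shows "coroot \<beta> \<bullet> a \<ge> 0"
proof (cases "(\<gamma> - coroot \<beta>) \<bullet> a > 0")
  case True
  have "\<gamma> - coroot \<beta> \<in> QC" using assms by (simp add: maximal_root_below_def coroot_le_def)
  then show ?thesis using maximal_root_pairing[OF assms(1,2)] QC_subtract True assms(2) by blast
next
  case False
  then show ?thesis using assms(3) by (simp add: inner_diff_left)
qed

text \<open>Conjugation by \<open>s a\<close> maps the inverted roots of s a \<beta> to those of \<beta>. It preserves their
  positivity because \<open>a\<close>, having pairing \<open>- 1\<close> with the coroot of s a \<beta>, is not one of them.\<close>

lemma quantum_root_lower:
  assumes "quantum_root \<beta>" "a \<in> \<Delta>" "\<beta> \<noteq> a" "coroot \<beta> \<bullet> a = 1" shows "quantum_root (s a \<beta>)"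
  unfolding quantum_root_def
proof (intro conjI ballI impI)
  let ?b = "s a \<beta>"
  have \<beta>: "\<beta> \<in> P" using assms(1) by (simp add: quantum_root_def)
  show b: "?b \<in> P" using simple_reflection_pos \<beta> assms by blast
  have swap: "coroot ?b \<bullet> v = coroot \<beta> \<bullet> s a v" for v
    by (metis weyl_pairing[OF simple_weyl[OF assms(2)]] reflection_invol)
  have conj: "s \<beta> (s a v) = s a (s ?b v)" for v
    using reflection_conj[OF linear_reflection reflection_isometry, of a ?b v] by simp
  have "coroot ?b \<bullet> a = - 1"
    using assms by (simp add: swap reflection_self root_nonzero simple_root)
  then have aI: "a \<notin> inverted ?b" using inverted_pairing[OF b] by force
  fix \<epsilon> assume \<epsilon>: "\<epsilon> \<in> inverted ?b" "\<epsilon> \<noteq> ?b"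
  then have eP: "\<epsilon> \<in> P" by (simp add: inverted_def)
  have ne: "\<epsilon> \<noteq> a" "- s ?b \<epsilon> \<noteq> a"
    using \<epsilon>(1) aI inverted_opposite[OF b \<epsilon>(1)] by metis+
  have "- s ?b \<epsilon> \<in> P" using inverted_opposite[OF b \<epsilon>(1)] by (simp add: inverted_def)
  then have "s a (- s ?b \<epsilon>) \<in> P" using simple_reflection_pos assms(2) ne by blast
  then have "- s \<beta> (s a \<epsilon>) \<in> P" by (simp add: conj linear_neg[OF linear_reflection])
  then have "s \<beta> (s a \<epsilon>) \<notin> P" using pos_not_neg by force
  then have "s a \<epsilon> \<in> inverted \<beta>" using simple_reflection_pos[OF eP assms(2) ne(1)] by (simp add: inverted_def)
  moreover have "s a \<epsilon> \<noteq> \<beta>" using \<epsilon>(2) by auto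
  ultimately show "coroot ?b \<bullet> \<epsilon> = 1" using assms(1) by (simp add: quantum_root_def swap)
qed

section \<open>Products of reflections of bounded weight\<close>

definition dem_list :: "'a list \<Rightarrow> 'a \<Rightarrow> 'a" where
  "dem_list bs = foldr (\<lambda>\<beta> w. s \<beta> \<star> w) bs id"

lemma dem_list_simps [simp]: "dem_list [] = id" "dem_list (\<beta> # bs) = s \<beta> \<star> dem_list bs"
  by (simp_all add: dem_list_def)

lemma dem_list_weyl: "set bs \<subseteq> P \<Longrightarrow> dem_list bs \<in> W"
  by (induction bs) (auto intro: weyl_id dem_weyl pos_weyl)

lemma dem_list_append: "set bs \<subseteq> P \<Longrightarrow> set cs \<subseteq> P \<Longrightarrow> dem_list (bs @ cs) = dem_list bs \<star> dem_list cs"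
proof (induction bs)
  case Nil
  have "dem_list ([] @ cs) = dem_list [] \<star> dem_list cs" using Nil dem_list_weyl by simp
  then show ?case .
next
  case (Cons \<beta> bs)
  have "dem_list ((\<beta> # bs) @ cs) = dem_list (\<beta> # bs) \<star> dem_list cs"
    using Cons dem_assoc[of "s \<beta>" "dem_list bs" "dem_list cs"] dem_list_weyl pos_weyl by simp
  then show ?case .
qed

text \<open>All positive roots are admitted, not only those occurring in quantum edges. This makes the
  family closed under lowering and conjugating roots.\<close>

definition bounded :: "'a \<Rightarrow> ('a \<Rightarrow> 'a) \<Rightarrow> bool" where
  "bounded \<gamma> x \<longleftrightarrow> (\<exists>bs. set bs \<subseteq> P \<and> \<gamma> - sum_list (map coroot bs) \<in> QC \<and> x \<preceq> dem_list bs)"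

lemma bounded_weyl: "bounded \<gamma> x \<Longrightarrow> x \<in> W"
  unfolding bounded_def using dem_list_weyl bruhat_weyl_lower by blast

lemma bounded_lower: "bounded \<gamma> y \<Longrightarrow> x \<preceq> y \<Longrightarrow> bounded \<gamma> x"
  unfolding bounded_def using bruhat_trans by blast

lemma bounded_mono:
  assumes "bounded \<gamma> x" "\<gamma>' - \<gamma> \<in> QC" shows "bounded \<gamma>' x"
proof -
  obtain bs where bs: "set bs \<subseteq> P" "\<gamma> - sum_list (map coroot bs) \<in> QC" "x \<preceq> dem_list bs"
    using assms(1) by (auto simp: bounded_def)
  have "\<gamma>' - sum_list (map coroot bs) = (\<gamma>' - \<gamma>) + (\<gamma> - sum_list (map coroot bs))" by simp
  then show ?thesis unfolding bounded_def using bs assms(2) nat_cone_add by metis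
qed

lemma bounded_mult:
  assumes "bounded \<gamma> x" "bounded \<delta> y" shows "bounded (\<gamma> + \<delta>) (x \<star> y)"
proof -
  obtain bs cs where bs: "set bs \<subseteq> P" "\<gamma> - sum_list (map coroot bs) \<in> QC" "x \<preceq> dem_list bs"
    and cs: "set cs \<subseteq> P" "\<delta> - sum_list (map coroot cs) \<in> QC" "y \<preceq> dem_list cs"
    using assms by (auto simp: bounded_def)
  have "\<gamma> + \<delta> - sum_list (map coroot (bs @ cs)) =
      (\<gamma> - sum_list (map coroot bs)) + (\<delta> - sum_list (map coroot cs))" by simp
  then have "\<gamma> + \<delta> - sum_list (map coroot (bs @ cs)) \<in> QC" using bs cs nat_cone_add by metis
  moreover have "x \<star> y \<preceq> dem_list (bs @ cs)"
    using dem_mono[OF bs(3) cs(3)] dem_list_weyl bs(1) cs(1) dem_list_append by simp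
  moreover have "set (bs @ cs) \<subseteq> P" using bs cs by simp
  ultimately show ?thesis unfolding bounded_def by blast
qed

lemma bounded_id: "\<gamma> \<in> QC \<Longrightarrow> bounded \<gamma> id"
  unfolding bounded_def by (intro exI[of _ "[]"]) simp

lemma bounded_reflection: "\<beta> \<in> P \<Longrightarrow> bounded (coroot \<beta>) (s \<beta>)"
  unfolding bounded_def by (intro exI[of _ "[\<beta>]"]) (simp add: pos_weyl)

lemma bounded_cases:
  assumes "bounded \<gamma> x"
  obtains "x = id" | \<beta> x' where "\<beta> \<in> P" "\<gamma> - coroot \<beta> \<in> QC" "bounded (\<gamma> - coroot \<beta>) x'" "x \<preceq> s \<beta> \<star> x'"
proof -
  obtain bs where bs: "set bs \<subseteq> P" "\<gamma> - sum_list (map coroot bs) \<in> QC" "x \<preceq> dem_list bs"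
    using assms(1) by (auto simp: bounded_def)
  show ?thesis
  proof (cases bs)
    case Nil
    then show ?thesis using that(1) bs(3) le_id by simp
  next
    case (Cons \<beta> cs)
    have "sum_list (map coroot cs) \<in> QC"
      using bs(1) Cons coroot_pos_QC by (intro nat_cone_sum_list) auto
    moreover have q: "\<gamma> - coroot \<beta> - sum_list (map coroot cs) \<in> QC"
      using bs(2) Cons by (simp add: diff_diff_add)
    ultimately have "\<gamma> - coroot \<beta> \<in> QC" using nat_cone_add by fastforce
    moreover have "bounded (\<gamma> - coroot \<beta>) (dem_list cs)"
      unfolding bounded_def using q bs(1) Cons by (intro exI[of _ cs]) auto
    ultimately show ?thesis using that(2)[of \<beta> "dem_list cs"] bs Cons by simp
  qed
qed

definition is_top :: "'a \<Rightarrow> ('a \<Rightarrow> 'a) \<Rightarrow> bool" where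
  "is_top \<gamma> z \<longleftrightarrow> bounded \<gamma> z \<and> (\<forall>x. bounded \<gamma> x \<longrightarrow> x \<preceq> z)"

definition top_elt :: "'a \<Rightarrow> 'a \<Rightarrow> 'a" where "top_elt \<gamma> = (THE z. is_top \<gamma> z)"

lemma top_elt_eq:
  assumes "is_top \<gamma> z" shows "top_elt \<gamma> = z"
  unfolding top_elt_def
proof (rule the_equality)
  show "y = z" if "is_top \<gamma> y" for y
    using that assms bruhat_antisym bounded_weyl unfolding is_top_def by metis
qed (rule assms)

lemma is_top_0: "is_top 0 id"
  unfolding is_top_def
proof (intro conjI allI impI)
  fix x assume "bounded 0 x"
  then show "x \<preceq> id"
  proof (cases rule: bounded_cases)
    case (2 \<beta> x')
    have "coroot \<beta> \<in> QC" "- coroot \<beta> \<in> QC" using 2 coroot_pos_QC by auto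
    then have "coroot \<beta> \<bullet> rho2 = 0" using QC_two_rho(1)[of "coroot \<beta>"] QC_two_rho(1)[of "- coroot \<beta>"] by simp
    then have "coroot \<beta> = 0" using QC_two_rho(2) \<open>coroot \<beta> \<in> QC\<close> by blast
    then show ?thesis using coroot_nonzero[OF 2(1)] by simp
  qed simp
qed (simp add: bounded_id)

lemma top_elt_0: "top_elt 0 = id" using top_elt_eq is_top_0 .

text \<open>The statement proved by induction on \<gamma>. Besides the existence of a largest element, it records
  the recursion along simple roots, the recursion along maximal roots, that simple reflections with
  nonnegative pairing commute with the largest element, that only simple roots below \<gamma> are needed to
  write it, and its value at coroots of quantum roots. These facts depend on each other for smaller
  weights.\<close>

definition good :: "'a \<Rightarrow> bool" where
  "good \<gamma> \<longleftrightarrow> is_top \<gamma> (top_elt \<gamma>)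
   \<and> (\<forall>a\<in>\<Delta>. \<gamma> \<bullet> a > 0 \<longrightarrow> top_elt \<gamma> = s a \<star> top_elt (\<gamma> - coroot a) \<star> s a)
   \<and> (\<forall>\<beta>. max_below \<gamma> \<beta> \<longrightarrow>
        top_elt \<gamma> = s \<beta> \<star> top_elt (\<gamma> - coroot \<beta>) \<and> top_elt \<gamma> = top_elt (\<gamma> - coroot \<beta>) \<star> s \<beta>)
   \<and> (\<forall>a\<in>\<Delta>. \<gamma> \<bullet> a \<ge> 0 \<longrightarrow> s a \<star> top_elt \<gamma> = top_elt \<gamma> \<star> s a)
   \<and> (\<exists>as. set as \<subseteq> \<Delta> \<and> (\<forall>a\<in>set as. \<gamma> - coroot a \<in> QC) \<and> top_elt \<gamma> = dem_list as)
   \<and> (\<forall>\<beta>. quantum_root \<beta> \<and> \<gamma> = coroot \<beta> \<longrightarrow> top_elt \<gamma> = s \<beta>)"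

lemma good_top: "good \<gamma> \<Longrightarrow> bounded \<gamma> x \<Longrightarrow> x \<preceq> top_elt \<gamma>" by (simp add: good_def is_top_def)
lemma good_bounded: "good \<gamma> \<Longrightarrow> bounded \<gamma> (top_elt \<gamma>)" by (simp add: good_def is_top_def)
lemma good_weyl: "good \<gamma> \<Longrightarrow> top_elt \<gamma> \<in> W" using good_bounded bounded_weyl by blast
lemma good_simple: "good \<gamma> \<Longrightarrow> a \<in> \<Delta> \<Longrightarrow> \<gamma> \<bullet> a > 0 \<Longrightarrow>
    top_elt \<gamma> = s a \<star> top_elt (\<gamma> - coroot a) \<star> s a"
  by (simp add: good_def)
lemma good_maximal: "good \<gamma> \<Longrightarrow> max_below \<gamma> \<beta> \<Longrightarrow>
    top_elt \<gamma> = s \<beta> \<star> top_elt (\<gamma> - coroot \<beta>)"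
  "good \<gamma> \<Longrightarrow> max_below \<gamma> \<beta> \<Longrightarrow> top_elt \<gamma> = top_elt (\<gamma> - coroot \<beta>) \<star> s \<beta>"
  unfolding good_def by blast+
lemma good_commute: "good \<gamma> \<Longrightarrow> a \<in> \<Delta> \<Longrightarrow> \<gamma> \<bullet> a \<ge> 0 \<Longrightarrow> s a \<star> top_elt \<gamma> = top_elt \<gamma> \<star> s a"
  by (simp add: good_def)
lemma good_word: "good \<gamma> \<Longrightarrow> \<exists>as. set as \<subseteq> \<Delta> \<and> (\<forall>a\<in>set as. \<gamma> - coroot a \<in> QC) \<and> top_elt \<gamma> = dem_list as"
  unfolding good_def by blast
lemma good_quantum_root: "good (coroot \<beta>) \<Longrightarrow> quantum_root \<beta> \<Longrightarrow> top_elt (coroot \<beta>) = s \<beta>"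
  by (simp add: good_def)

context
  fixes \<gamma> :: 'a
  assumes \<gamma>: "\<gamma> \<in> QC"
    and IH: "\<And>\<delta>. \<delta> \<in> QC \<Longrightarrow> coroot_height \<delta> < coroot_height \<gamma> \<Longrightarrow> good \<delta>"
begin

lemma good_below: "\<beta> \<in> P \<Longrightarrow> \<gamma> - coroot \<beta> \<in> QC \<Longrightarrow> good (\<gamma> - coroot \<beta>)"
  using IH coroot_height_less by blast

lemma good_below2:
  assumes "\<beta> \<in> P" "\<gamma> - coroot \<beta> \<in> QC" "\<delta> \<in> P" "\<gamma> - coroot \<beta> - coroot \<delta> \<in> QC"
  shows "good (\<gamma> - coroot \<beta> - coroot \<delta>)"
  using IH[OF assms(4)] coroot_height_less[OF assms(2,1)] coroot_height_less[OF assms(4,3)] by simp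

text \<open>The first reflection of a bounded product is split off, the rest being bounded by the largest
  element of the remaining weight \<gamma> - coroot \<beta>. According to the pairing \<open>k\<close> of coroot \<beta> with \<open>a\<close>,
  copies of \<open>s a\<close> are extracted from s \<beta> or from the largest element, and moved to the outside.\<close>

lemma top_upper:
  assumes a: "a \<in> \<Delta>" "\<gamma> \<bullet> a > 0" and x: "bounded \<gamma> x"
  shows "x \<preceq> s a \<star> top_elt (\<gamma> - coroot a) \<star> s a"
proof -
  let ?s = "s a" and ?g1 = "\<gamma> - coroot a"
  let ?T = "?s \<star> top_elt ?g1 \<star> ?s"
  have aP: "a \<in> P" and s: "?s \<in> W" using a simple_pos simple_weyl by auto
  have g1: "?g1 \<in> QC" "good ?g1" using QC_subtract[OF \<gamma> a] good_below[OF aP] by auto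
  note W = dem_weyl s good_weyl[OF g1(2)]
  have T: "?T \<in> W" using W by simp
  \<comment> \<open>Three ways to see that an element is below the claimed bound.\<close>
  have both: "y \<preceq> ?T" if "bounded ?g1 u" "y \<preceq> ?s \<star> u \<star> ?s" for u y
  proof -
    have "u \<preceq> top_elt ?g1" using good_top g1 that by blast
    then have "?s \<star> u \<star> ?s \<preceq> ?T" using W by (intro dem_mono) auto
    then show ?thesis using that bruhat_trans by blast
  qed
  have left: "y \<preceq> ?T" if "bounded ?g1 u" "y \<preceq> ?s \<star> u" for u y
  proof -
    have "?s \<star> u \<in> W" using that bounded_weyl W by blast
    then have "?s \<star> u \<preceq> ?s \<star> u \<star> ?s" using le_dem_left s by blast
    then show ?thesis using both[OF that(1)] that(2) bruhat_trans by blast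
  qed
  have right: "y \<preceq> ?T" if "bounded ?g1 u" "y \<preceq> u \<star> ?s" for u y
  proof -
    have u: "u \<in> W" using that bounded_weyl by blast
    then have "u \<star> ?s \<preceq> ?s \<star> (u \<star> ?s)" using le_dem_right W by blast
    then have "u \<star> ?s \<preceq> ?s \<star> u \<star> ?s" using u s by (simp add: dem_assoc)
    then show ?thesis using both[OF that(1)] that(2) bruhat_trans by blast
  qed
  from x show ?thesis
  proof (cases rule: bounded_cases)
    case 1
    then show ?thesis using id_le T by simp
  next
    case (2 \<beta> x')
    let ?g = "\<gamma> - coroot \<beta>" and ?r = "s \<beta>"
    define k where "k = coroot \<beta> \<bullet> a"
    have g: "good ?g" using good_below 2 by blast
    have r: "?r \<in> W" and zg: "top_elt ?g \<in> W" using pos_weyl 2 good_weyl g by auto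
    have "x' \<preceq> top_elt ?g" using good_top g 2 by blast
    then have "?r \<star> x' \<preceq> ?r \<star> top_elt ?g" using r zg by (intro dem_mono) auto
    then have xz: "x \<preceq> ?r \<star> top_elt ?g" using 2 bruhat_trans by blast
    have ga: "?g \<bullet> a = \<gamma> \<bullet> a - k" by (simp add: inner_diff_left k_def)
    have ints: "k \<in> \<int>" "\<gamma> \<bullet> a \<in> \<int>"
      using pairing_int[OF 2(1) aP] QC_pairing_int[OF \<gamma> a(1)] by (auto simp: k_def)
    then have n1: "\<gamma> \<bullet> a \<ge> 1" using a Ints_pos_ge_1 by blast
    have sub: "?g - coroot a \<in> QC \<and> good (?g - coroot a) \<and> top_elt (?g - coroot a) \<in> W \<and>
        top_elt ?g = ?s \<star> top_elt (?g - coroot a) \<star> ?s" if "?g \<bullet> a > 0"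
      using that QC_subtract[OF 2(2) a(1)] good_below2[OF 2(1,2) aP] good_weyl good_simple[OF g a(1)] by blast
    have inner: "bounded ?g1 (?r \<star> top_elt (?g - coroot a))" if "?g \<bullet> a > 0"
    proof -
      have "bounded (coroot \<beta> + (?g - coroot a)) (?r \<star> top_elt (?g - coroot a))"
        using sub[OF that] by (intro bounded_mult bounded_reflection good_bounded 2) blast
      then show ?thesis by simp
    qed
    consider "\<beta> = a" | "\<beta> \<noteq> a" "k \<ge> 2" | "\<beta> \<noteq> a" "k = 1" | "k = 0" | "k < 0"
      using ints(1) Ints_pos_cases by (metis linorder_neqE_linordered_idom)
    then show ?thesis
    proof cases
      case 1
      then show ?thesis using left[OF good_bounded[OF g1(2)]] xz by simp
    next
      \<comment> \<open>The simple reflection to the right of \<open>s ?b\<close> is paid for by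
        the drop of at least 2 in the coroot.\<close>
      case two: 2
      let ?b = "s a \<beta>"
      have b: "?b \<in> P" using simple_reflection_pos 2(1) a(1) two by blast
      have cb: "coroot ?b = coroot \<beta> - k *\<^sub>R coroot a" by (simp add: coroot_reflection k_def)
      have "coroot ?b \<bullet> a < 0"
        using two(2) by (simp add: cb inner_diff_left k_def root_nonzero simple_root a)
      then have rb: "?r = ?s \<star> s ?b \<star> ?s" using dem_conj[OF b a(1)] by simp
      have "bounded (coroot ?b + (coroot a + ?g)) (s ?b \<star> (?s \<star> top_elt ?g))"
        by (intro bounded_mult bounded_reflection b aP good_bounded g)
      moreover have "?g1 - (coroot ?b + (coroot a + ?g)) = (k - 2) *\<^sub>R coroot a"
        by (simp add: cb algebra_simps scaleR_2)
      then have "?g1 - (coroot ?b + (coroot a + ?g)) \<in> QC"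
        using ints two simple_coroot_QC[OF a(1)] by (auto intro: Ints_nonneg_scale_nat_cone)
      ultimately have "bounded ?g1 (s ?b \<star> (?s \<star> top_elt ?g))" by (rule bounded_mono)
      moreover have "?r \<star> top_elt ?g = ?s \<star> (s ?b \<star> (?s \<star> top_elt ?g))"
        using s pos_weyl[OF b] zg by (simp add: rb dem_assoc dem_weyl)
      ultimately show ?thesis using left xz by simp
    next
      case 3
      let ?b = "s a \<beta>"
      have b: "?b \<in> P" using simple_reflection_pos 2(1) a(1) 3 by blast
      have cb: "coroot ?b = coroot \<beta> - coroot a" using 3 by (simp add: coroot_reflection k_def)
      have "coroot ?b \<bullet> a < 0"
        using 3(2) by (simp add: cb inner_diff_left k_def root_nonzero simple_root a)
      then have rb: "?r = ?s \<star> s ?b \<star> ?s" using dem_conj[OF b a(1)] by simp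
      \<comment> \<open>The inner \<open>s a\<close> commutes with the remaining largest element
        and moves to the right end.\<close>
      have "?g \<bullet> a \<ge> 0" using ga n1 3 by simp
      then have comm: "?s \<star> top_elt ?g = top_elt ?g \<star> ?s" using good_commute[OF g a(1)] by blast
      have "bounded (coroot ?b + ?g) (s ?b \<star> top_elt ?g)" by (intro bounded_mult bounded_reflection b good_bounded g)
      then have "bounded ?g1 (s ?b \<star> top_elt ?g)" by (simp add: cb)
      moreover have "?r \<star> top_elt ?g = ?s \<star> (s ?b \<star> top_elt ?g) \<star> ?s"
        using s pos_weyl[OF b] zg by (simp add: rb dem_assoc dem_weyl comm)
      ultimately show ?thesis using both xz by simp
    next
      case 4
      have p: "?g \<bullet> a > 0" using ga a 4 by simp
      have "?r \<star> ?s = ?s \<star> ?r" using dem_commute[OF 2(1) a(1)] 4 by (simp add: k_def)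
      then have "?r \<star> (?s \<star> v) = ?s \<star> (?r \<star> v)" if "v \<in> W" for v
        using r s that by (metis dem_assoc)
      then have "?r \<star> top_elt ?g = ?s \<star> (?r \<star> top_elt (?g - coroot a)) \<star> ?s"
        using sub[OF p] r s by (simp add: dem_assoc dem_weyl)
      then show ?thesis using both[OF inner[OF p]] xz by simp
    next
      case 5
      \<comment> \<open>The remaining weight has pairing at least 2, so its largest element ends
        in \<open>s a\<close>.\<close>
      have "k \<le> - 1" using 5 ints(1) by (auto simp: Ints_def)
      then have p: "?g \<bullet> a \<ge> 2" using ga n1 by simp
      then have p0: "?g \<bullet> a > 0" by simp
      note d = sub[OF p0]
      have "(?g - coroot a) \<bullet> a \<ge> 0" using p a by (simp add: inner_diff_left root_nonzero simple_root)
      then have "?s \<star> top_elt (?g - coroot a) = top_elt (?g - coroot a) \<star> ?s" using good_commute a(1) d by blast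
      then have "top_elt ?g = top_elt (?g - coroot a) \<star> ?s"
        using d s a(1) by (simp add: dem_assoc dem_simple_idem)
      then have "?r \<star> top_elt ?g = (?r \<star> top_elt (?g - coroot a)) \<star> ?s" using d r s by (simp add: dem_assoc)
      then show ?thesis using right[OF inner[OF p0]] xz by simp
    qed
  qed
qed

text \<open>If \<gamma> \<bullet> a \<ge> 2, one of the outer factors \<open>s a\<close> is absorbed, and the other one is paid for by
  \<open>coroot a\<close>. If \<gamma> \<bullet> a = 1, the recursion along a maximal root \<beta> below \<gamma> - coroot a is used,
  and both factors \<open>s a\<close> are moved towards s \<beta> or past it, depending on the pairing \<open>k\<close>.\<close>

lemma top_member:
  assumes a: "a \<in> \<Delta>" "\<gamma> \<bullet> a > 0"
  shows "bounded \<gamma> (s a \<star> top_elt (\<gamma> - coroot a) \<star> s a)"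
proof -
  let ?s = "s a" and ?g1 = "\<gamma> - coroot a"
  let ?T = "?s \<star> top_elt ?g1 \<star> ?s"
  have aP: "a \<in> P" and s: "?s \<in> W" using a simple_pos simple_weyl by auto
  have aa: "coroot a \<bullet> a = 2" using a root_nonzero simple_root by simp
  have g1: "?g1 \<in> QC" "good ?g1" using QC_subtract[OF \<gamma> a] good_below[OF aP] by auto
  have z1: "top_elt ?g1 \<in> W" using good_weyl g1 by blast
  have ga1: "?g1 \<bullet> a = \<gamma> \<bullet> a - 2" by (simp add: inner_diff_left aa)
  have "\<gamma> \<bullet> a = 1 \<or> \<gamma> \<bullet> a \<ge> 2" using QC_pairing_int[OF \<gamma> a(1)] a(2) by (auto simp: Ints_def)
  then show ?thesis
  proof
    assume "\<gamma> \<bullet> a \<ge> 2"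
    then have "?s \<star> top_elt ?g1 = top_elt ?g1 \<star> ?s" using good_commute[OF g1(2) a(1)] ga1 by simp
    then have "?T = top_elt ?g1 \<star> ?s" using s z1 a(1) by (simp add: dem_assoc dem_simple_idem)
    moreover have "bounded (?g1 + coroot a) (top_elt ?g1 \<star> ?s)" by (intro bounded_mult bounded_reflection aP good_bounded g1)
    ultimately show ?thesis by simp
  next
    assume n1: "\<gamma> \<bullet> a = 1"
    then have "?g1 \<noteq> 0" using ga1 by (metis inner_zero_left diff_gt_0_iff_gt less_irrefl one_less_numeral_iff semiring_norm(76) eq_iff_diff_eq_0)
    then obtain \<beta> where \<beta>: "max_below ?g1 \<beta>" using maximal_root_exists g1 by blast
    then have bP: "\<beta> \<in> P" and gQ: "?g1 - coroot \<beta> \<in> QC" by (auto simp: maximal_root_below_def coroot_le_def)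
    let ?g = "?g1 - coroot \<beta>" and ?r = "s \<beta>"
    define k where "k = coroot \<beta> \<bullet> a"
    have g: "good ?g" using good_below2[OF aP g1(1) bP gQ] .
    have zg: "top_elt ?g \<in> W" and r: "?r \<in> W" using good_weyl g pos_weyl bP by auto
    have z: "top_elt ?g1 = ?r \<star> top_elt ?g" "top_elt ?g1 = top_elt ?g \<star> ?r" using good_maximal[OF g1(2) \<beta>] by auto
    have ga: "?g \<bullet> a = - 1 - k" using ga1 n1 by (simp add: inner_diff_left k_def)
    have "k \<in> \<int>" using pairing_int[OF bP aP] by (simp add: k_def)
    then consider "k > 0" | "k = 0" | "k = - 1" | "k \<le> - 2"
      using Ints_neg_cases by (metis linorder_neqE_linordered_idom)
    then show ?thesis
    proof cases
      case 1
      then have "?s \<star> ?r = ?r" using dem_absorb[OF bP a(1)] by (simp add: k_def)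
      then have "?s \<star> top_elt ?g1 = top_elt ?g1" using z(1) s r zg by (metis dem_assoc)
      moreover have "bounded (?g1 + coroot a) (top_elt ?g1 \<star> ?s)" by (intro bounded_mult bounded_reflection aP good_bounded g1)
      ultimately show ?thesis by simp
    next
      case 2
      have e: "?g + coroot a = \<gamma> - coroot \<beta>" by simp
      have q: "\<gamma> - coroot \<beta> \<in> QC" using nat_cone_add[OF gQ simple_coroot_QC[OF a(1)]] by simp
      have gd: "good (\<gamma> - coroot \<beta>)" using good_below[OF bP q] .
      have "(\<gamma> - coroot \<beta>) \<bullet> a > 0" using n1 2 by (simp add: inner_diff_left k_def)
      then have "top_elt (\<gamma> - coroot \<beta>) = ?s \<star> top_elt (\<gamma> - coroot \<beta> - coroot a) \<star> ?s"
        using good_simple[OF gd a(1)] by blast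
      moreover have "\<gamma> - coroot \<beta> - coroot a = ?g" by simp
      ultimately have zz: "top_elt (\<gamma> - coroot \<beta>) = ?s \<star> top_elt ?g \<star> ?s" by simp
      have "?r \<star> ?s = ?s \<star> ?r" using dem_commute[OF bP a(1)] 2 by (simp add: k_def)
      then have "?s \<star> (?r \<star> v) = ?r \<star> (?s \<star> v)" if "v \<in> W" for v
        using r s that by (metis dem_assoc)
      then have "?T = ?r \<star> top_elt (\<gamma> - coroot \<beta>)"
        using r s zg by (simp add: zz z(1) dem_assoc dem_weyl)
      moreover have "bounded (coroot \<beta> + (\<gamma> - coroot \<beta>)) (?r \<star> top_elt (\<gamma> - coroot \<beta>))"
        by (intro bounded_mult bounded_reflection bP good_bounded gd)
      ultimately show ?thesis by simp
    next
      case 3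
      let ?b = "s a \<beta>"
      have "\<beta> \<noteq> a" using 3 aa by (auto simp: k_def)
      then have b: "?b \<in> P" using simple_reflection_pos bP a(1) by blast
      have cb: "coroot ?b = coroot \<beta> + coroot a" using 3 by (simp add: coroot_reflection k_def)
      have rb: "s ?b = ?s \<star> ?r \<star> ?s" using dem_conj[OF bP a(1)] 3 by (simp add: k_def)
      have "?s \<star> top_elt ?g = top_elt ?g \<star> ?s" using good_commute[OF g a(1)] ga 3 by simp
      then have "?T = s ?b \<star> top_elt ?g" using r s zg by (simp add: z(1) rb dem_assoc dem_weyl)
      moreover have "bounded (coroot ?b + ?g) (s ?b \<star> top_elt ?g)" by (intro bounded_mult bounded_reflection b good_bounded g)
      ultimately show ?thesis by (simp add: cb)
    next
      case 4
      then have p: "?g \<bullet> a > 0" using ga by simp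
      have "good (?g - coroot a)"
        using QC_subtract[OF gQ a(1) p] coroot_height_less[OF g1(1) aP] coroot_height_less[OF gQ bP]
          coroot_height_less[OF QC_subtract[OF gQ a(1) p] aP] IH by simp
      then have "top_elt (?g - coroot a) \<in> W" by (rule good_weyl)
      then have "top_elt ?g \<star> ?s = top_elt ?g"
        using good_simple[OF g a(1) p] s a(1) by (simp add: dem_assoc dem_weyl dem_simple_idem)
      then have "?T = ?s \<star> (?r \<star> top_elt ?g)" using r s zg by (simp add: z(1) dem_assoc dem_weyl)
      moreover have "bounded (coroot a + (coroot \<beta> + ?g)) (?s \<star> (?r \<star> top_elt ?g))"
        by (intro bounded_mult bounded_reflection aP bP good_bounded g)
      ultimately show ?thesis by simp
    qed
  qed
qed

lemma step_simple:
  assumes "a \<in> \<Delta>" "\<gamma> \<bullet> a > 0"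
  shows "top_elt \<gamma> = s a \<star> top_elt (\<gamma> - coroot a) \<star> s a"
  using top_elt_eq top_upper[OF assms] top_member[OF assms] unfolding is_top_def by blast

lemma step_top: "is_top \<gamma> (top_elt \<gamma>)"
proof (cases "\<gamma> = 0")
  case True
  then show ?thesis using is_top_0 top_elt_0 by simp
next
  case False
  then obtain a where a: "a \<in> \<Delta>" "\<gamma> \<bullet> a > 0" using QC_positive_pairing \<gamma> by blast
  show ?thesis unfolding step_simple[OF a] is_top_def using top_upper[OF a] top_member[OF a] by blast
qed

lemma step_word: "\<exists>as. set as \<subseteq> \<Delta> \<and> (\<forall>a\<in>set as. \<gamma> - coroot a \<in> QC) \<and> top_elt \<gamma> = dem_list as"
proof (cases "\<gamma> = 0")
  case True
  then show ?thesis using top_elt_0 by (intro exI[of _ "[]"]) simp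
next
  case False
  then obtain a where a: "a \<in> \<Delta>" "\<gamma> \<bullet> a > 0" using QC_positive_pairing \<gamma> by blast
  have g1: "\<gamma> - coroot a \<in> QC" using QC_subtract[OF \<gamma> a] .
  then obtain as where as: "set as \<subseteq> \<Delta>" "\<And>b. b \<in> set as \<Longrightarrow> \<gamma> - coroot a - coroot b \<in> QC"
    "top_elt (\<gamma> - coroot a) = dem_list as"
    using good_word[OF good_below[OF simple_pos[OF a(1)]]] by blast
  have "\<gamma> - coroot b \<in> QC" if "b \<in> set as" for b
  proof -
    have "\<gamma> - coroot b = (\<gamma> - coroot a - coroot b) + coroot a" by simp
    then show ?thesis using as(2)[OF that] simple_coroot_QC[OF a(1)] nat_cone_add by metis
  qed
  moreover have "top_elt \<gamma> = dem_list ([a] @ as @ [a])"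
    using step_simple[OF a] as a(1) simple_pos dem_list_append[of "a # as" "[a]"] dem_list_append[of as "[a]"]
    by (simp add: subset_iff simple_weyl dem_assoc dem_list_weyl)
  ultimately show ?thesis using as(1) a(1) g1 by (intro exI[of _ "[a] @ as @ [a]"]) auto
qed

text \<open>The recursion along simple roots lowers a quantum root to another quantum root.\<close>

lemma step_quantum_root:
  assumes "quantum_root \<beta>" "\<gamma> = coroot \<beta>" shows "top_elt \<gamma> = s \<beta>"
proof -
  have \<beta>: "\<beta> \<in> P" using assms by (simp add: quantum_root_def)
  obtain a where a: "a \<in> \<Delta>" "coroot \<beta> \<bullet> a > 0" using pos_pairing_simple_exists \<beta> by blast
  have z: "top_elt \<gamma> = s a \<star> top_elt (\<gamma> - coroot a) \<star> s a"
    using step_simple a assms(2) by blast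
  show ?thesis
  proof (cases "\<beta> = a")
    case True
    then show ?thesis using z assms(2) a top_elt_0 by (simp add: dem_simple_idem simple_weyl)
  next
    case False
    have "a \<in> inverted \<beta>" using reflection_simple_neg[OF \<beta> a] simple_pos a by (simp add: inverted_def)
    then have k: "coroot \<beta> \<bullet> a = 1" using assms(1) False by (simp add: quantum_root_def)
    let ?b = "s a \<beta>"
    have sm: "quantum_root ?b" using quantum_root_lower[OF assms(1) a(1) False k] .
    then have b: "?b \<in> P" by (simp add: quantum_root_def)
    have cb: "\<gamma> - coroot a = coroot ?b" using k assms(2) by (simp add: coroot_reflection)
    have "good (coroot ?b)"
      using good_below[OF simple_pos[OF a(1)]] coroot_pos_QC[OF b] by (simp add: cb)
    then have zb: "top_elt (\<gamma> - coroot a) = s ?b" using good_quantum_root[OF _ sm] cb by simp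
    have "coroot ?b \<bullet> a < 0"
      using k by (simp add: coroot_reflection inner_diff_left root_nonzero simple_root a)
    then show ?thesis using z zb dem_conj[OF b a(1)] by simp
  qed
qed

text \<open>The remaining largest element is a product of simple reflections that commute with s \<beta>, by
  maximality of \<beta>. This gives the symmetry of both formulas, and interchanges the recursion along
  \<beta> with the one along a simple root that pairs positively with \<gamma> - coroot \<beta>.\<close>

lemma step_maximal:
  assumes "max_below \<gamma> \<beta>"
  shows "top_elt \<gamma> = s \<beta> \<star> top_elt (\<gamma> - coroot \<beta>)" "top_elt \<gamma> = top_elt (\<gamma> - coroot \<beta>) \<star> s \<beta>"
proof -
  let ?g = "\<gamma> - coroot \<beta>" and ?r = "s \<beta>"
  have \<beta>: "\<beta> \<in> P" "?g \<in> QC" using assms by (auto simp: maximal_root_below_def coroot_le_def)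
  have g: "good ?g" using good_below \<beta> by blast
  have r: "?r \<in> W" and zg: "top_elt ?g \<in> W" using pos_weyl \<beta> good_weyl g by auto
  obtain as where as: "set as \<subseteq> \<Delta>" "\<And>b. b \<in> set as \<Longrightarrow> ?g - coroot b \<in> QC" "top_elt ?g = dem_list as"
    using good_word[OF g] by blast
  have "?r \<star> dem_list bs = dem_list bs \<star> ?r" if "set bs \<subseteq> set as" for bs
    using that
  proof (induction bs)
    case Nil
    have "?r \<star> dem_list [] = dem_list [] \<star> ?r" using r by simp
    then show ?case .
  next
    case (Cons a bs)
    have a: "a \<in> \<Delta>" "?g - coroot a \<in> QC" using Cons as by auto
    have s: "s a \<in> W" using simple_weyl a by blast
    have "set bs \<subseteq> P" using Cons as simple_pos by auto
    then have w: "dem_list bs \<in> W" by (rule dem_list_weyl)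
    have c: "?r \<star> s a = s a \<star> ?r"
      using dem_commute[OF \<beta>(1) a(1) maximal_root_pairing[OF assms a]] .
    have "?r \<star> dem_list (a # bs) = (?r \<star> s a) \<star> dem_list bs" using r s w by (simp add: dem_assoc)
    also have "\<dots> = s a \<star> (?r \<star> dem_list bs)" using r s w by (simp add: c dem_assoc)
    also have "\<dots> = dem_list (a # bs) \<star> ?r" using Cons r s w by (simp add: dem_assoc)
    finally show ?case .
  qed
  then have comm: "?r \<star> top_elt ?g = top_elt ?g \<star> ?r" using as(3) by simp
  show z: "top_elt \<gamma> = ?r \<star> top_elt ?g"
  proof (cases "?g = 0")
    case True
    then show ?thesis using step_quantum_root[OF maximal_root_quantum[OF assms]] top_elt_0 r by simp
  next
    case False
    then obtain a where a: "a \<in> \<Delta>" "?g \<bullet> a > 0" using QC_positive_pairing \<beta> by blast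
    let ?s = "s a"
    have s: "?s \<in> W" and aP: "a \<in> P" using simple_weyl simple_pos a by auto
    have ga: "?g - coroot a \<in> QC" using QC_subtract[OF \<beta>(2) a] .
    have k: "coroot \<beta> \<bullet> a \<ge> 0" using maximal_root_pairing[OF assms a(1) ga] .
    then have p: "\<gamma> \<bullet> a > 0" using a(2) by (simp add: inner_diff_left)
    have sw: "\<gamma> - coroot a - coroot \<delta> = \<gamma> - coroot \<delta> - coroot a" for \<delta> by simp
    have q: "\<gamma> - coroot a \<in> QC" using QC_subtract[OF \<gamma> a(1) p] .
    have "max_below (\<gamma> - coroot a) \<beta>"
      unfolding maximal_root_below_def coroot_le_def
    proof (intro conjI ballI impI)
      fix \<beta>' assume b': "\<beta>' \<in> P" "\<gamma> - coroot a - coroot \<beta>' \<in> QC \<and> root_le \<Delta> \<beta> \<beta>'"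
      have "\<gamma> - coroot \<beta>' = (\<gamma> - coroot a - coroot \<beta>') + coroot a" by simp
      then have "\<gamma> - coroot \<beta>' \<in> QC" using b' simple_coroot_QC[OF a(1)] nat_cone_add by metis
      then show "\<beta>' = \<beta>" using assms b' by (simp add: maximal_root_below_def coroot_le_def)
    next
      show "\<gamma> - coroot a - coroot \<beta> \<in> QC" unfolding sw by (rule ga)
    qed (rule \<beta>)
    then have z1: "top_elt (\<gamma> - coroot a) = ?r \<star> top_elt (?g - coroot a)"
      using good_maximal(1)[OF good_below[OF aP q]] sw by simp
    have w: "top_elt (?g - coroot a) \<in> W" using good_weyl[OF good_below2[OF \<beta> aP ga]] .
    have c: "?r \<star> ?s = ?s \<star> ?r" using dem_commute[OF \<beta>(1) a(1) k] .
    have "top_elt \<gamma> = (?s \<star> ?r) \<star> top_elt (?g - coroot a) \<star> ?s"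
      using step_simple[OF a(1) p] z1 r s w by (simp add: dem_assoc)
    also have "\<dots> = ?r \<star> (?s \<star> top_elt (?g - coroot a) \<star> ?s)"
      unfolding c[symmetric] using r s w by (simp add: dem_assoc dem_weyl)
    also have "\<dots> = ?r \<star> top_elt ?g" using good_simple[OF g a] by simp
    finally show ?thesis .
  qed
  show "top_elt \<gamma> = top_elt ?g \<star> ?r" using z comm by simp
qed

text \<open>If the pairing is positive, then \<open>s a\<close> is absorbed on both sides. If it is zero, then either the
  reflection in a maximal root absorbs \<open>s a\<close> on both sides, or \<open>s a\<close> commutes with this reflection
  and has pairing zero with the remaining weight.\<close>

lemma step_commute:
  assumes a: "a \<in> \<Delta>" "\<gamma> \<bullet> a \<ge> 0"
  shows "s a \<star> top_elt \<gamma> = top_elt \<gamma> \<star> s a"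
proof (cases "\<gamma> \<bullet> a > 0")
  case True
  have s: "s a \<in> W" using simple_weyl a by blast
  have w: "top_elt (\<gamma> - coroot a) \<in> W"
    using good_weyl[OF good_below[OF simple_pos[OF a(1)] QC_subtract[OF \<gamma> a(1) True]]] .
  have i: "s a \<star> (s a \<star> v) = s a \<star> v" if "v \<in> W" for v
    using dem_assoc[OF s s that] dem_simple_idem[OF a(1)] by simp
  show ?thesis
    unfolding step_simple[OF a(1) True] using s w a(1) by (simp add: i dem_assoc dem_weyl dem_simple_idem)
next
  case False
  show ?thesis
  proof (cases "\<gamma> = 0")
    case True
    then show ?thesis using top_elt_0 simple_weyl[OF a(1)] by simp
  next
    case nonzero: False
    then obtain \<beta> where m: "max_below \<gamma> \<beta>" using maximal_root_exists \<gamma> by blast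
    let ?g = "\<gamma> - coroot \<beta>" and ?r = "s \<beta>" and ?s = "s a"
    have \<beta>: "\<beta> \<in> P" "?g \<in> QC" using m by (auto simp: maximal_root_below_def coroot_le_def)
    have g: "good ?g" using good_below \<beta> by blast
    have r: "?r \<in> W" and zg: "top_elt ?g \<in> W" and s: "?s \<in> W"
      using pos_weyl \<beta> good_weyl g simple_weyl a by auto
    note z = step_maximal[OF m]
    have k: "coroot \<beta> \<bullet> a \<ge> 0" using maximal_root_pairing'[OF m a] .
    show ?thesis
    proof (cases "coroot \<beta> \<bullet> a > 0")
      case True
      note ab = dem_absorb[OF \<beta>(1) a(1) True]
      have "?s \<star> top_elt \<gamma> = top_elt \<gamma>" using z(1) ab(2) r s zg by (metis dem_assoc)
      moreover have "top_elt \<gamma> \<star> ?s = top_elt \<gamma>" using z(2) ab(1) r s zg by (metis dem_assoc)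
      ultimately show ?thesis by simp
    next
      case zero: False
      have "?g \<bullet> a \<ge> 0" using a(2) k zero by (simp add: inner_diff_left)
      then have "?s \<star> top_elt ?g = top_elt ?g \<star> ?s" using good_commute[OF g a(1)] by blast
      moreover have "?r \<star> ?s = ?s \<star> ?r" using dem_commute[OF \<beta>(1) a(1) k] .
      ultimately show ?thesis using z(1) r s zg by (metis dem_assoc)
    qed
  qed
qed

lemma step_good: "good \<gamma>"
  unfolding good_def
  using step_top step_simple step_maximal step_commute step_word step_quantum_root by blast

end

lemma QC_good: "\<gamma> \<in> QC \<Longrightarrow> good \<gamma>"
proof (induction "coroot_height \<gamma>" arbitrary: \<gamma> rule: less_induct)
  case less
  show ?case by (rule step_good) (use less in auto)
qed

section \<open>The maximum\<close>

lemma z_value_eq: "z_value \<Phi> \<Delta> \<gamma> w \<Longrightarrow> w = top_elt \<gamma>"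
proof (induction rule: z_value.induct)
  case 1
  have "id = top_elt 0" using top_elt_0 by simp
  then show ?case .
next
  case (2 a)
  then show ?case using good_quantum_root[OF QC_good] quantum_root_simple simple_coroot_QC by metis
next
  case (3 \<gamma> \<beta> w)
  then show ?case using good_maximal(2)[OF QC_good] by metis
qed

lemma z_value_top_elt: "\<gamma> \<in> QC \<Longrightarrow> z_value \<Phi> \<Delta> \<gamma> (top_elt \<gamma>)"
proof (induction "coroot_height \<gamma>" arbitrary: \<gamma> rule: less_induct)
  case less
  show ?case
  proof (cases "\<gamma> = 0 \<or> \<gamma> \<in> coroot ` \<Delta>")
    case True
    then show ?thesis
    proof
      assume "\<gamma> = 0"
      then show ?thesis using z_value.intros(1) top_elt_0 by metis
    next
      assume "\<gamma> \<in> coroot ` \<Delta>"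
      then obtain a where "a \<in> \<Delta>" "\<gamma> = coroot a" by blast
      then show ?thesis
        using z_value.intros(2)[of a \<Delta> \<Phi>] good_quantum_root[OF QC_good] quantum_root_simple simple_coroot_QC by metis
    qed
  next
    case False
    then obtain \<beta> where m: "max_below \<gamma> \<beta>"
      using maximal_root_exists less.prems by blast
    then have \<beta>: "\<beta> \<in> P" "\<gamma> - coroot \<beta> \<in> QC" by (auto simp: maximal_root_below_def coroot_le_def)
    have "z_value \<Phi> \<Delta> (\<gamma> - coroot \<beta>) (top_elt (\<gamma> - coroot \<beta>))"
      using less.hyps[OF coroot_height_less[OF \<beta>(2,1)] \<beta>(2)] .
    then have "z_value \<Phi> \<Delta> \<gamma> (top_elt (\<gamma> - coroot \<beta>) \<star> s \<beta>)"
      using z_value.intros(3)[OF less.prems _ _ m] False by blast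
    then show ?thesis using good_maximal(2)[OF QC_good[OF less.prems] m] by simp
  qed
qed

lemma z_elt_top_elt: "\<gamma> \<in> QC \<Longrightarrow> z_elt \<Phi> \<Delta> \<gamma> = top_elt \<gamma>"
  unfolding z_elt_def using z_value_top_elt z_value_eq by (intro the_equality) blast+

text \<open>Maximal roots are quantum roots, so each factor of the recursion along maximal roots is a quantum
  edge to the identity, which is then translated.\<close>

lemma path_from_top_elt: "\<gamma> \<in> QC \<Longrightarrow> \<exists>n. qpath (top_elt \<gamma>) n \<gamma> id"
proof (induction "coroot_height \<gamma>" arbitrary: \<gamma> rule: less_induct)
  case less
  show ?case
  proof (cases "\<gamma> = 0")
    case True
    then show ?thesis using path_refl[OF weyl_id] top_elt_0 by auto
  next
    case False
    then obtain \<beta> where m: "max_below \<gamma> \<beta>"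
      using maximal_root_exists less.prems by blast
    then have \<beta>: "\<beta> \<in> P" "\<gamma> - coroot \<beta> \<in> QC" by (auto simp: maximal_root_below_def coroot_le_def)
    let ?g = "\<gamma> - coroot \<beta>"
    obtain n where n: "qpath (top_elt ?g) n ?g id" using less.hyps[OF coroot_height_less[OF \<beta>(2,1)] \<beta>(2)] by blast
    obtain k where "qpath (top_elt ?g \<star> s \<beta>) k (coroot \<beta>) (top_elt ?g)"
      using dem_path[OF quantum_root_path[OF maximal_root_quantum[OF m]] good_weyl[OF QC_good[OF \<beta>(2)]]] by blast
    then have "qpath (top_elt ?g \<star> s \<beta>) (k + n) (coroot \<beta> + ?g) id" using n by (rule path_append)
    then show ?thesis using good_maximal(2)[OF QC_good[OF less.prems] m] by auto
  qed
qed

text \<open>A Bruhat edge leads upwards, and a quantum edge from \<open>x\<close> to \<open>y\<close> gives x \<preceq> y \<star> s \<beta>.\<close>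

lemma path_bounded: "qpath x n \<omega> y \<Longrightarrow> bounded \<delta> y \<Longrightarrow> bounded (\<delta> + \<omega>) x"
proof (induction rule: path_induct)
  case (cons x \<omega> y n \<omega>' z)
  then have y: "bounded (\<delta> + \<omega>') y" by blast
  obtain \<beta> where x: "x \<in> W" and \<beta>: "\<beta> \<in> P" "y = x \<circ> s \<beta>" "\<omega> = 0 \<or> \<omega> = coroot \<beta>"
    using cons(1) edge_iff[of x \<omega> y] by blast
  have x': "x = y \<circ> s \<beta>" by (simp add: \<beta>(2))
  from \<beta>(3) have "bounded (\<delta> + (\<omega> + \<omega>')) x"
  proof
    assume z: "\<omega> = 0"
    then have "len x < len (x \<circ> s \<beta>)" using edge_length[OF cons(1)] \<beta>(2) by simp
    then have "x \<preceq> y" using bruhat_step[OF x \<beta>(1)] len_reflection_iff(1)[OF x \<beta>(1)] \<beta>(2) by simp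
    then show ?thesis using bounded_lower[OF y] z by simp
  next
    assume z: "\<omega> = coroot \<beta>"
    have "x \<preceq> y \<star> s \<beta>"
      using x' dem_bound[OF bounded_weyl[OF y] pos_weyl[OF \<beta>(1)] bruhat_refl bruhat_refl] by simp
    then have "bounded (\<delta> + \<omega>' + coroot \<beta>) x" using bounded_lower[OF bounded_mult[OF y bounded_reflection[OF \<beta>(1)]]] by blast
    then show ?thesis using z by (simp add: ac_simps)
  qed
  then show ?case .
qed simp

lemma wt_le_iff:
  assumes "\<gamma> \<in> QC" "x \<in> W" shows "coroot_le \<Delta> (wt \<Phi> \<Delta> x id) \<gamma> \<longleftrightarrow> x \<preceq> top_elt \<gamma>"
proof
  assume le: "coroot_le \<Delta> (wt \<Phi> \<Delta> x id) \<gamma>"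
  obtain n \<omega> where "qpath x n \<omega> id" using path_to_id assms(2) by blast
  then obtain m where "qpath x m (wt \<Phi> \<Delta> x id) id" using wt_minimal(1) by blast
  then have "bounded (0 + wt \<Phi> \<Delta> x id) x" using path_bounded bounded_id[of 0] by blast
  then have "bounded \<gamma> x" using bounded_mono le by (simp add: coroot_le_def)
  then show "x \<preceq> top_elt \<gamma>" using good_top QC_good assms(1) by blast
next
  assume "x \<preceq> top_elt \<gamma>"
  then obtain n where n: "qpath x n 0 (top_elt \<gamma>)" using bruhat_path assms(2) by blast
  obtain m where "qpath (top_elt \<gamma>) m \<gamma> id" using path_from_top_elt assms(1) by blast
  then have "qpath x (n + m) (0 + \<gamma>) id" using n path_append by blast
  then show "coroot_le \<Delta> (wt \<Phi> \<Delta> x id) \<gamma>" using wt_minimal(2) by (simp add: coroot_le_def)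
qed

lemma z_elt_maximum:
  assumes "\<gamma> \<in> QC"
  shows "unique_maximal (\<preceq>) {x \<in> W. coroot_le \<Delta> (wt \<Phi> \<Delta> x id) \<gamma>} (z_elt \<Phi> \<Delta> \<gamma>)"
  unfolding z_elt_top_elt[OF assms]
  using good_weyl[OF QC_good[OF assms]] wt_le_iff[OF assms] by (intro unique_maximal_max) auto

end

theorem theorem3p7:
  fixes \<Phi> \<Delta> :: "'a::euclidean_space set" and \<gamma> :: 'a
  assumes "based_root_system \<Phi> \<Delta>"
    and "\<gamma> \<in> nat_cone (coroot ` \<Delta>)"
  shows "unique_maximal (bruhat_le \<Phi> \<Delta>)
           {x \<in> weyl_group \<Phi>. coroot_le \<Delta> (wt \<Phi> \<Delta> x id) \<gamma>}
           (z_elt \<Phi> \<Delta> \<gamma>)"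
proof -
  interpret based_root_system \<Phi> \<Delta> by fact
  show ?thesis using z_elt_maximum assms(2) .
qed

end
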